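(* Let $n\ge 1$. The modules $$\mathbb C\widetilde{\mathcal L}_E(\mathrm{id}_k)\bigotimes_{\mathbb CS_k}S^{\lambda},\qquad 0\le k\le n,\ \lambda\vdash k,$$ form a list of all the indecomposable projective modules of $\mathbb C\mathcal{PT}_n$ up to isomorphism.
   Context: $\mathcal{PT}_n$ is the monoid of all partial functions on $\{1,\dots,n\}$, with functions composed from right to left. For $A\subseteq\{1,\dots,n\}$, $\mathrm{id}_A$ is the partial identity on $A$; $\mathrm{id}_k=\mathrm{id}_{\{1,\dots,k\}}$; $E=\{\mathrm{id}_A\mid A\subseteq\{1,\dots,n\}\}$. The relation $\widetilde{\mathcal L}_E$ is: $a\,\widetilde{\mathcal L}_E\,b$ iff for all $e\in E$ ($ae=a\Leftrightarrow be=b$); in $\mathcal{PT}_n$ this means $\operatorname{dom}(a)=\operatorname{dom}(b)$. Thus $\widetilde{\mathcal L}_E(\mathrm{id}_k)$, the class of $\mathrm{id}_k$, consists of all $f\in\mathcal{PT}_n$ with $\operatorname{dom}(f)=\{1,\dots,k\}$. $\mathbb C\widetilde{\mathcal L}_E(\mathrm{id}_k)$ is the $\mathbb C$-vector space with this basis; it is a $\mathbb C\mathcal{PT}_n$-$\mathbb CS_k$-bimodule, where $s\in\mathcal{PT}_n$ acts on $x\in \widetilde{\mathcal L}_E(\mathrm{id}_k)$ by $s\cdot x=sx$ if $sx\in\widetilde{\mathcal L}_E(\mathrm{id}_k)$ and $0$ otherwise, and the symmetric group $S_k$ (the maximal subgroup with identity $\mathrm{id}_k$) acts by right multiplication. $S^{\lambda}$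 is the simple (Specht) $\mathbb CS_k$-module indexed by the partition $\lambda\vdash k$. Modules are finite dimensional left modules. *)

theory Defs
  imports Complex_Main "HOL-Algebra.Algebra"
begin

section \<open>Left modules over a not necessarily commutative ring\<close>

text \<open>The locale \<^locale>\<open>module\<close> of HOL-Algebra presupposes a commutative ring.\<close>

locale left_module = R?: ring R + M?: abelian_group M
  for R :: "('a, 'u) ring_scheme" (structure) and M :: "('a, 'b, 'v) module_scheme" (structure) +
  assumes smult_closed:
      "\<lbrakk>a \<in> carrier R; x \<in> carrier M\<rbrakk> \<Longrightarrow> a \<odot>\<^bsub>M\<^esub> x \<in> carrier M"
    and smult_l_distr:
      "\<lbrakk>a \<in> carrier R; b \<in> carrier R; x \<in> carrier M\<rbrakk> \<Longrightarrow>
        (a \<oplus>\<^bsub>R\<^esub> b) \<odot>\<^bsub>M\<^esub> x = a \<odot>\<^bsub>M\<^esub> x \<oplus>\<^bsub>M\<^esub> b \<odot>\<^bsub>M\<^esub> x"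
    and smult_r_distr:
      "\<lbrakk>a \<in> carrier R; x \<in> carrier M; y \<in> carrier M\<rbrakk> \<Longrightarrow>
        a \<odot>\<^bsub>M\<^esub> (x \<oplus>\<^bsub>M\<^esub> y) = a \<odot>\<^bsub>M\<^esub> x \<oplus>\<^bsub>M\<^esub> a \<odot>\<^bsub>M\<^esub> y"
    and smult_assoc:
      "\<lbrakk>a \<in> carrier R; b \<in> carrier R; x \<in> carrier M\<rbrakk> \<Longrightarrow>
        (a \<otimes>\<^bsub>R\<^esub> b) \<odot>\<^bsub>M\<^esub> x = a \<odot>\<^bsub>M\<^esub> (b \<odot>\<^bsub>M\<^esub> x)"
    and smult_one:
      "x \<in> carrier M \<Longrightarrow> \<one>\<^bsub>R\<^esub> \<odot>\<^bsub>M\<^esub> x = x"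

definition left_module_hom ::
    "'r ring \<Rightarrow> ('r, 'm) module \<Rightarrow> ('r, 'n) module \<Rightarrow> ('m \<Rightarrow> 'n) set" where
  "left_module_hom R M N = {h \<in> carrier M \<rightarrow> carrier N.
     (\<forall>x\<in>carrier M. \<forall>y\<in>carrier M. h (x \<oplus>\<^bsub>M\<^esub> y) = h x \<oplus>\<^bsub>N\<^esub> h y) \<and>
     (\<forall>a\<in>carrier R. \<forall>x\<in>carrier M. h (a \<odot>\<^bsub>M\<^esub> x) = a \<odot>\<^bsub>N\<^esub> h x)}"

definition left_module_iso :: "'r ring \<Rightarrow> ('r, 'm) module \<Rightarrow> ('r, 'n) module \<Rightarrow> bool" where
  "left_module_iso R M N \<longleftrightarrow>
     (\<exists>h\<in>left_module_hom R M N. bij_betw h (carrier M) (carrier N))"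

text \<open>\<^const>\<open>submodule\<close> and \<^const>\<open>set_add\<close> (the sum of two submodules)
  are those of HOL-Algebra; neither requires commutativity of the ring.\<close>

definition indecomposable_module :: "'r ring \<Rightarrow> ('r, 'm) module \<Rightarrow> bool" where
  "indecomposable_module R M \<longleftrightarrow>
     carrier M \<noteq> {\<zero>\<^bsub>M\<^esub>} \<and>
     (\<forall>U V. submodule U R M \<longrightarrow> submodule V R M \<longrightarrow>
        U \<inter> V = {\<zero>\<^bsub>M\<^esub>} \<longrightarrow> U <+>\<^bsub>M\<^esub> V = carrier M \<longrightarrow>
        U = {\<zero>\<^bsub>M\<^esub>} \<or> V = {\<zero>\<^bsub>M\<^esub>})"

text \<open>The lifting property of \<open>P\<close> against the surjections \<open>U \<rightarrow> V\<close>. HOL cannot quantify over the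
  types of \<open>U\<close> and \<open>V\<close> inside a definition, so these are parameters. Projectivity is
  this predicate for all types \<open>'u\<close> and \<open>'v\<close>.\<close>

definition projective_module ::
    "'u itself \<Rightarrow> 'v itself \<Rightarrow> 'r ring \<Rightarrow> ('r, 'p) module \<Rightarrow> bool" where
  "projective_module _ _ R P \<longleftrightarrow>
     (\<forall>(U :: ('r, 'u) module) (V :: ('r, 'v) module).
        left_module R U \<longrightarrow> left_module R V \<longrightarrow>
        (\<forall>g\<in>left_module_hom R U V. \<forall>h\<in>left_module_hom R P V.
           g ` carrier U = carrier V \<longrightarrow>
           (\<exists>h'\<in>left_module_hom R P U. \<forall>p\<in>carrier P. g (h' p) = h p)))"

section \<open>Tensor products\<close>

text \<open>\<open>M\<close> is an abelian group with left multiplications by a ring and a commuting right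
  action \<open>ract\<close> of \<open>R\<close>; \<open>N\<close> is a left \<open>R\<close>-module. The tensor product is the quotient of the free abelian
  group on \<open>carrier M \<times> carrier N\<close> by the usual relations, and a scalar \<open>a\<close> acts on the coset
  of \<open>(x, y)\<close> by sending it to the coset of \<open>(a x, y)\<close>. As in every additive structure of
  HOL-Algebra that is not a ring, the ring multiplication and unit fields are irrelevant.\<close>

definition tensor_relations ::
    "('a, 'm) module \<Rightarrow> ('m \<Rightarrow> 'r \<Rightarrow> 'm) \<Rightarrow> 'r ring \<Rightarrow> ('r, 'n) module \<Rightarrow> ('m \<times> 'n \<Rightarrow>\<^sub>0 int) set" where
  "tensor_relations M ract R N =
     {frag_of (x \<oplus>\<^bsub>M\<^esub> x', y) - frag_of (x, y) - frag_of (x', y) | x x' y.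
        x \<in> carrier M \<and> x' \<in> carrier M \<and> y \<in> carrier N} \<union>
     {frag_of (x, y \<oplus>\<^bsub>N\<^esub> y') - frag_of (x, y) - frag_of (x, y') | x y y'.
        x \<in> carrier M \<and> y \<in> carrier N \<and> y' \<in> carrier N} \<union>
     {frag_of (ract x r, y) - frag_of (x, r \<odot>\<^bsub>N\<^esub> y) | x r y.
        x \<in> carrier M \<and> r \<in> carrier R \<and> y \<in> carrier N}"

definition tensor_module ::
    "('a, 'm) module \<Rightarrow> ('m \<Rightarrow> 'r \<Rightarrow> 'm) \<Rightarrow> 'r ring \<Rightarrow> ('r, 'n) module \<Rightarrow>
     ('a, ('m \<times> 'n \<Rightarrow>\<^sub>0 int) set) module" where
  "tensor_module M ract R N =
     (let F = free_Abelian_group (carrier M \<times> carrier N);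
          K = generate F (tensor_relations M ract R N)
      in \<lparr>carrier = carrier (F Mod K),
          monoid.mult = undefined,
          monoid.one = undefined,
          ring.zero = \<one>\<^bsub>F Mod K\<^esub>,
          ring.add = (\<otimes>\<^bsub>F Mod K\<^esub>),
          smult = (\<lambda>a C. \<Union>c\<in>C. K #>\<^bsub>F\<^esub> frag_extend (\<lambda>(x, y). frag_of (a \<odot>\<^bsub>M\<^esub> x, y)) c)\<rparr>)"

section \<open>Algebras of finite monoids over the complex numbers\<close>

text \<open>For finite \<open>A\<close>, the space with basis \<open>A\<close> consists of the complex functions vanishing outside
  \<open>A\<close>. Given \<open>act\<close> on basis elements, \<open>bilinear_ext S A act a f\<close> is the bilinear extension, where
  \<open>act s x\<close> is read as \<open>0\<close> whenever it lies outside \<open>A\<close>.\<close>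

definition functions_on :: "'x set \<Rightarrow> ('x \<Rightarrow> complex) set" where
  "functions_on A = {f. \<forall>x. x \<notin> A \<longrightarrow> f x = 0}"

definition bilinear_ext ::
    "'s set \<Rightarrow> 'x set \<Rightarrow> ('s \<Rightarrow> 'x \<Rightarrow> 'x) \<Rightarrow> ('s \<Rightarrow> complex) \<Rightarrow> ('x \<Rightarrow> complex) \<Rightarrow> 'x \<Rightarrow> complex" where
  "bilinear_ext S A act a f =
     (\<lambda>y. if y \<in> A then \<Sum>s\<in>S. \<Sum>x\<in>A. if act s x = y then a s * f x else 0 else 0)"

definition monoid_algebra :: "'g monoid \<Rightarrow> ('g \<Rightarrow> complex) ring" where
  "monoid_algebra G =
     \<lparr>carrier = functions_on (carrier G),
      monoid.mult = bilinear_ext (carrier G) (carrier G) (\<otimes>\<^bsub>G\<^esub>),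
      monoid.one = (\<lambda>x. if x = \<one>\<^bsub>G\<^esub> then 1 else 0),
      ring.zero = (\<lambda>_. 0),
      ring.add = (\<lambda>a b x. a x + b x)\<rparr>"

text \<open>A complex number \<open>c\<close> acts on a module of the monoid algebra as \<open>c\<close> times the identity of the
  algebra.\<close>

definition finite_dimensional :: "'g monoid \<Rightarrow> ('g \<Rightarrow> complex, 'm) module \<Rightarrow> bool" where
  "finite_dimensional G M \<longleftrightarrow>
     (\<exists>B. finite B \<and> B \<subseteq> carrier M \<and>
        (\<forall>x\<in>carrier M. \<exists>c :: 'm \<Rightarrow> complex.
           x = (\<Oplus>\<^bsub>M\<^esub>b\<in>B. (\<lambda>g. c b * \<one>\<^bsub>monoid_algebra G\<^esub> g) \<odot>\<^bsub>M\<^esub> b)))"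

section \<open>The monoid of partial functions\<close>

definition partial_identity :: "nat set \<Rightarrow> nat \<rightharpoonup> nat" where
  "partial_identity A = Some |` A"

definition PT :: "nat \<Rightarrow> (nat \<rightharpoonup> nat) monoid" where
  "PT n = \<lparr>carrier = {f. dom f \<subseteq> {1..n} \<and> ran f \<subseteq> {1..n}},
           monoid.mult = (\<circ>\<^sub>m),
           monoid.one = partial_identity {1..n}\<rparr>"

definition E :: "nat \<Rightarrow> (nat \<rightharpoonup> nat) set" where
  "E n = partial_identity ` Pow {1..n}"

definition L_tilde :: "('g, 'z) monoid_scheme \<Rightarrow> 'g set \<Rightarrow> 'g \<Rightarrow> 'g \<Rightarrow> bool" where
  "L_tilde G I a b \<longleftrightarrow> (\<forall>e\<in>I. a \<otimes>\<^bsub>G\<^esub> e = a \<longleftrightarrow> b \<otimes>\<^bsub>G\<^esub> e = b)"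

definition L_class :: "nat \<Rightarrow> nat \<Rightarrow> (nat \<rightharpoonup> nat) set" where
  "L_class n k = {x \<in> carrier (PT n). L_tilde (PT n) (E n) x (partial_identity {1..k})}"

definition L_module :: "nat \<Rightarrow> nat \<Rightarrow> ((nat \<rightharpoonup> nat) \<Rightarrow> complex, (nat \<rightharpoonup> nat) \<Rightarrow> complex) module" where
  "L_module n k =
     \<lparr>carrier = functions_on (L_class n k),
      monoid.mult = undefined,
      monoid.one = undefined,
      ring.zero = (\<lambda>_. 0),
      ring.add = (\<lambda>f g x. f x + g x),
      smult = bilinear_ext (carrier (PT n)) (L_class n k) (\<otimes>\<^bsub>PT n\<^esub>)\<rparr>"

text \<open>The isomorphism from \<^term>\<open>sym_group k\<close> to the maximal subgroup of \<^term>\<open>PT n\<close> with identity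
  \<^term>\<open>partial_identity {1..k}\<close> is restriction to \<open>{1..k}\<close>.\<close>

definition L_right_action ::
    "nat \<Rightarrow> nat \<Rightarrow> ((nat \<rightharpoonup> nat) \<Rightarrow> complex) \<Rightarrow> ((nat \<Rightarrow> nat) \<Rightarrow> complex) \<Rightarrow> (nat \<rightharpoonup> nat) \<Rightarrow> complex" where
  "L_right_action n k f b =
     bilinear_ext (carrier (sym_group k)) (L_class n k)
       (\<lambda>p x. x \<otimes>\<^bsub>PT n\<^esub> ((Some \<circ> p) |` {1..k})) b f"

section \<open>Specht modules\<close>

definition is_partition :: "nat \<Rightarrow> nat list \<Rightarrow> bool" where
  "is_partition k \<mu> \<longleftrightarrow> sorted_wrt (\<ge>) \<mu> \<and> 0 \<notin> set \<mu> \<and> sum_list \<mu> = k"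

text \<open>Rows and columns are numbered from \<open>0\<close>. A tableau is relevant only through its values on the
  cells; a tabloid is encoded as the list of the sets of entries of its rows.\<close>

definition cells :: "nat list \<Rightarrow> (nat \<times> nat) set" where
  "cells \<mu> = {(i, j). i < length \<mu> \<and> j < \<mu> ! i}"

definition tableau :: "nat list \<Rightarrow> (nat \<times> nat \<Rightarrow> nat) \<Rightarrow> bool" where
  "tableau \<mu> t \<longleftrightarrow> bij_betw t (cells \<mu>) {1..sum_list \<mu>}"

definition tabloid_of :: "nat list \<Rightarrow> (nat \<times> nat \<Rightarrow> nat) \<Rightarrow> nat set list" where
  "tabloid_of \<mu> t = map (\<lambda>i. {t (i, j) | j. (i, j) \<in> cells \<mu>}) [0..<length \<mu>]"

definition tabloids :: "nat list \<Rightarrow> nat set list set" where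
  "tabloids \<mu> = {tabloid_of \<mu> t | t. tableau \<mu> t}"

definition perm_tabloid :: "(nat \<Rightarrow> nat) \<Rightarrow> nat set list \<Rightarrow> nat set list" where
  "perm_tabloid p T = map ((`) p) T"

definition column_stabilizer :: "nat list \<Rightarrow> (nat \<times> nat \<Rightarrow> nat) \<Rightarrow> (nat \<Rightarrow> nat) set" where
  "column_stabilizer \<mu> t =
     {p. p permutes {1..sum_list \<mu>} \<and>
         (\<forall>j. p ` {t (i, j) | i. (i, j) \<in> cells \<mu>} = {t (i, j) | i. (i, j) \<in> cells \<mu>})}"

definition polytabloid :: "nat list \<Rightarrow> (nat \<times> nat \<Rightarrow> nat) \<Rightarrow> nat set list \<Rightarrow> complex" where
  "polytabloid \<mu> t =
     (\<lambda>T. \<Sum>p\<in>column_stabilizer \<mu> t.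
        if perm_tabloid p (tabloid_of \<mu> t) = T then of_int (sign p) else 0)"

definition polytabloids :: "nat list \<Rightarrow> (nat set list \<Rightarrow> complex) set" where
  "polytabloids \<mu> = {polytabloid \<mu> t | t. tableau \<mu> t}"

text \<open>The Specht module is the complex span of the (finitely many) polytabloids inside the
  permutation module with basis the tabloids.\<close>

definition specht_module :: "nat list \<Rightarrow> ((nat \<Rightarrow> nat) \<Rightarrow> complex, nat set list \<Rightarrow> complex) module" where
  "specht_module \<mu> =
     \<lparr>carrier = {(\<lambda>T. \<Sum>e\<in>polytabloids \<mu>. c e * e T) | c. True},
      monoid.mult = undefined,
      monoid.one = undefined,
      ring.zero = (\<lambda>_. 0),
      ring.add = (\<lambda>f g T. f T + g T),
      smult = bilinear_ext (carrier (sym_group (sum_list \<mu>))) (tabloids \<mu>) perm_tabloid\<rparr>"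

section \<open>The induced modules\<close>

definition induced_module :: "nat \<Rightarrow> nat \<Rightarrow> nat list \<Rightarrow>
    ((nat \<rightharpoonup> nat) \<Rightarrow> complex,
     (((nat \<rightharpoonup> nat) \<Rightarrow> complex) \<times> (nat set list \<Rightarrow> complex) \<Rightarrow>\<^sub>0 int) set) module" where
  "induced_module n k \<mu> =
     tensor_module (L_module n k) (L_right_action n k) (monoid_algebra (sym_group k)) (specht_module \<mu>)"

end

theory Submission
  imports Defs "HOL-Library.Function_Algebras"
begin

text \<open>
  For \<open>B \<subseteq> {1..n}\<close> let \<open>f\<^sub>B = (\<Sum>D\<subseteq>B. (-1)^|B - D| id\<^sub>D)\<close>. For a partial function \<open>s\<close>, the element
  \<open>f\<^sub>C s f\<^sub>B\<close> is \<open>s f\<^sub>B\<close> if \<open>s\<close> maps \<open>B\<close> onto \<open>C\<close> and \<open>0\<close> otherwise. Hence the \<open>f\<^sub>B\<close> are orthogonal idempotents with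
  sum \<open>1\<close>, the \<open>k\<close>-th class module is isomorphic to \<open>A f\<^sub>k\<close> (where \<open>A\<close> is the monoid algebra), \<open>f\<^sub>k A f\<^sub>k\<close> is the
  group algebra of \<open>S\<^sub>k\<close>, and \<open>f\<^sub>l A f\<^sub>k = 0\<close> for \<open>k < l\<close>. If \<open>\<epsilon>\<close> is the self-adjoint Young idempotent
  proportional to \<open>a b a\<close> (\<open>a\<close> the row sum and \<open>b\<close> the signed column sum of a tableau), the Specht module is the left ideal
  generated by \<open>\<epsilon>\<close>, so that the induced module is \<open>A e\<close> for the idempotent \<open>e\<close> of \<open>A\<close> corresponding to \<open>\<epsilon>\<close>.
  It is projective, and indecomposable because \<open>e A e\<close> is one-dimensional.

  Conversely, let \<open>Q\<close> be indecomposable projective and \<open>k\<close> maximal with \<open>f\<^sub>k Q \<noteq> 0\<close>. As the Young idempotents of all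
  partitions of \<open>k\<close> generate the group algebra as a two-sided ideal (they yield as many orthogonal central elements as there
  are cycle types), some \<open>v = e v \<noteq> 0\<close> exists in \<open>Q\<close>. A dual basis of \<open>Q\<close> and the maximality of \<open>k\<close>
  produce a homomorphism \<open>Q \<rightarrow> A e\<close> mapping \<open>v\<close> to \<open>e\<close>; it splits \<open>x \<mapsto> x v\<close> and is therefore an isomorphism.
\<close>

section \<open>Convolution\<close>

text \<open>Two obstacles shape the proof. The tensor products are quotients of free abelian groups
  on large carriers, so every property is established for the left ideal of an idempotent and
  transported along an isomorphism; even the module axioms of the tensor product are obtained in
  this way. And semisimplicity of the group algebras enters only through positivity:
  \<open>a \<star> star a\<close> has at the identity the squared norm of \<open>a\<close>, so a
  nonzero self-adjoint element has a nonzero square. This is why the symmetrizer has the form a b a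
  and not a b: it is self-adjoint, its square is a nonzero multiple of itself, and for two shapes
  the vanishing of the row-column product in either order makes the symmetrizers orthogonal. In the
  converse, a coordinate of \<open>Q\<close> in \<open>f\<^sub>k A\<close> may have components in
  \<open>A f\<^sub>B\<close> for all sets \<open>B\<close> with at least \<open>k\<close> elements;
  maximality of \<open>k\<close> removes the larger ones and leaves the corner
  \<open>f\<^sub>k A f\<^sub>k\<close>, where multiplication by the adjoint yields a nonzero
  multiple of \<open>e\<close>.\<close>

definition scale_fun :: "complex \<Rightarrow> ('x \<Rightarrow> complex) \<Rightarrow> 'x \<Rightarrow> complex" (infixr \<open>*\<^sub>F\<close> 75)
  where "c *\<^sub>F f = (\<lambda>x. c * f x)"

definition delta :: "'x \<Rightarrow> 'x \<Rightarrow> complex"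
  where "delta g = (\<lambda>x. if x = g then 1 else 0)"

lemma delta_apply: "delta g x = (if x = g then 1 else 0)"
  by (simp add: delta_def)

lemma scale_fun_apply [simp]: "(c *\<^sub>F f) x = c * f x"
  by (simp add: scale_fun_def)

text \<open>Besides the scaling rules for computations with convolutions, this supplies span,
  independence and the bound on independent sets for the count of class functions.\<close>

interpretation fun_vs: vector_space scale_fun
  by standard (auto simp: fun_eq_iff algebra_simps)

lemma sum_fun_apply [simp]: "(\<Sum>i\<in>I. f i) x = (\<Sum>i\<in>I. f i x :: complex)"
  by (induction I rule: infinite_finite_induct) auto

lemma functions_on_closed [simp, intro]:
  "0 \<in> functions_on A"
  "f \<in> functions_on A \<Longrightarrow> g \<in> functions_on A \<Longrightarrow> f + g \<in> functions_on A"
  "f \<in> functions_on A \<Longrightarrow> c *\<^sub>F f \<in> functions_on A"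
  "f \<in> functions_on A \<Longrightarrow> - f \<in> functions_on A"
  "s \<in> A \<Longrightarrow> delta s \<in> functions_on A"
  by (auto simp: functions_on_def delta_def)

lemma functions_on_sum [intro]:
  "(\<And>i. i \<in> I \<Longrightarrow> f i \<in> functions_on A) \<Longrightarrow> (\<Sum>i\<in>I. f i) \<in> functions_on A"
  by (induction I rule: infinite_finite_induct) auto

lemma functions_on_expand:
  assumes "finite A" "f \<in> functions_on A"
  shows "f = (\<Sum>x\<in>A. f x *\<^sub>F delta x)"
proof
  fix y
  have "(\<Sum>x\<in>A. f x *\<^sub>F delta x) y = (\<Sum>x\<in>A. if x = y then f x else 0)"
    by (auto simp: delta_def intro!: sum.cong)
  then show "f y = (\<Sum>x\<in>A. f x *\<^sub>F delta x) y"
    using assms by (auto simp: functions_on_def)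
qed

lemma functions_on_eqI:
  assumes "f \<in> functions_on A" "g \<in> functions_on A" "\<And>x. x \<in> A \<Longrightarrow> f x = g x"
  shows "f = g"
proof
  fix x
  show "f x = g x"
    using assms by (cases "x \<in> A") (auto simp: functions_on_def)
qed

context
  fixes S :: "'s set" and A :: "'x set" and act :: "'s \<Rightarrow> 'x \<Rightarrow> 'x"
begin

text \<open>As a double sum of basis vectors the extension is visibly linear in both arguments; the
  truncation to \<open>A\<close> is confined to the basis vectors.\<close>

lemma bilinear_ext_eq:
  "bilinear_ext S A act a f =
    (\<Sum>s\<in>S. \<Sum>x\<in>A. (a s * f x) *\<^sub>F (if act s x \<in> A then delta (act s x) else 0))"
proof
  fix y
  show "bilinear_ext S A act a f y =
    (\<Sum>s\<in>S. \<Sum>x\<in>A. (a s * f x) *\<^sub>F (if act s x \<in> A then delta (act s x) else 0)) y"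
    by (auto simp: bilinear_ext_def delta_def intro!: sum.cong sum.neutral)
qed

lemma bilinear_ext_in [simp, intro]: "bilinear_ext S A act a f \<in> functions_on A"
  by (simp add: bilinear_ext_def functions_on_def)

lemma bilinear_ext_add:
  "bilinear_ext S A act (a + b) f = bilinear_ext S A act a f + bilinear_ext S A act b f"
  "bilinear_ext S A act a (f + g) = bilinear_ext S A act a f + bilinear_ext S A act a g"
  by (simp_all add: bilinear_ext_eq algebra_simps fun_vs.scale_left_distrib sum.distrib)

lemma bilinear_ext_scale:
  "bilinear_ext S A act (c *\<^sub>F a) f = c *\<^sub>F bilinear_ext S A act a f"
  "bilinear_ext S A act a (c *\<^sub>F f) = c *\<^sub>F bilinear_ext S A act a f"
  by (simp_all add: bilinear_ext_eq fun_vs.scale_sum_right mult_ac)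

lemma bilinear_ext_zero [simp]:
  "bilinear_ext S A act 0 f = 0" "bilinear_ext S A act a 0 = 0"
  by (simp_all add: bilinear_ext_eq)

lemma bilinear_ext_sum:
  "bilinear_ext S A act (\<Sum>i\<in>I. h i) f = (\<Sum>i\<in>I. bilinear_ext S A act (h i) f)"
  "bilinear_ext S A act a (\<Sum>i\<in>I. h' i) = (\<Sum>i\<in>I. bilinear_ext S A act a (h' i))"
  by (induction I rule: infinite_finite_induct) (simp_all add: bilinear_ext_add)

lemma bilinear_ext_delta_left:
  assumes "finite S" "s \<in> S"
  shows "bilinear_ext S A act (delta s) f =
    (\<Sum>x\<in>A. f x *\<^sub>F (if act s x \<in> A then delta (act s x) else 0))"
proof -
  have "bilinear_ext S A act (delta s) f =
     (\<Sum>s'\<in>S. if s' = s then (\<Sum>x\<in>A. f x *\<^sub>F (if act s x \<in> A then delta (act s x) else 0)) else 0)"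
    unfolding bilinear_ext_eq by (intro sum.cong) (auto simp: delta_def)
  then show ?thesis using assms by simp
qed

lemma bilinear_ext_delta:
  assumes "finite S" "s \<in> S" "finite A" "x \<in> A"
  shows "bilinear_ext S A act (delta s) (delta x) = (if act s x \<in> A then delta (act s x) else 0)"
proof -
  have "bilinear_ext S A act (delta s) (delta x) =
     (\<Sum>y\<in>A. if y = x then (if act s x \<in> A then delta (act s x) else 0) else 0)"
    unfolding bilinear_ext_delta_left[OF assms(1,2)] by (intro sum.cong) (auto simp: delta_def)
  then show ?thesis using assms by simp
qed

end

lemma bilinear_ext_minus [simp]:
  "bilinear_ext S A act (- a) f = - bilinear_ext S A act a f"
  "bilinear_ext S A act a (- f) = - bilinear_ext S A act a f"
  using bilinear_ext_scale(1)[of S A act "-1" a f] bilinear_ext_scale(2)[of S A act a "-1" f]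
  by simp_all

text \<open>Reading products outside \<open>A\<close> as zero is compatible with iterating the
  action as long as a point that has left \<open>A\<close> is not brought back by a further factor,
  which is what \<open>out\<close> demands.\<close>

lemma bilinear_ext_assoc:
  fixes a b :: "'s \<Rightarrow> complex" and f :: "'x \<Rightarrow> complex"
  assumes "finite S" "finite A"
    and cl: "\<And>s t. s \<in> S \<Longrightarrow> t \<in> S \<Longrightarrow> m s t \<in> S"
    and out: "\<And>s t x. s \<in> S \<Longrightarrow> t \<in> S \<Longrightarrow> x \<in> A \<Longrightarrow> act t x \<notin> A \<Longrightarrow> act (m s t) x \<notin> A"
    and act_mult: "\<And>s t x. s \<in> S \<Longrightarrow> t \<in> S \<Longrightarrow> x \<in> A \<Longrightarrow> act t x \<in> A \<Longrightarrow> act (m s t) x = act s (act t x)"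
  shows "bilinear_ext S A act (bilinear_ext S S m a b) f =
         bilinear_ext S A act a (bilinear_ext S A act b f)"
proof -
  define D where "D = (\<lambda>s x. if act s x \<in> A then delta (act s x) else (0 :: 'x \<Rightarrow> complex))"
  have "bilinear_ext S A act (bilinear_ext S S m a b) f =
      (\<Sum>s\<in>S. \<Sum>t\<in>S. (a s * b t) *\<^sub>F (bilinear_ext S A act (delta (m s t)) f))"
    unfolding bilinear_ext_eq[of S S m a b] bilinear_ext_sum bilinear_ext_scale
    by (intro sum.cong) (auto simp: cl)
  also have "\<dots> = (\<Sum>s\<in>S. \<Sum>t\<in>S. (a s * b t) *\<^sub>F (\<Sum>x\<in>A. f x *\<^sub>F D (m s t) x))"
    using assms by (intro sum.cong) (auto simp: bilinear_ext_delta_left D_def)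
  also have "\<dots> = (\<Sum>s\<in>S. \<Sum>t\<in>S. \<Sum>x\<in>A. (a s * b t * f x) *\<^sub>F D (m s t) x)"
    by (simp add: fun_vs.scale_sum_right)
  \<comment> \<open>If \<open>act t x\<close> lies outside \<open>A\<close>, then
    \<open>D t x\<close> is zero and \<open>out\<close> makes \<open>D (m s t) x\<close> zero as
    well; otherwise both sides are the truncated basis vector at
    \<open>act s (act t x)\<close>.\<close>
  also have "\<dots> = (\<Sum>s\<in>S. \<Sum>t\<in>S. \<Sum>x\<in>A. (a s * b t * f x) *\<^sub>F bilinear_ext S A act (delta s) (D t x))"
    using assms by (intro sum.cong) (auto simp: D_def bilinear_ext_delta)
  also have "\<dots> = (\<Sum>s\<in>S. a s *\<^sub>F bilinear_ext S A act (delta s) (\<Sum>t\<in>S. \<Sum>x\<in>A. (b t * f x) *\<^sub>F D t x))"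
    by (simp add: bilinear_ext_sum bilinear_ext_scale fun_vs.scale_sum_right mult.assoc)
  also have "\<dots> = (\<Sum>s\<in>S. a s *\<^sub>F bilinear_ext S A act (delta s) (bilinear_ext S A act b f))"
    unfolding bilinear_ext_eq[of S A act b f] D_def ..
  also have "\<dots> = bilinear_ext S A act (\<Sum>s\<in>S. a s *\<^sub>F delta s) (bilinear_ext S A act b f)"
    by (simp add: bilinear_ext_sum bilinear_ext_scale)
  also have "\<dots> = bilinear_ext S A act a (bilinear_ext S A act b f)"
  proof -
    have "(\<Sum>x\<in>S. a x *\<^sub>F delta x) s = a s" if "s \<in> S" for s
    proof -
      have "(\<Sum>x\<in>S. a x *\<^sub>F delta x) s = (\<Sum>x\<in>S. if x = s then a x else 0)"
        by (auto simp: delta_def intro!: sum.cong)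
      then show ?thesis using that \<open>finite S\<close> by simp
    qed
    then show ?thesis unfolding bilinear_ext_eq by (intro sum.cong) auto
  qed
  finally show ?thesis .
qed

lemma abelian_group_functions:
  fixes M :: "('x \<Rightarrow> complex, 'z) ring_scheme"
  assumes "\<zero>\<^bsub>M\<^esub> = 0" "ring.add M = (\<lambda>f g x. f x + g x)" "0 \<in> carrier M"
    and "\<And>f g. f \<in> carrier M \<Longrightarrow> g \<in> carrier M \<Longrightarrow> f + g \<in> carrier M"
    and "\<And>f. f \<in> carrier M \<Longrightarrow> - f \<in> carrier M"
  shows "abelian_group M"
proof (rule abelian_groupI)
  fix x y z assume "x \<in> carrier M" "y \<in> carrier M"
  then show "x \<oplus>\<^bsub>M\<^esub> y \<in> carrier M" using assms(4)[of x y] by (simp add: assms(2) plus_fun_def)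
next
  fix x assume "x \<in> carrier M"
  then show "\<exists>y\<in>carrier M. y \<oplus>\<^bsub>M\<^esub> x = \<zero>\<^bsub>M\<^esub>"
    using assms(5)[of x] by (auto simp: assms(1,2) fun_eq_iff intro!: bexI[of _ "- x"])
qed (auto simp: assms fun_eq_iff)

section \<open>The algebra of a finite monoid\<close>

locale finite_monoid = Group.monoid G for G :: "'a monoid" (structure) +
  assumes finite_carrier [simp]: "finite (carrier G)"
begin

abbreviation alg :: "('a \<Rightarrow> complex) set" where "alg \<equiv> functions_on (carrier G)"

abbreviation conv :: "('a \<Rightarrow> complex) \<Rightarrow> ('a \<Rightarrow> complex) \<Rightarrow> 'a \<Rightarrow> complex" (infixl \<open>\<star>\<close> 70)
  where "a \<star> b \<equiv> bilinear_ext (carrier G) (carrier G) (\<otimes>) a b"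

lemma conv_assoc: "a \<star> b \<star> c = a \<star> (b \<star> c)"
  by (rule bilinear_ext_assoc) (auto simp: m_assoc)

lemma conv_delta: "s \<in> carrier G \<Longrightarrow> t \<in> carrier G \<Longrightarrow> delta s \<star> delta t = delta (s \<otimes> t)"
  by (simp add: bilinear_ext_delta)

lemma conv_expand:
  assumes "a \<in> alg"
  shows "a \<star> b = (\<Sum>s\<in>carrier G. a s *\<^sub>F (delta s \<star> b))"
    and "b \<star> a = (\<Sum>s\<in>carrier G. a s *\<^sub>F (b \<star> delta s))"
  using arg_cong[OF functions_on_expand[OF finite_carrier assms], of "\<lambda>x. x \<star> b"]
        arg_cong[OF functions_on_expand[OF finite_carrier assms], of "\<lambda>x. b \<star> x"]
  by (simp_all add: bilinear_ext_sum bilinear_ext_scale)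

lemma conv_one [simp]:
  assumes "a \<in> alg"
  shows "delta \<one> \<star> a = a" "a \<star> delta \<one> = a"
proof -
  have "delta \<one> \<star> a = (\<Sum>s\<in>carrier G. a s *\<^sub>F (delta \<one> \<star> delta s))"
    by (rule conv_expand(2)[OF assms])
  then show "delta \<one> \<star> a = a"
    using functions_on_expand[OF finite_carrier assms] by (simp add: conv_delta)
  have "a \<star> delta \<one> = (\<Sum>s\<in>carrier G. a s *\<^sub>F (delta s \<star> delta \<one>))"
    by (rule conv_expand(1)[OF assms])
  then show "a \<star> delta \<one> = a"
    using functions_on_expand[OF finite_carrier assms] by (simp add: conv_delta)
qed

lemma monoid_algebra_simps [simp]:
  "carrier (monoid_algebra G) = alg"
  "a \<otimes>\<^bsub>monoid_algebra G\<^esub> b = a \<star> b"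
  "a \<oplus>\<^bsub>monoid_algebra G\<^esub> b = a + b"
  "\<zero>\<^bsub>monoid_algebra G\<^esub> = 0"
  "\<one>\<^bsub>monoid_algebra G\<^esub> = delta \<one>"
  by (simp_all add: monoid_algebra_def delta_def plus_fun_def zero_fun_def)

lemma ring_monoid_algebra: "ring (monoid_algebra G)"
proof (rule ringI)
  show "abelian_group (monoid_algebra G)"
    by (rule abelian_group_functions) (auto simp: monoid_algebra_def zero_fun_def functions_on_def)
  show "Group.monoid (monoid_algebra G)"
    by (rule monoidI) (auto simp: conv_assoc)
qed (auto simp: bilinear_ext_add)

end

section \<open>Modules generated by an idempotent\<close>

context left_module
begin

lemma smult_zero_right: "a \<in> carrier R \<Longrightarrow> a \<odot>\<^bsub>M\<^esub> \<zero>\<^bsub>M\<^esub> = \<zero>\<^bsub>M\<^esub>"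
  using smult_r_distr[of a "\<zero>\<^bsub>M\<^esub>" "\<zero>\<^bsub>M\<^esub>"] smult_closed[of a "\<zero>\<^bsub>M\<^esub>"]
  by (metis M.add.l_cancel_one M.zero_closed)

lemma smult_zero_left: "x \<in> carrier M \<Longrightarrow> \<zero> \<odot>\<^bsub>M\<^esub> x = \<zero>\<^bsub>M\<^esub>"
  using smult_l_distr[of \<zero> \<zero> x] smult_closed[of \<zero> x]
  by (metis M.add.l_cancel_one R.zero_closed R.l_zero)

text \<open>Negation is multiplication by minus one, so closure under scalars already yields the
  subgroup property.\<close>

lemma submoduleI:
  assumes "H \<subseteq> carrier M" "\<zero>\<^bsub>M\<^esub> \<in> H"
    and "\<And>x y. x \<in> H \<Longrightarrow> y \<in> H \<Longrightarrow> x \<oplus>\<^bsub>M\<^esub> y \<in> H"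
    and "\<And>a x. a \<in> carrier R \<Longrightarrow> x \<in> H \<Longrightarrow> a \<odot>\<^bsub>M\<^esub> x \<in> H"
  shows "submodule H R M"
proof (intro submodule.intro subgroup.intro submodule_axioms.intro)
  fix x assume x: "x \<in> H"
  have "(\<ominus> \<one>) \<odot>\<^bsub>M\<^esub> x \<oplus>\<^bsub>M\<^esub> x = (\<ominus> \<one> \<oplus> \<one>) \<odot>\<^bsub>M\<^esub> x"
    using x assms(1) smult_one[of x] by (subst smult_l_distr) auto
  also have "\<dots> = \<zero>\<^bsub>M\<^esub>"
    using x assms(1) by (auto simp: R.l_neg smult_zero_left)
  finally have "\<ominus>\<^bsub>M\<^esub> x = (\<ominus> \<one>) \<odot>\<^bsub>M\<^esub> x"
    using x assms(1) smult_closed by (intro M.minus_equality) auto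
  then show "inv\<^bsub>add_monoid M\<^esub> x \<in> H"
    using assms(4)[of "\<ominus> \<one>" x] x by (simp add: a_inv_def)
qed (use assms in auto)

end

lemma submoduleD:
  assumes "submodule H R M"
  shows "H \<subseteq> carrier M" "\<zero>\<^bsub>M\<^esub> \<in> H"
    and "\<And>x y. x \<in> H \<Longrightarrow> y \<in> H \<Longrightarrow> x \<oplus>\<^bsub>M\<^esub> y \<in> H"
    and "\<And>x. x \<in> H \<Longrightarrow> \<ominus>\<^bsub>M\<^esub> x \<in> H"
    and "\<And>a x. a \<in> carrier R \<Longrightarrow> x \<in> H \<Longrightarrow> a \<odot>\<^bsub>M\<^esub> x \<in> H"
proof -
  interpret subgroup H "add_monoid M" using assms by (rule submodule.axioms)
  show "H \<subseteq> carrier M" "\<zero>\<^bsub>M\<^esub> \<in> H" "\<And>x y. x \<in> H \<Longrightarrow> y \<in> H \<Longrightarrow> x \<oplus>\<^bsub>M\<^esub> y \<in> H"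
       "\<And>x. x \<in> H \<Longrightarrow> \<ominus>\<^bsub>M\<^esub> x \<in> H"
    using subset one_closed m_closed m_inv_closed by (auto simp: a_inv_def)
  show "\<And>a x. a \<in> carrier R \<Longrightarrow> x \<in> H \<Longrightarrow> a \<odot>\<^bsub>M\<^esub> x \<in> H"
    using assms by (rule submodule.smult_closed)
qed

lemma set_add_iff: "x \<in> A <+>\<^bsub>M\<^esub> B \<longleftrightarrow> (\<exists>a\<in>A. \<exists>b\<in>B. x = a \<oplus>\<^bsub>M\<^esub> b)"
  by (auto simp: set_add_def set_mult_def)

lemma left_module_homD:
  assumes "h \<in> left_module_hom R M N"
  shows "\<And>x. x \<in> carrier M \<Longrightarrow> h x \<in> carrier N"
    and "\<And>x y. x \<in> carrier M \<Longrightarrow> y \<in> carrier M \<Longrightarrow> h (x \<oplus>\<^bsub>M\<^esub> y) = h x \<oplus>\<^bsub>N\<^esub> h y"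
    and "\<And>a x. a \<in> carrier R \<Longrightarrow> x \<in> carrier M \<Longrightarrow> h (a \<odot>\<^bsub>M\<^esub> x) = a \<odot>\<^bsub>N\<^esub> h x"
  using assms by (auto simp: left_module_hom_def)

lemma left_module_homI:
  assumes "\<And>x. x \<in> carrier M \<Longrightarrow> h x \<in> carrier N"
    and "\<And>x y. x \<in> carrier M \<Longrightarrow> y \<in> carrier M \<Longrightarrow> h (x \<oplus>\<^bsub>M\<^esub> y) = h x \<oplus>\<^bsub>N\<^esub> h y"
    and "\<And>a x. a \<in> carrier R \<Longrightarrow> x \<in> carrier M \<Longrightarrow> h (a \<odot>\<^bsub>M\<^esub> x) = a \<odot>\<^bsub>N\<^esub> h x"
  shows "h \<in> left_module_hom R M N"
  using assms by (auto simp: left_module_hom_def)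

lemma left_module_hom_zero:
  assumes "left_module R M" "left_module R N" "h \<in> left_module_hom R M N"
  shows "h \<zero>\<^bsub>M\<^esub> = \<zero>\<^bsub>N\<^esub>"
proof -
  interpret M: left_module R M by fact
  interpret N: left_module R N by fact
  have "h (\<zero>\<^bsub>R\<^esub> \<odot>\<^bsub>M\<^esub> \<zero>\<^bsub>M\<^esub>) = \<zero>\<^bsub>R\<^esub> \<odot>\<^bsub>N\<^esub> h \<zero>\<^bsub>M\<^esub>"
    using assms(3) by (simp add: left_module_homD(3))
  then show ?thesis
    using left_module_homD(1)[OF assms(3)] by (simp add: M.smult_zero_left N.smult_zero_left)
qed

lemma left_module_hom_comp:
  assumes "f \<in> left_module_hom R M N" "g \<in> left_module_hom R N P"
  shows "g \<circ> f \<in> left_module_hom R M P"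
  using left_module_homD[OF assms(1)] left_module_homD[OF assms(2)]
  by (intro left_module_homI) auto

lemma left_module_hom_inv:
  assumes "left_module R M" "h \<in> left_module_hom R M N" "bij_betw h (carrier M) (carrier N)"
  shows "inv_into (carrier M) h \<in> left_module_hom R N M"
proof -
  interpret M: left_module R M by fact
  note h = left_module_homD[OF assms(2)]
  have inj: "inj_on h (carrier M)" and im: "carrier N = h ` carrier M"
    using assms(3) by (auto simp: bij_betw_def)
  show ?thesis
    by (rule left_module_homI)
       (auto simp: im inv_into_f_f[OF inj] h(2,3)[symmetric] M.smult_closed)
qed

lemma left_module_iso_sym:
  assumes "left_module R M" "left_module_iso R M N"
  shows "left_module_iso R N M"
  using assms left_module_hom_inv bij_betw_inv_into unfolding left_module_iso_def by blast

lemma left_module_iso_trans: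
  assumes "left_module_iso R M N" "left_module_iso R N P"
  shows "left_module_iso R M P"
  using assms left_module_hom_comp bij_betw_trans unfolding left_module_iso_def by blast

text \<open>No module axiom is assumed of \<open>N\<close>: a bijection compatible with the
  operations carries all of them over. The tensor product obtains its module structure in this way.
  The zero of \<open>N\<close> is a separate record field and has to be matched explicitly.\<close>

lemma left_module_transport:
  assumes M: "left_module R M" and h: "h \<in> left_module_hom R M N"
    and bij: "bij_betw h (carrier M) (carrier N)" and zero: "h \<zero>\<^bsub>M\<^esub> = \<zero>\<^bsub>N\<^esub>"
  shows "left_module R N"
proof -
  interpret M: left_module R M by fact
  note h = left_module_homD[OF h]
  have im: "carrier N = h ` carrier M"
    using bij by (auto simp: bij_betw_def)
  have "abelian_group N"
  proof (rule abelian_groupI)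
    fix x assume "x \<in> carrier N"
    then obtain x' where "x = h x'" "x' \<in> carrier M" by (auto simp: im)
    then show "\<exists>y\<in>carrier N. y \<oplus>\<^bsub>N\<^esub> x = \<zero>\<^bsub>N\<^esub>"
      by (intro bexI[of _ "h (\<ominus>\<^bsub>M\<^esub> x')"])
         (auto simp: h(1) h(2)[symmetric] zero M.M.l_neg)
  qed (auto simp: im h(2)[symmetric] zero[symmetric] M.M.a_ac)
  then show ?thesis
    by (intro left_module.intro left_module_axioms.intro M.ring_axioms)
       (auto simp: im h(2,3)[symmetric] M.smult_closed M.smult_l_distr M.smult_r_distr
          M.smult_assoc M.smult_one)
qed

lemma submodule_image:
  assumes "left_module R M" "left_module R N" "h \<in> left_module_hom R M N" "submodule U R M"
  shows "submodule (h ` U) R N"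
proof -
  interpret N: left_module R N by fact
  note h = left_module_homD[OF assms(3)] and U = submoduleD[OF assms(4)]
  note sub = subsetD[OF U(1)]
  have z: "h \<zero>\<^bsub>M\<^esub> = \<zero>\<^bsub>N\<^esub>" by (rule left_module_hom_zero[OF assms(1-3)])
  show ?thesis
    by (rule N.submoduleI)
       (use U(2-5) in \<open>auto simp: sub h(1) h(2,3)[symmetric] z[symmetric]\<close>)
qed

lemma indecomposable_transport:
  assumes M: "left_module R M" and N: "left_module R N" and iso: "left_module_iso R M N"
    and ind: "indecomposable_module R M"
  shows "indecomposable_module R N"
proof -
  interpret M: left_module R M by fact
  interpret N: left_module R N by fact
  obtain g where g: "g \<in> left_module_hom R N M" and bij: "bij_betw g (carrier N) (carrier M)"
    using left_module_iso_sym[OF M iso] by (auto simp: left_module_iso_def)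
  note gD = left_module_homD[OF g]
  have z: "g \<zero>\<^bsub>N\<^esub> = \<zero>\<^bsub>M\<^esub>" by (rule left_module_hom_zero[OF N M g])
  have inj: "inj_on g (carrier N)" and im: "carrier M = g ` carrier N"
    using bij by (auto simp: bij_betw_def)
  have inj0: "U = {\<zero>\<^bsub>N\<^esub>}" if "g ` U = {\<zero>\<^bsub>M\<^esub>}" "U \<subseteq> carrier N" for U
    using that inj inj_on_image_eq_iff[OF inj, of U "{\<zero>\<^bsub>N\<^esub>}"] z by auto
  show ?thesis
    unfolding indecomposable_module_def
  proof (intro conjI allI impI)
    show "carrier N \<noteq> {\<zero>\<^bsub>N\<^esub>}"
      using ind z im by (auto simp: indecomposable_module_def)
    fix U V assume U: "submodule U R N" and V: "submodule V R N"
      and int: "U \<inter> V = {\<zero>\<^bsub>N\<^esub>}" and sum: "U <+>\<^bsub>N\<^esub> V = carrier N"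
    note UD = submoduleD[OF U] and VD = submoduleD[OF V]
    have "g ` U \<inter> g ` V = {\<zero>\<^bsub>M\<^esub>}"
      using inj_on_image_Int[OF inj UD(1) VD(1)] int z by simp
    moreover have "g ` U <+>\<^bsub>M\<^esub> g ` V = carrier M"
    proof -
      have "g ` U <+>\<^bsub>M\<^esub> g ` V = g ` (U <+>\<^bsub>N\<^esub> V)"
      proof (intro subset_antisym subsetI)
        fix x assume "x \<in> g ` U <+>\<^bsub>M\<^esub> g ` V"
        then obtain u v where "u \<in> U" "v \<in> V" "x = g u \<oplus>\<^bsub>M\<^esub> g v" by (auto simp: set_add_iff)
        then show "x \<in> g ` (U <+>\<^bsub>N\<^esub> V)"
          using subsetD[OF UD(1), of u] subsetD[OF VD(1), of v] gD(2)[of u v] by (intro image_eqI[of _ _ "u \<oplus>\<^bsub>N\<^esub> v"]) (auto simp: set_add_iff)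
      next
        fix x assume "x \<in> g ` (U <+>\<^bsub>N\<^esub> V)"
        then obtain u v where "u \<in> U" "v \<in> V" "x = g (u \<oplus>\<^bsub>N\<^esub> v)" by (auto simp: set_add_iff)
        then show "x \<in> g ` U <+>\<^bsub>M\<^esub> g ` V"
          using subsetD[OF UD(1), of u] subsetD[OF VD(1), of v] gD(2)[of u v] by (auto simp: set_add_iff)
      qed
      then show ?thesis by (simp add: sum im)
    qed
    ultimately have "g ` U = {\<zero>\<^bsub>M\<^esub>} \<or> g ` V = {\<zero>\<^bsub>M\<^esub>}"
      using ind submodule_image[OF N M g U] submodule_image[OF N M g V]
      by (simp add: indecomposable_module_def)
    then show "U = {\<zero>\<^bsub>N\<^esub>} \<or> V = {\<zero>\<^bsub>N\<^esub>}"
      using inj0 UD(1) VD(1) by blast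
  qed
qed

lemma projective_transport:
  assumes M: "left_module R M" and iso: "left_module_iso R M N"
    and proj: "projective_module TYPE('u) TYPE('v) R M"
  shows "projective_module TYPE('u) TYPE('v) R N"
  unfolding projective_module_def
proof (intro allI impI ballI)
  fix U :: "('a, 'u) module" and V :: "('a, 'v) module" and g h
  assume *: "left_module R U" "left_module R V" "g \<in> left_module_hom R U V"
    "h \<in> left_module_hom R N V" "g ` carrier U = carrier V"
  obtain f where f: "f \<in> left_module_hom R M N" "bij_betw f (carrier M) (carrier N)"
    using iso by (auto simp: left_module_iso_def)
  let ?f' = "inv_into (carrier M) f"
  have f': "?f' \<in> left_module_hom R N M" by (rule left_module_hom_inv[OF M f])
  obtain h' where h': "h' \<in> left_module_hom R M U" "\<forall>p\<in>carrier M. g (h' p) = (h \<circ> f) p"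
    using proj * left_module_hom_comp[OF f(1) *(4)] unfolding projective_module_def by blast
  have "g ((h' \<circ> ?f') p) = h p" if "p \<in> carrier N" for p
    using h'(2) left_module_homD(1)[OF f' that] bij_betw_inv_into_right[OF f(2) that] by simp
  then show "\<exists>h'\<in>left_module_hom R N U. \<forall>p\<in>carrier N. g (h' p) = h p"
    using left_module_hom_comp[OF f' h'(1)] by blast
qed

section \<open>Left ideals generated by an idempotent\<close>

definition left_ideal :: "'r ring \<Rightarrow> 'r \<Rightarrow> ('r, 'r) module" where
  "left_ideal R e = \<lparr>carrier = {x \<otimes>\<^bsub>R\<^esub> e | x. x \<in> carrier R},
     monoid.mult = undefined, monoid.one = undefined,
     ring.zero = \<zero>\<^bsub>R\<^esub>, ring.add = (\<oplus>\<^bsub>R\<^esub>), smult = (\<otimes>\<^bsub>R\<^esub>)\<rparr>"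

lemma carrier_left_ideal: "carrier (left_ideal R e) = {x \<otimes>\<^bsub>R\<^esub> e | x. x \<in> carrier R}"
  by (simp add: left_ideal_def)

lemma left_ideal_simps [simp]:
  "\<zero>\<^bsub>left_ideal R e\<^esub> = \<zero>\<^bsub>R\<^esub>"
  "x \<oplus>\<^bsub>left_ideal R e\<^esub> y = x \<oplus>\<^bsub>R\<^esub> y"
  "x \<odot>\<^bsub>left_ideal R e\<^esub> y = x \<otimes>\<^bsub>R\<^esub> y"
  by (simp_all add: left_ideal_def)

locale ring_idempotent = ring R for R :: "'r ring" (structure) +
  fixes e
  assumes e_closed [simp]: "e \<in> carrier R" and e_idem [simp]: "e \<otimes> e = e"
begin

lemma left_ideal_iff [simp]: "x \<in> carrier (left_ideal R e) \<longleftrightarrow> x \<in> carrier R \<and> x \<otimes> e = x"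
  unfolding carrier_left_ideal by (auto simp: m_assoc intro!: exI[of _ x])

lemma e_in_left_ideal: "e \<in> carrier (left_ideal R e)"
  by simp

lemma left_ideal_closed: "x \<in> carrier (left_ideal R e) \<Longrightarrow> x \<in> carrier R"
  by simp

lemma left_ideal_mult_e: "x \<in> carrier (left_ideal R e) \<Longrightarrow> x \<otimes> e = x"
  by simp

lemma left_module_left_ideal: "left_module R (left_ideal R e)"
proof -
  have "abelian_group (left_ideal R e)"
  proof (rule abelian_groupI)
    fix x assume "x \<in> carrier (left_ideal R e)"
    then show "\<exists>y\<in>carrier (left_ideal R e). y \<oplus>\<^bsub>left_ideal R e\<^esub> x = \<zero>\<^bsub>left_ideal R e\<^esub>"
      by (intro bexI[of _ "\<ominus> x"]) (auto simp: l_minus l_neg)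
  qed (auto simp: l_distr a_ac)
  then show ?thesis
    by (intro left_module.intro left_module_axioms.intro ring_axioms)
       (auto simp: l_distr r_distr m_assoc)
qed

lemma hom_from_left_ideal:
  assumes "left_module R M" "h \<in> left_module_hom R (left_ideal R e) M" "x \<in> carrier (left_ideal R e)"
  shows "h x = x \<odot>\<^bsub>M\<^esub> h e"
  using left_module_homD(3)[OF assms(2) _ e_in_left_ideal, of x] assms(3)
  by (auto simp: left_ideal_iff)

lemma smult_hom:
  assumes "left_module R M" "u \<in> carrier M"
  shows "(\<lambda>x. x \<odot>\<^bsub>M\<^esub> u) \<in> left_module_hom R (left_ideal R e) M"
proof -
  interpret M: left_module R M by fact
  show ?thesis
    using assms(2)
    by (intro left_module_homI)
       (auto simp: left_ideal_iff M.smult_closed M.smult_l_distr M.smult_assoc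
        )
qed

text \<open>A homomorphism out of the left ideal sends \<open>p\<close> to \<open>p\<close> times
  the image of \<open>e\<close>, because \<open>p\<close> equals \<open>p \<otimes> e\<close>. Hence
  letting scalars act on any preimage of \<open>h e\<close> gives a lift.\<close>

lemma projective_left_ideal: "projective_module TYPE('u) TYPE('v) R (left_ideal R e)"
  unfolding projective_module_def
proof (intro allI impI ballI)
  fix U :: "('r, 'u) module" and V :: "('r, 'v) module" and g h
  assume U: "left_module R U" and V: "left_module R V" and g: "g \<in> left_module_hom R U V"
    and h: "h \<in> left_module_hom R (left_ideal R e) V" and surj: "g ` carrier U = carrier V"
  have "h e \<in> g ` carrier U"
    unfolding surj by (rule left_module_homD(1)[OF h e_in_left_ideal])
  then obtain u where u: "u \<in> carrier U" "g u = h e" by force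
  have lift: "g (p \<odot>\<^bsub>U\<^esub> u) = h p" if "p \<in> carrier (left_ideal R e)" for p
    using hom_from_left_ideal[OF V h that] left_module_homD(3)[OF g _ u(1), of p] that u(2)
    by (auto simp: left_ideal_iff)
  show "\<exists>h'\<in>left_module_hom R (left_ideal R e) U.
      \<forall>p\<in>carrier (left_ideal R e). g (h' p) = h p"
    by (intro bexI[OF _ smult_hom[OF U u(1)]] ballI lift)
qed

text \<open>By \<open>div\<close>, every nonzero element of the corner \<open>e R e\<close> can be
  multiplied from the left back to \<open>e\<close>. For \<open>e = u \<oplus> v\<close>, either
  \<open>e \<otimes> u\<close> is zero and \<open>e = e \<otimes> v\<close> lies in the second
  summand, or \<open>e\<close> is recovered from \<open>e \<otimes> u\<close> in the first; the
  summand containing \<open>e\<close> is everything.\<close>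

lemma indecomposable_left_ideal:
  assumes e0: "e \<noteq> \<zero>"
    and div: "\<And>x. x \<in> carrier R \<Longrightarrow> e \<otimes> x \<otimes> e = \<zero> \<or> (\<exists>y\<in>carrier R. y \<otimes> (e \<otimes> x \<otimes> e) = e)"
  shows "indecomposable_module R (left_ideal R e)"
  unfolding indecomposable_module_def
proof (intro conjI allI impI)
  let ?M = "left_ideal R e"
  show "carrier ?M \<noteq> {\<zero>\<^bsub>?M\<^esub>}"
    using e0 e_in_left_ideal by (metis left_ideal_simps(1) singletonD)
  fix U V assume U: "submodule U R ?M" and V: "submodule V R ?M"
    and int: "U \<inter> V = {\<zero>\<^bsub>?M\<^esub>}" and sum: "U <+>\<^bsub>?M\<^esub> V = carrier ?M"
  note UD = submoduleD[OF U] and VD = submoduleD[OF V]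
  have gen: "W = carrier ?M" if W: "submodule W R ?M" "e \<in> W" for W
  proof -
    have "x \<in> W" if "x \<in> carrier ?M" for x
      using submoduleD(5)[OF W(1) _ W(2), of x] left_ideal_mult_e[OF that] left_ideal_closed[OF that]
      by simp
    then show ?thesis using submoduleD(1)[OF W(1)] by blast
  qed
  obtain u v where uv: "u \<in> U" "v \<in> V" "e = u \<oplus> v"
    using sum e_in_left_ideal set_add_iff[where x = e and A = U and B = V and M = "left_ideal R e"] by auto
  have u: "u \<in> carrier R" "u \<otimes> e = u" and v: "v \<in> carrier R" "v \<otimes> e = v"
    using subsetD[OF UD(1) uv(1)] subsetD[OF VD(1) uv(2)] by simp_all
  have eu: "e \<otimes> u \<otimes> e = e \<otimes> u" using u by (simp add: m_assoc)
  show "U = {\<zero>\<^bsub>?M\<^esub>} \<or> V = {\<zero>\<^bsub>?M\<^esub>}"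
  proof (cases "e \<otimes> u = \<zero>")
    case True
    have "e = e \<otimes> (u \<oplus> v)" unfolding uv(3)[symmetric] by simp
    also have "\<dots> = e \<otimes> v" using u v True by (simp add: r_distr)
    finally have "e \<in> V" using VD(5)[OF e_closed uv(2)] by simp
    then show ?thesis using gen[OF V] int UD(1) by auto
  next
    case False
    then obtain y where y: "y \<in> carrier R" "y \<otimes> (e \<otimes> u) = e"
      using div[OF u(1)] unfolding eu by auto
    then have "e \<in> U" using UD(5)[OF y(1) UD(5)[OF e_closed uv(1)]] by simp
    then show ?thesis using gen[OF U] int VD(1) by auto
  qed
qed

text \<open>Homomorphisms between the two left ideals correspond to elements of
  \<open>e R e'\<close> by evaluation at \<open>e\<close>, and an injective one has a nonzero value
  there. This obstruction separates the modules of the list.\<close>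

lemma left_ideal_iso_nonzero:
  assumes "ring_idempotent R e'" "left_module_iso R (left_ideal R e) (left_ideal R e')" "e \<noteq> \<zero>"
  shows "\<exists>x\<in>carrier R. e \<otimes> x \<otimes> e' \<noteq> \<zero>"
proof -
  interpret e': ring_idempotent R e' by fact
  obtain h where h: "h \<in> left_module_hom R (left_ideal R e) (left_ideal R e')"
    and bij: "bij_betw h (carrier (left_ideal R e)) (carrier (left_ideal R e'))"
    using assms(2) unfolding left_module_iso_def by blast
  have he: "h e \<in> carrier R" "h e \<otimes> e' = h e"
    using left_module_homD(1)[OF h e_in_left_ideal] e'.left_ideal_iff by auto
  have "e \<otimes> h e \<otimes> e' = h e"
    using hom_from_left_ideal[OF e'.left_module_left_ideal h e_in_left_ideal] he
    by (simp add: m_assoc)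
  moreover have "h e \<noteq> \<zero>"
  proof
    assume "h e = \<zero>"
    moreover have "h \<zero> = \<zero>"
      using left_module_hom_zero[OF left_module_left_ideal e'.left_module_left_ideal h] by simp
    moreover have "\<zero> \<in> carrier (left_ideal R e)" by simp
    ultimately show False
      using bij assms(3) e_in_left_ideal by (metis bij_betw_imp_inj_on inj_on_contraD)
  qed
  ultimately show ?thesis using he by metis
qed

text \<open>The hypotheses make \<open>b\<close> a retraction of \<open>x \<mapsto> x v\<close>, so
  \<open>Q\<close> splits into the kernel of \<open>b\<close> and the image of that map. The image
  contains a preimage of \<open>e\<close> under \<open>b\<close> and is nonzero, hence the kernel
  vanishes.\<close>

lemma indecomposable_iso_left_ideal:
  assumes Q: "left_module R Q" and ind: "indecomposable_module R Q" and e0: "e \<noteq> \<zero>"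
    and v: "v \<in> carrier Q"
    and b: "b \<in> left_module_hom R Q (left_ideal R e)" and bv: "b v = e"
  shows "left_module_iso R Q (left_ideal R e)"
proof -
  interpret Q: left_module R Q by fact
  let ?P = "left_ideal R e"
  note bD = left_module_homD[OF b]
  have P: "left_module R ?P" by (rule left_module_left_ideal)
  have b0: "b \<zero>\<^bsub>Q\<^esub> = \<zero>" using left_module_hom_zero[OF Q P b] by simp
  define K where "K = {q \<in> carrier Q. b q = \<zero>}"
  define I where "I = (\<lambda>x. x \<odot>\<^bsub>Q\<^esub> v) ` carrier ?P"
  have K: "submodule K R Q"
    by (rule Q.submoduleI) (auto simp: K_def b0 bD(2,3) Q.smult_closed)
  have carrP: "submodule (carrier ?P) R ?P"
    by (rule left_module.submoduleI[OF P]) (auto simp: l_distr m_assoc)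
  have I: "submodule I R Q"
    unfolding I_def by (rule submodule_image[OF P Q smult_hom[OF Q v] carrP])
  have bI: "b (x \<odot>\<^bsub>Q\<^esub> v) = x" if "x \<in> carrier ?P" for x
    using bD(3)[of x v] v bv that by (simp add: left_ideal_iff)
  have "K \<inter> I = {\<zero>\<^bsub>Q\<^esub>}"
  proof -
    have "x \<odot>\<^bsub>Q\<^esub> v = \<zero>\<^bsub>Q\<^esub>" if "x \<in> carrier ?P" "b (x \<odot>\<^bsub>Q\<^esub> v) = \<zero>" for x
      using that bI[of x] Q.smult_zero_left[OF v] by simp
    then have "K \<inter> I \<subseteq> {\<zero>\<^bsub>Q\<^esub>}" by (auto simp: K_def I_def)
    then show ?thesis using submoduleD(2)[OF K] submoduleD(2)[OF I] by auto
  qed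
  moreover have "K <+>\<^bsub>Q\<^esub> I = carrier Q"
  proof -
    have "q \<in> K <+>\<^bsub>Q\<^esub> I" if q: "q \<in> carrier Q" for q
    proof -
      \<comment> \<open>The component of \<open>q\<close> in \<open>I\<close>. Its image under
        \<open>b\<close> is again \<open>b q\<close>, so subtracting it lands in the kernel.\<close>
      let ?i = "b q \<odot>\<^bsub>Q\<^esub> v"
      have bq: "b q \<in> carrier ?P" "b q \<in> carrier R"
        using bD(1)[OF q] left_ideal_closed by auto
      have i: "?i \<in> I" "?i \<in> carrier Q"
        using bq v Q.smult_closed by (auto simp: I_def)
      have i': "\<ominus>\<^bsub>Q\<^esub> ?i \<in> I" by (rule submoduleD(4)[OF I i(1)])
      have m: "b (\<ominus>\<^bsub>Q\<^esub> ?i) = \<ominus> (b q)"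
      proof -
        have "b (\<ominus>\<^bsub>Q\<^esub> ?i) \<oplus> b ?i = \<zero>"
          using bD(2)[of "\<ominus>\<^bsub>Q\<^esub> ?i" ?i] i b0 by (simp add: Q.M.l_neg)
        then show ?thesis
          unfolding bI[OF bq(1)]
          using bq left_ideal_closed[OF bD(1), of "\<ominus>\<^bsub>Q\<^esub> ?i"] i(2)
          by (metis Q.M.a_inv_closed minus_equality)
      qed
      have "q \<oplus>\<^bsub>Q\<^esub> \<ominus>\<^bsub>Q\<^esub> ?i \<in> K"
        using q i m bq by (simp add: K_def bD(2) r_neg)
      moreover have "q = (q \<oplus>\<^bsub>Q\<^esub> \<ominus>\<^bsub>Q\<^esub> ?i) \<oplus>\<^bsub>Q\<^esub> ?i"
        using q i by (simp add: Q.M.a_assoc Q.M.l_neg)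
      ultimately show ?thesis
        using i(1) unfolding set_add_iff by blast
    qed
    moreover have "K <+>\<^bsub>Q\<^esub> I \<subseteq> carrier Q"
      using submoduleD(1)[OF K] submoduleD(1)[OF I]
      by (auto simp: set_add_iff subset_iff)
    ultimately show ?thesis by blast
  qed
  ultimately have "K = {\<zero>\<^bsub>Q\<^esub>} \<or> I = {\<zero>\<^bsub>Q\<^esub>}"
    using ind K I by (simp add: indecomposable_module_def)
  moreover have "I \<noteq> {\<zero>\<^bsub>Q\<^esub>}"
  proof
    assume "I = {\<zero>\<^bsub>Q\<^esub>}"
    then have "e \<odot>\<^bsub>Q\<^esub> v = \<zero>\<^bsub>Q\<^esub>" using e_in_left_ideal unfolding I_def by blast
    then show False using bI[OF e_in_left_ideal] b0 e0 by simp
  qed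
  ultimately have K0: "K = {\<zero>\<^bsub>Q\<^esub>}" by blast
  have "inj_on b (carrier Q)"
  proof (rule inj_onI)
    fix x y assume x: "x \<in> carrier Q" and y: "y \<in> carrier Q" and eq: "b x = b y"
    have by': "b y \<in> carrier R" using left_ideal_closed[OF bD(1)[OF y]] .
    have "b (\<ominus>\<^bsub>Q\<^esub> y) \<oplus> b y = \<zero>"
      using bD(2)[of "\<ominus>\<^bsub>Q\<^esub> y" y] y b0 by (simp add: Q.M.l_neg)
    then have "x \<oplus>\<^bsub>Q\<^esub> \<ominus>\<^bsub>Q\<^esub> y \<in> K"
      using x y eq left_ideal_closed[OF bD(1), of "\<ominus>\<^bsub>Q\<^esub> y"] by' by (simp add: K_def bD(2) a_comm)
    then show "x = y"
      using K0 Q.M.minus_equality[of x "\<ominus>\<^bsub>Q\<^esub> y"] x y by simp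
  qed
  moreover have "b ` carrier Q = carrier ?P"
  proof
    show "carrier ?P \<subseteq> b ` carrier Q"
    proof
      fix x assume x: "x \<in> carrier ?P"
      show "x \<in> b ` carrier Q"
        by (rule image_eqI[of _ _ "x \<odot>\<^bsub>Q\<^esub> v"])
           (use bI[OF x] Q.smult_closed[OF left_ideal_closed[OF x] v] in simp_all)
    qed
  qed (use bD(1) in blast)
  ultimately show ?thesis
    using b unfolding left_module_iso_def bij_betw_def by blast
qed

end

section \<open>Recognising tensor products\<close>

text \<open>A balanced product \<open>\<phi>\<close> of \<open>M\<close> and \<open>N\<close> into \<open>P\<close> exhibits \<open>P\<close> as the tensor product as soon as
  \<open>y\<^sub>0\<close> generates \<open>N\<close> and \<open>\<chi>\<close> rewrites every pure tensor \<open>(x, y)\<close> into the form \<open>(\<chi> (\<phi> x y), y\<^sub>0)\<close>.\<close>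

locale tensor_recognition = P: left_module A P
  for A :: "'a ring" and P :: "('a, 'p) module" +
  fixes M :: "('a, 'm) module" and N :: "('r, 'n) module" and R :: "'r ring"
    and ract :: "'m \<Rightarrow> 'r \<Rightarrow> 'm" and \<phi> :: "'m \<Rightarrow> 'n \<Rightarrow> 'p" and y\<^sub>0 :: 'n and \<chi> :: "'p \<Rightarrow> 'm"
  assumes M_add: "\<And>x x'. x \<in> carrier M \<Longrightarrow> x' \<in> carrier M \<Longrightarrow> x \<oplus>\<^bsub>M\<^esub> x' \<in> carrier M"
    and M_smult: "\<And>a x. a \<in> carrier A \<Longrightarrow> x \<in> carrier M \<Longrightarrow> a \<odot>\<^bsub>M\<^esub> x \<in> carrier M"
    and M_distr: "\<And>a x x'. a \<in> carrier A \<Longrightarrow> x \<in> carrier M \<Longrightarrow> x' \<in> carrier M \<Longrightarrow>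
        a \<odot>\<^bsub>M\<^esub> (x \<oplus>\<^bsub>M\<^esub> x') = a \<odot>\<^bsub>M\<^esub> x \<oplus>\<^bsub>M\<^esub> a \<odot>\<^bsub>M\<^esub> x'"
    and M_ract: "\<And>x r. x \<in> carrier M \<Longrightarrow> r \<in> carrier R \<Longrightarrow> ract x r \<in> carrier M"
    and M_comm: "\<And>a x r. a \<in> carrier A \<Longrightarrow> x \<in> carrier M \<Longrightarrow> r \<in> carrier R \<Longrightarrow>
        a \<odot>\<^bsub>M\<^esub> ract x r = ract (a \<odot>\<^bsub>M\<^esub> x) r"
    and N_add: "\<And>y y'. y \<in> carrier N \<Longrightarrow> y' \<in> carrier N \<Longrightarrow> y \<oplus>\<^bsub>N\<^esub> y' \<in> carrier N"
    and N_smult: "\<And>r y. r \<in> carrier R \<Longrightarrow> y \<in> carrier N \<Longrightarrow> r \<odot>\<^bsub>N\<^esub> y \<in> carrier N"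
    and \<phi>_closed: "\<And>x y. x \<in> carrier M \<Longrightarrow> y \<in> carrier N \<Longrightarrow> \<phi> x y \<in> carrier P"
    and \<phi>_add_left: "\<And>x x' y. x \<in> carrier M \<Longrightarrow> x' \<in> carrier M \<Longrightarrow> y \<in> carrier N \<Longrightarrow>
        \<phi> (x \<oplus>\<^bsub>M\<^esub> x') y = \<phi> x y \<oplus>\<^bsub>P\<^esub> \<phi> x' y"
    and \<phi>_add_right: "\<And>x y y'. x \<in> carrier M \<Longrightarrow> y \<in> carrier N \<Longrightarrow> y' \<in> carrier N \<Longrightarrow>
        \<phi> x (y \<oplus>\<^bsub>N\<^esub> y') = \<phi> x y \<oplus>\<^bsub>P\<^esub> \<phi> x y'"
    and \<phi>_balanced: "\<And>x r y. x \<in> carrier M \<Longrightarrow> r \<in> carrier R \<Longrightarrow> y \<in> carrier N \<Longrightarrow>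
        \<phi> (ract x r) y = \<phi> x (r \<odot>\<^bsub>N\<^esub> y)"
    and y\<^sub>0: "y\<^sub>0 \<in> carrier N"
    and \<chi>_hom: "\<chi> \<in> left_module_hom A P M"
    and \<phi>_\<chi>: "\<And>p. p \<in> carrier P \<Longrightarrow> \<phi> (\<chi> p) y\<^sub>0 = p"
    and gen: "\<And>x y. x \<in> carrier M \<Longrightarrow> y \<in> carrier N \<Longrightarrow>
        \<exists>r\<in>carrier R. y = r \<odot>\<^bsub>N\<^esub> y\<^sub>0 \<and> \<chi> (\<phi> x y) = ract x r"
begin

definition "F = free_Abelian_group (carrier M \<times> carrier N)"
definition "Rel = tensor_relations M ract R N"
definition "K = generate F Rel"
definition "T = tensor_module M ract R N"
definition "fe a = frag_extend (\<lambda>(x, y). frag_of (a \<odot>\<^bsub>M\<^esub> x, y))" for a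
text \<open>The isomorphism is constructed from \<open>P\<close> into the tensor product: every
  coset turns out to have a representative of the normal form \<open>(\<chi> p, y\<^sub>0)\<close>,
  and the defining relations make this assignment additive.\<close>

definition "\<Psi> p = K #>\<^bsub>F\<^esub> frag_of (\<chi> p, y\<^sub>0)"

sublocale F: comm_group F
  unfolding F_def by (rule abelian_free_Abelian_group)

lemma F_simps [simp]: "x \<otimes>\<^bsub>F\<^esub> y = x + y" "\<one>\<^bsub>F\<^esub> = 0"
  by (simp_all add: F_def)

lemma frag_of_F [simp]: "frag_of (x, y) \<in> carrier F \<longleftrightarrow> x \<in> carrier M \<and> y \<in> carrier N"
  by (simp add: F_def)

lemma F_closed [simp]:
  "0 \<in> carrier F"
  "x \<in> carrier F \<Longrightarrow> y \<in> carrier F \<Longrightarrow> x + y \<in> carrier F"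
  "x \<in> carrier F \<Longrightarrow> y \<in> carrier F \<Longrightarrow> x - y \<in> carrier F"
  using F.m_closed[of x y] F.one_closed subset_trans[OF keys_diff[of x y]]
  by (auto simp: F_def)

lemma inv_F [simp]: "x \<in> carrier F \<Longrightarrow> inv\<^bsub>F\<^esub> x = - x"
  by (simp add: F_def)

lemma Rel_F: "Rel \<subseteq> carrier F"
  unfolding Rel_def tensor_relations_def using M_add N_add M_ract N_smult by auto

lemma K_subgroup: "subgroup K F"
  unfolding K_def by (rule F.generate_is_subgroup[OF Rel_F])

sublocale K: normal K F
  using K_subgroup by (rule F.subgroup_imp_normal)

lemma K_closed: "0 \<in> K" "x \<in> K \<Longrightarrow> y \<in> K \<Longrightarrow> x + y \<in> K" "x \<in> K \<Longrightarrow> - x \<in> K" "x \<in> K \<Longrightarrow> x \<in> carrier F"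
  using K.one_closed K.m_closed[of x y] K.m_inv_closed[of x] K.mem_carrier[of x] by auto

lemma coset_eq_iff:
  assumes "x \<in> carrier F" "y \<in> carrier F"
  shows "K #>\<^bsub>F\<^esub> x = K #>\<^bsub>F\<^esub> y \<longleftrightarrow> x - y \<in> K"
proof
  assume "K #>\<^bsub>F\<^esub> x = K #>\<^bsub>F\<^esub> y"
  then have "x \<in> K #>\<^bsub>F\<^esub> y" using F.rcos_self[OF assms(1) K_subgroup] by simp
  then show "x - y \<in> K" by (auto simp: r_coset_def)
next
  assume "x - y \<in> K"
  then have "x \<in> K #>\<^bsub>F\<^esub> y" by (force simp: r_coset_def)
  then show "K #>\<^bsub>F\<^esub> x = K #>\<^bsub>F\<^esub> y"
    using F.repr_independence[OF _ assms(2) K_subgroup] by simp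
qed

lemma Rel_K:
  "x \<in> carrier M \<Longrightarrow> x' \<in> carrier M \<Longrightarrow> y \<in> carrier N \<Longrightarrow>
    frag_of (x \<oplus>\<^bsub>M\<^esub> x', y) - frag_of (x, y) - frag_of (x', y) \<in> K"
  "x \<in> carrier M \<Longrightarrow> y \<in> carrier N \<Longrightarrow> y' \<in> carrier N \<Longrightarrow>
    frag_of (x, y \<oplus>\<^bsub>N\<^esub> y') - frag_of (x, y) - frag_of (x, y') \<in> K"
  "x \<in> carrier M \<Longrightarrow> r \<in> carrier R \<Longrightarrow> y \<in> carrier N \<Longrightarrow>
    frag_of (ract x r, y) - frag_of (x, r \<odot>\<^bsub>N\<^esub> y) \<in> K"
  unfolding K_def Rel_def tensor_relations_def by (rule generate.incl; blast)+

lemma fe_F: "a \<in> carrier A \<Longrightarrow> z \<in> carrier F \<Longrightarrow> fe a z \<in> carrier F"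
  using keys_frag_extend[of "\<lambda>(x, y). frag_of (a \<odot>\<^bsub>M\<^esub> x, y)" z] M_smult[of a]
  by (fastforce simp: fe_def F_def split: prod.splits)

lemma fe_simps [simp]:
  "fe a 0 = 0" "fe a (x + y) = fe a x + fe a y" "fe a (x - y) = fe a x - fe a y"
  "fe a (- x) = - fe a x" "fe a (frag_of (u, v)) = frag_of (a \<odot>\<^bsub>M\<^esub> u, v)"
  by (simp_all add: fe_def frag_extend_add frag_extend_diff frag_extend_minus)

text \<open>Well-definedness of the scalar action on cosets. The elements sent into \<open>K\<close>
  form a subgroup, so the three kinds of generators suffice; for the balancing relation the point is
  that the two actions on \<open>M\<close> commute.\<close>

lemma fe_K:
  assumes a: "a \<in> carrier A" and z: "z \<in> K"
  shows "fe a z \<in> K"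
proof -
  let ?H = "{z \<in> carrier F. fe a z \<in> K}"
  have "generate F Rel \<subseteq> ?H"
  proof (rule F.generate_subgroup_incl)
    show "subgroup ?H F"
    proof (rule F.subgroupI)
      show "?H \<noteq> {}" using K_closed(1) by (auto intro!: exI[of _ 0])
    next
      fix z assume z: "z \<in> ?H"
      then have "- z \<in> carrier F" using F.inv_closed[of z] by simp
      then show "inv\<^bsub>F\<^esub> z \<in> ?H" using z K_closed(3)[of "fe a z"] by simp
    next
      fix y z assume "y \<in> ?H" "z \<in> ?H"
      then show "y \<otimes>\<^bsub>F\<^esub> z \<in> ?H" using K_closed(2)[of "fe a y" "fe a z"] by simp
    qed auto
    show "Rel \<subseteq> ?H"
    proof
      fix z assume z: "z \<in> Rel"
      have "fe a z \<in> K"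
        using z unfolding Rel_def tensor_relations_def
      proof (elim UnE CollectE exE conjE)
        fix x x' y assume *: "z = frag_of (x \<oplus>\<^bsub>M\<^esub> x', y) - frag_of (x, y) - frag_of (x', y)"
          "x \<in> carrier M" "x' \<in> carrier M" "y \<in> carrier N"
        show ?thesis
          unfolding *(1) fe_simps M_distr[OF a *(2,3)]
          by (rule Rel_K(1)[OF M_smult[OF a *(2)] M_smult[OF a *(3)] *(4)])
      next
        fix x y y' assume *: "z = frag_of (x, y \<oplus>\<^bsub>N\<^esub> y') - frag_of (x, y) - frag_of (x, y')"
          "x \<in> carrier M" "y \<in> carrier N" "y' \<in> carrier N"
        show ?thesis
          unfolding *(1) fe_simps by (rule Rel_K(2)[OF M_smult[OF a *(2)] *(3,4)])
      next
        fix x r y assume *: "z = frag_of (ract x r, y) - frag_of (x, r \<odot>\<^bsub>N\<^esub> y)"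
          "x \<in> carrier M" "r \<in> carrier R" "y \<in> carrier N"
        show ?thesis
          unfolding *(1) fe_simps M_comm[OF a *(2,3)]
          by (rule Rel_K(3)[OF M_smult[OF a *(2)] *(3,4)])
      qed
      then show "z \<in> ?H" using Rel_F z by blast
    qed
  qed
  then show ?thesis using z unfolding K_def[symmetric] by blast
qed

lemma T_simps:
  "carrier T = rcosets\<^bsub>F\<^esub> K" "\<zero>\<^bsub>T\<^esub> = K" "x \<oplus>\<^bsub>T\<^esub> y = x <#>\<^bsub>F\<^esub> y"
  "a \<odot>\<^bsub>T\<^esub> C = (\<Union>c\<in>C. K #>\<^bsub>F\<^esub> fe a c)"
  unfolding T_def tensor_module_def F_def[symmetric] Rel_def[symmetric] K_def[symmetric] Let_def fe_def
  by (simp_all add: FactGroup_def)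

lemma T_add: "x \<in> carrier F \<Longrightarrow> y \<in> carrier F \<Longrightarrow>
    (K #>\<^bsub>F\<^esub> x) \<oplus>\<^bsub>T\<^esub> (K #>\<^bsub>F\<^esub> y) = K #>\<^bsub>F\<^esub> (x + y)"
  using K.rcos_sum[of x y] by (simp add: T_simps)

text \<open>The union over a coset in the definition of the tensor product is a union of equal sets:
  changing the member by an element of \<open>K\<close> changes its multiple by an element of
  \<open>K\<close>.\<close>

lemma T_smult:
  assumes a: "a \<in> carrier A" and z: "z \<in> carrier F"
  shows "a \<odot>\<^bsub>T\<^esub> (K #>\<^bsub>F\<^esub> z) = K #>\<^bsub>F\<^esub> fe a z"
proof -
  have const: "K #>\<^bsub>F\<^esub> fe a c = K #>\<^bsub>F\<^esub> fe a z" if c: "c \<in> K #>\<^bsub>F\<^esub> z" for c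
  proof -
    obtain k where k: "k \<in> K" "c = k + z" using c by (auto simp: r_coset_def)
    then show ?thesis
      using a z fe_K[OF a k(1)] by (subst coset_eq_iff) (auto simp: fe_F K_closed)
  qed
  have "z \<in> K #>\<^bsub>F\<^esub> z" by (rule F.rcos_self[OF z K_subgroup])
  with const show ?thesis unfolding T_simps(4) by blast
qed

lemmas \<chi>D = left_module_homD[OF \<chi>_hom]

lemma \<Psi>_closed: "p \<in> carrier P \<Longrightarrow> \<Psi> p \<in> carrier T"
  by (simp add: \<Psi>_def T_simps F.rcosetsI[OF K.subset] \<chi>D y\<^sub>0)

lemma \<Psi>_add:
  assumes "p \<in> carrier P" "q \<in> carrier P"
  shows "\<Psi> (p \<oplus>\<^bsub>P\<^esub> q) = \<Psi> p \<oplus>\<^bsub>T\<^esub> \<Psi> q"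
proof -
  have *: "\<chi> p \<in> carrier M" "\<chi> q \<in> carrier M" using assms \<chi>D(1) by auto
  have "frag_of (\<chi> p \<oplus>\<^bsub>M\<^esub> \<chi> q, y\<^sub>0) - (frag_of (\<chi> p, y\<^sub>0) + frag_of (\<chi> q, y\<^sub>0)) \<in> K"
    using Rel_K(1)[OF * y\<^sub>0] by (simp only: diff_diff_eq)
  then have "K #>\<^bsub>F\<^esub> frag_of (\<chi> p \<oplus>\<^bsub>M\<^esub> \<chi> q, y\<^sub>0) =
      K #>\<^bsub>F\<^esub> (frag_of (\<chi> p, y\<^sub>0) + frag_of (\<chi> q, y\<^sub>0))"
    using * y\<^sub>0 by (subst coset_eq_iff) (auto intro: M_add)
  then show ?thesis
    using * y\<^sub>0 by (simp only: \<Psi>_def \<chi>D(2)[OF assms] T_add frag_of_F)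
qed

lemma \<Psi>_smult: "a \<in> carrier A \<Longrightarrow> p \<in> carrier P \<Longrightarrow> \<Psi> (a \<odot>\<^bsub>P\<^esub> p) = a \<odot>\<^bsub>T\<^esub> \<Psi> p"
  by (simp add: \<Psi>_def \<chi>D y\<^sub>0 T_smult)

lemma \<Psi>_zero: "\<Psi> \<zero>\<^bsub>P\<^esub> = \<zero>\<^bsub>T\<^esub>"
proof -
  let ?f = "frag_of (\<chi> \<zero>\<^bsub>P\<^esub>, y\<^sub>0)"
  have f: "?f \<in> carrier F" using \<chi>D(1)[OF P.M.zero_closed] y\<^sub>0 by simp
  \<comment> \<open>Group axioms for the tensor product are not yet available, so cancellation takes
    place among representatives in \<open>F\<close>.\<close>
  have "K #>\<^bsub>F\<^esub> (?f + ?f) = K #>\<^bsub>F\<^esub> ?f"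
    using \<Psi>_add[of "\<zero>\<^bsub>P\<^esub>" "\<zero>\<^bsub>P\<^esub>"] f by (simp add: \<Psi>_def T_add)
  then have "K #>\<^bsub>F\<^esub> ?f = K #>\<^bsub>F\<^esub> 0"
    using f by (subst (asm) coset_eq_iff, simp_all, subst coset_eq_iff) simp_all
  then show ?thesis
    using F.coset_mult_one[OF K.subset] by (simp add: \<Psi>_def T_simps)
qed

text \<open>By \<open>gen\<close>, a pure tensor \<open>(x, y)\<close> is congruent to some
  \<open>(ract x r, y\<^sub>0)\<close>, and \<open>ract x r\<close> is the normal form
  \<open>\<chi> (\<phi> x y)\<close>. Differences are handled by additivity of
  \<open>\<Psi>\<close>.\<close>

lemma \<Psi>_surj:
  assumes "z \<in> carrier F"
  shows "\<exists>p\<in>carrier P. K #>\<^bsub>F\<^esub> z = \<Psi> p"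
proof -
  have "Poly_Mapping.keys z \<subseteq> carrier M \<times> carrier N" using assms by (simp add: F_def)
  then have "z \<in> carrier F \<and> (\<exists>p\<in>carrier P. K #>\<^bsub>F\<^esub> z = \<Psi> p)"
  proof (induction z rule: frag_induction)
    case zero
    then show ?case
      using \<Psi>_zero F.coset_mult_one[OF K.subset] by (auto simp: T_simps intro!: bexI[of _ "\<zero>\<^bsub>P\<^esub>"])
  next
    case (one z)
    then obtain x y where z: "z = (x, y)" and xy: "x \<in> carrier M" "y \<in> carrier N" by auto
    obtain r where r: "r \<in> carrier R" "y = r \<odot>\<^bsub>N\<^esub> y\<^sub>0" "\<chi> (\<phi> x y) = ract x r"
      using gen[OF xy] by blast
    have "frag_of (ract x r, y\<^sub>0) - frag_of (x, y) \<in> K"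
      using Rel_K(3)[OF xy(1) r(1) y\<^sub>0] r(2) by simp
    then have "\<Psi> (\<phi> x y) = K #>\<^bsub>F\<^esub> frag_of z"
      unfolding \<Psi>_def r(3) z using xy r(1) y\<^sub>0 by (subst coset_eq_iff) (auto simp: M_ract)
    then show ?case using xy by (auto simp: z \<phi>_closed intro!: bexI[of _ "\<phi> x y"])
  next
    case (diff a b)
    then obtain p q where pq: "p \<in> carrier P" "q \<in> carrier P" "K #>\<^bsub>F\<^esub> a = \<Psi> p" "K #>\<^bsub>F\<^esub> b = \<Psi> q"
      and ab: "a \<in> carrier F" "b \<in> carrier F" by blast
    let ?s = "p \<ominus>\<^bsub>P\<^esub> q"
    have s: "?s \<in> carrier P" "?s \<oplus>\<^bsub>P\<^esub> q = p"
      using pq by (auto simp: a_minus_def P.M.a_assoc P.M.l_neg)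
    have w: "frag_of (\<chi> ?s, y\<^sub>0) \<in> carrier F" using s y\<^sub>0 by (simp add: \<chi>D)
    have "\<Psi> ?s \<oplus>\<^bsub>T\<^esub> \<Psi> q = \<Psi> p"
      using \<Psi>_add[of ?s q] s pq by simp
    then have "K #>\<^bsub>F\<^esub> (frag_of (\<chi> ?s, y\<^sub>0) + b) = K #>\<^bsub>F\<^esub> a"
      using w ab by (simp add: pq(3,4)[symmetric] \<Psi>_def[of ?s] T_add)
    then have "K #>\<^bsub>F\<^esub> (a - b) = \<Psi> ?s"
      using w ab K_closed(3) unfolding \<Psi>_def
      by (simp add: coset_eq_iff eq_commute[of "K #>\<^bsub>F\<^esub> (a - b)"] algebra_simps)
    then show ?case using ab s by auto
  qed
  then show ?thesis by blast
qed

text \<open>The balanced map \<open>\<phi>\<close> extends to the free abelian group and kills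
  \<open>K\<close>; by \<open>\<phi>_\<chi>\<close> the extension sends the representative of
  \<open>\<Psi> p\<close> back to \<open>p\<close> and so provides a left inverse.\<close>

lemma \<Psi>_inj: "inj_on \<Psi> (carrier P)"
proof -
  obtain \<Phi> where \<Phi>: "\<Phi> \<in> hom F (add_monoid P)"
    and \<Phi>_of: "\<And>u. u \<in> carrier M \<times> carrier N \<Longrightarrow> \<Phi> (frag_of u) = \<phi> (fst u) (snd u)"
    by (rule comm_group.free_Abelian_group_universal[OF P.M.a_comm_group,
            of "\<lambda>u. \<phi> (fst u) (snd u)" "carrier M \<times> carrier N", folded F_def])
       (use \<phi>_closed in auto)
  interpret \<Phi>: group_hom F "add_monoid P" \<Phi>
    using \<Phi> by unfold_locales
  have \<Phi>_diff: "\<Phi> (u - v) = \<Phi> u \<oplus>\<^bsub>P\<^esub> \<ominus>\<^bsub>P\<^esub> \<Phi> v" if "u \<in> carrier F" "v \<in> carrier F" for u v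
  proof -
    have "\<Phi> u = \<Phi> (u - v) \<oplus>\<^bsub>P\<^esub> \<Phi> v"
      using \<Phi>.hom_mult[of "u - v" v] that by simp
    then show ?thesis
      using \<Phi>.hom_closed[of "u - v"] \<Phi>.hom_closed[of v] that by (simp add: P.M.a_assoc P.M.r_neg)
  qed
  have cancel: "u \<oplus>\<^bsub>P\<^esub> (v \<oplus>\<^bsub>P\<^esub> (\<ominus>\<^bsub>P\<^esub> u \<oplus>\<^bsub>P\<^esub> \<ominus>\<^bsub>P\<^esub> v)) = \<zero>\<^bsub>P\<^esub>"
    if "u \<in> carrier P" "v \<in> carrier P" for u v
    using P.M.r_neg[of "u \<oplus>\<^bsub>P\<^esub> v"] that by (simp add: P.M.a_assoc P.M.minus_add)
  have "K \<subseteq> kernel F (add_monoid P) \<Phi>"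
    unfolding K_def
  proof (rule F.generate_subgroup_incl[OF _ \<Phi>.subgroup_kernel])
    have "\<Phi> z = \<zero>\<^bsub>P\<^esub>" if "z \<in> Rel" for z
      using that unfolding Rel_def tensor_relations_def
      by (auto simp: \<Phi>_diff \<Phi>_of \<phi>_add_left \<phi>_add_right \<phi>_balanced M_add N_add M_ract N_smult
            \<phi>_closed P.M.a_ac P.M.r_neg cancel)
    then show "Rel \<subseteq> kernel F (add_monoid P) \<Phi>"
      using Rel_F by (auto simp: kernel_def)
  qed
  then have ker: "\<Phi> z = \<zero>\<^bsub>P\<^esub>" if "z \<in> K" for z
    using that by (auto simp: kernel_def)
  show ?thesis
  proof (rule inj_onI)
    fix p q assume pq: "p \<in> carrier P" "q \<in> carrier P" and eq: "\<Psi> p = \<Psi> q"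
    let ?p = "frag_of (\<chi> p, y\<^sub>0)" and ?q = "frag_of (\<chi> q, y\<^sub>0)"
    have F: "?p \<in> carrier F" "?q \<in> carrier F" using pq by (simp_all add: \<chi>D y\<^sub>0)
    have "\<Phi> (?p - ?q) = \<zero>\<^bsub>P\<^esub>"
      using eq F by (intro ker) (simp add: \<Psi>_def coset_eq_iff)
    then have "p \<oplus>\<^bsub>P\<^esub> \<ominus>\<^bsub>P\<^esub> q = \<zero>\<^bsub>P\<^esub>"
      using F pq by (simp add: \<Phi>_diff \<Phi>_of \<chi>D y\<^sub>0 \<phi>_\<chi>)
    then show "p = q"
      using P.M.minus_equality[of p "\<ominus>\<^bsub>P\<^esub> q"] pq by simp
  qed
qed

lemma \<Psi>_hom: "\<Psi> \<in> left_module_hom A P T"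
  by (intro left_module_homI \<Psi>_closed \<Psi>_add \<Psi>_smult)

lemma \<Psi>_bij: "bij_betw \<Psi> (carrier P) (carrier T)"
proof -
  have "carrier T \<subseteq> \<Psi> ` carrier P"
    using \<Psi>_surj by (fastforce simp: T_simps RCOSETS_def)
  then show ?thesis
    using \<Psi>_inj \<Psi>_closed by (auto simp: bij_betw_def)
qed

theorem left_module_tensor: "left_module A (tensor_module M ract R N)"
  using left_module_transport[OF P.left_module_axioms \<Psi>_hom \<Psi>_bij \<Psi>_zero] by (simp add: T_def)

theorem tensor_iso: "left_module_iso A P (tensor_module M ract R N)"
  using \<Psi>_hom \<Psi>_bij unfolding left_module_iso_def T_def by blast

end

section \<open>Group algebras\<close>

locale finite_group = finite_monoid + group
begin

text \<open>The adjoint in the group algebra: \<open>(a \<star> star b) \<one>\<close> is the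
  standard Hermitian inner product of \<open>a\<close> and \<open>b\<close>.\<close>

definition star :: "('a \<Rightarrow> complex) \<Rightarrow> 'a \<Rightarrow> complex"
  where "star a = (\<lambda>g. if g \<in> carrier G then cnj (a (inv g)) else 0)"

lemma star_in [simp, intro]: "star a \<in> alg"
  by (simp add: star_def functions_on_def)

lemma star_star: "a \<in> alg \<Longrightarrow> star (star a) = a"
  by (rule functions_on_eqI[of _ "carrier G"]) (auto simp: star_def functions_on_def)

lemma star_delta: "g \<in> carrier G \<Longrightarrow> star (delta g) = delta (inv g)"
  by (rule functions_on_eqI[of _ "carrier G"]) (auto simp: star_def delta_def functions_on_def)

lemma star_scale: "star (c *\<^sub>F a) = cnj c *\<^sub>F star a"
  by (auto simp: star_def fun_eq_iff)

lemma star_sum: "star (\<Sum>i\<in>I. f i) = (\<Sum>i\<in>I. star (f i))"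
  by (auto simp: star_def fun_eq_iff)

lemma star_conv: "star (a \<star> b) = star b \<star> star a"
proof (rule functions_on_eqI[of _ "carrier G"])
  fix y assume y: "y \<in> carrier G"
  have bij: "bij_betw (\<lambda>g. inv g) (carrier G) (carrier G)"
    by (rule bij_betw_byWitness[where f' = "\<lambda>g. inv g"]) auto
  have r: "(\<Sum>s\<in>carrier G. F s) = (\<Sum>s\<in>carrier G. F (inv s))" for F :: "'a \<Rightarrow> complex"
    by (rule sum.reindex_bij_betw[OF bij, symmetric])
  have "star (a \<star> b) y = (\<Sum>s\<in>carrier G. \<Sum>x\<in>carrier G. if s \<otimes> x = inv y then cnj (a s) * cnj (b x) else 0)"
    using y by (simp add: star_def bilinear_ext_def if_distrib[of cnj] cong: if_cong)
  also have "\<dots> = (\<Sum>s\<in>carrier G. \<Sum>x\<in>carrier G. if inv s \<otimes> inv x = inv y then cnj (a (inv s)) * cnj (b (inv x)) else 0)"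
    by (subst r, rule sum.cong[OF refl], subst r) (rule refl)
  also have "\<dots> = (\<Sum>s\<in>carrier G. \<Sum>x\<in>carrier G. if x \<otimes> s = y then cnj (a (inv s)) * cnj (b (inv x)) else 0)"
  proof (intro sum.cong refl if_cong)
    fix s x assume "s \<in> carrier G" "x \<in> carrier G"
    then show "inv s \<otimes> inv x = inv y \<longleftrightarrow> x \<otimes> s = y"
      using y by (metis inv_mult_group inv_inv m_closed)
  qed
  also have "\<dots> = (\<Sum>x\<in>carrier G. \<Sum>s\<in>carrier G. if x \<otimes> s = y then star b x * star a s else 0)"
    by (subst sum.swap) (auto simp: star_def intro!: sum.cong)
  also have "\<dots> = (star b \<star> star a) y"
    using y by (simp add: bilinear_ext_def)
  finally show "star (a \<star> b) y = (star b \<star> star a) y" .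
qed auto

lemma conv_star_one: "(a \<star> star a) \<one> = of_real (\<Sum>g\<in>carrier G. (cmod (a g))\<^sup>2)"
proof -
  have "(a \<star> star a) \<one> = (\<Sum>s\<in>carrier G. \<Sum>x\<in>carrier G. if s \<otimes> x = \<one> then a s * star a x else 0)"
    by (simp add: bilinear_ext_def)
  also have "\<dots> = (\<Sum>s\<in>carrier G. \<Sum>x\<in>carrier G. if x = inv s then a s * star a x else 0)"
    by (intro sum.cong refl if_cong) (auto simp: inv_equality inv_comm r_inv dest: inv_comm)
  also have "\<dots> = (\<Sum>s\<in>carrier G. of_real ((cmod (a s))\<^sup>2))"
    by (intro sum.cong) (auto simp: star_def complex_norm_square simp del: of_real_power)
  finally show ?thesis by simp
qed

text \<open>The coefficient at the identity is the sum of the squared absolute values of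
  \<open>a\<close>. This positivity is the source of semisimplicity in all that follows.\<close>

lemma conv_star_eq_0_iff:
  assumes "a \<in> alg"
  shows "(a \<star> star a) \<one> = 0 \<longleftrightarrow> a = 0"
proof -
  have "(a \<star> star a) \<one> = 0 \<longleftrightarrow> (\<Sum>g\<in>carrier G. (cmod (a g))\<^sup>2) = 0"
    unfolding conv_star_one by (rule of_real_eq_0_iff)
  also have "\<dots> \<longleftrightarrow> (\<forall>g\<in>carrier G. a g = 0)"
    by (simp add: sum_nonneg_eq_0_iff)
  also have "\<dots> \<longleftrightarrow> a = 0"
    using assms by (auto simp: functions_on_def fun_eq_iff)
  finally show ?thesis .
qed

text \<open>An average over conjugates without the division by the group order; it produces class
  functions, that is, central elements.\<close>

definition conj_sum :: "('a \<Rightarrow> complex) \<Rightarrow> 'a \<Rightarrow> complex"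
  where "conj_sum a = (\<Sum>g\<in>carrier G. delta g \<star> a \<star> delta (inv g))"

lemma conj_sum_in [simp, intro]: "conj_sum a \<in> alg"
  unfolding conj_sum_def by auto

lemma conj_delta_apply:
  assumes "a \<in> alg" "g \<in> carrier G" "y \<in> carrier G"
  shows "(delta g \<star> a \<star> delta (inv g)) y = a (inv g \<otimes> y \<otimes> g)"
proof -
  have "(delta g \<star> a \<star> delta (inv g)) y =
      (\<Sum>s\<in>carrier G. a s * (if y = g \<otimes> s \<otimes> inv g then 1 else 0))"
    using assms by (subst conv_expand(2)[of a "delta g"])
      (auto simp: bilinear_ext_sum bilinear_ext_scale conv_delta delta_apply intro!: sum.cong)
  also have "\<dots> = (\<Sum>s\<in>carrier G. if s = inv g \<otimes> y \<otimes> g then a s else 0)"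
  proof (intro sum.cong refl)
    fix s assume s: "s \<in> carrier G"
    have "y = g \<otimes> s \<otimes> inv g \<longleftrightarrow> s = inv g \<otimes> y \<otimes> g"
      using assms s by (metis inv_closed inv_solve_left inv_solve_right m_assoc m_closed)
    then show "a s * (if y = g \<otimes> s \<otimes> inv g then 1 else 0) = (if s = inv g \<otimes> y \<otimes> g then a s else 0)"
      by simp
  qed
  finally show ?thesis using assms by simp
qed

lemma conj_sum_apply:
  "a \<in> alg \<Longrightarrow> y \<in> carrier G \<Longrightarrow> conj_sum a y = (\<Sum>g\<in>carrier G. a (inv g \<otimes> y \<otimes> g))"
  by (simp add: conj_sum_def conj_delta_apply)

lemma conj_sum_one: "a \<in> alg \<Longrightarrow> conj_sum a \<one> = of_nat (card (carrier G)) * a \<one>"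
  by (simp add: conj_sum_apply)

lemma conj_sum_class_function:
  assumes "a \<in> alg" "y \<in> carrier G" "h \<in> carrier G"
  shows "conj_sum a (h \<otimes> y \<otimes> inv h) = conj_sum a y"
proof -
  have bij: "bij_betw (\<lambda>g. h \<otimes> g) (carrier G) (carrier G)"
    by (rule bij_betw_byWitness[where f' = "\<lambda>g. inv h \<otimes> g"]) (use assms in \<open>auto simp: m_assoc[symmetric]\<close>)
  have "conj_sum a (h \<otimes> y \<otimes> inv h) = (\<Sum>g\<in>carrier G. a (inv (h \<otimes> g) \<otimes> (h \<otimes> y \<otimes> inv h) \<otimes> (h \<otimes> g)))"
    using assms by (simp add: conj_sum_apply
      sum.reindex_bij_betw[OF bij, of "\<lambda>g. a (inv g \<otimes> (h \<otimes> y \<otimes> inv h) \<otimes> g)"])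
  also have "\<dots> = (\<Sum>g\<in>carrier G. a (inv g \<otimes> y \<otimes> g))"
  proof (intro sum.cong refl arg_cong[of _ _ a])
    fix g assume g: "g \<in> carrier G"
    have cancel: "inv h \<otimes> (h \<otimes> u) = u" if "u \<in> carrier G" for u
      using assms that by (simp add: m_assoc[symmetric])
    show "inv (h \<otimes> g) \<otimes> (h \<otimes> y \<otimes> inv h) \<otimes> (h \<otimes> g) = inv g \<otimes> y \<otimes> g"
      using assms g by (simp add: inv_mult_group m_assoc cancel)
  qed
  finally show ?thesis using assms by (simp add: conj_sum_apply)
qed

lemma star_conj_sum: "star (conj_sum a) = conj_sum (star a)"
  by (simp add: conj_sum_def star_sum star_conv star_delta conv_assoc)

end

section \<open>Young symmetrizers\<close>

text \<open>With the row index or the column index of an entry for \<open>r\<close> this is the row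
  group or the column group of a tableau, so one set of closure lemmas serves both.\<close>

definition fibre_stabilizer :: "nat \<Rightarrow> (nat \<Rightarrow> nat) \<Rightarrow> (nat \<Rightarrow> nat) set"
  where "fibre_stabilizer k r = {p. p permutes {1..k} \<and> (\<forall>x\<in>{1..k}. r (p x) = r x)}"

locale symmetric_group_algebra =
  fixes k :: nat
begin

sublocale finite_group "sym_group k"
  by (intro finite_group.intro finite_monoid.intro finite_monoid_axioms.intro sym_group_is_group
        group.is_monoid) (simp add: sym_group_def finite_permutations)

declare One_nat_def [simp del]

notation conv (infixl \<open>\<star>\<close> 70)

lemma sym_group_simps [simp]:
  "p \<in> carrier (sym_group k) \<longleftrightarrow> p permutes {1..k}"
  "p \<otimes>\<^bsub>sym_group k\<^esub> q = p \<circ> q" "\<one>\<^bsub>sym_group k\<^esub> = id"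
  by (simp_all add: sym_group_carrier sym_group_mult sym_group_one)

lemma inv_sym_group [simp]:
  assumes "p permutes {1..k}"
  shows "inv\<^bsub>sym_group k\<^esub> p = inv' p"
  using assms by (intro inv_equality) (simp_all add: permutes_inv permutes_inv_o)

abbreviation "stab \<equiv> fibre_stabilizer k"

lemma finite_stab [simp]: "finite (stab r)"
  by (rule finite_subset[OF _ finite_permutations[of "{1..k}"]]) (auto simp: fibre_stabilizer_def)

lemma stab_permutes: "p \<in> stab r \<Longrightarrow> p permutes {1..k}"
  by (simp add: fibre_stabilizer_def)

lemma stab_apply:
  assumes "p \<in> stab r" "x \<in> {1..k}"
  shows "p x \<in> {1..k}" "r (p x) = r x"
  using assms permutes_in_image[OF stab_permutes[OF assms(1)], of x]
  unfolding fibre_stabilizer_def by blast+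

lemma stabI: "p permutes {1..k} \<Longrightarrow> (\<And>x. x \<in> {1..k} \<Longrightarrow> r (p x) = r x) \<Longrightarrow> p \<in> stab r"
  unfolding fibre_stabilizer_def by blast

lemma stab_comp: "p \<in> stab r \<Longrightarrow> q \<in> stab r \<Longrightarrow> p \<circ> q \<in> stab r"
  by (rule stabI) (metis permutes_compose stab_permutes, metis comp_apply stab_apply)

lemma stab_inv:
  assumes "p \<in> stab r"
  shows "inv' p \<in> stab r"
proof -
  have p: "p permutes {1..k}" using assms by (rule stab_permutes)
  have "r (inv' p x) = r x" if "x \<in> {1..k}" for x
  proof -
    have "inv' p x \<in> {1..k}" using that permutes_in_image[OF permutes_inv[OF p]] by blast
    then have "r (p (inv' p x)) = r (inv' p x)" by (rule stab_apply(2)[OF assms])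
    then show ?thesis by (simp add: permutes_inverses(1)[OF p])
  qed
  then show ?thesis using permutes_inv[OF p] by (intro stabI)
qed

lemma id_stab [simp]: "id \<in> stab r"
  by (simp add: fibre_stabilizer_def permutes_id)

lemma stab_bij:
  assumes "p \<in> stab r"
  shows "bij_betw (\<lambda>q. p \<circ> q) (stab r) (stab r)" "bij_betw (\<lambda>q. q \<circ> p) (stab r) (stab r)"
    "bij_betw inv' (stab r) (stab r)"
proof -
  have p: "p permutes {1..k}" using assms by (rule stab_permutes)
  show "bij_betw (\<lambda>q. p \<circ> q) (stab r) (stab r)"
    by (rule bij_betw_byWitness[where f' = "\<lambda>q. inv' p \<circ> q"])
       (use assms stab_comp stab_inv permutes_inv_o[OF p] in \<open>auto simp: o_assoc\<close>)
  show "bij_betw (\<lambda>q. q \<circ> p) (stab r) (stab r)"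
    by (rule bij_betw_byWitness[where f' = "\<lambda>q. q \<circ> inv' p"])
       (use assms stab_comp stab_inv permutes_inv_o[OF p] in \<open>auto simp: comp_assoc\<close>)
  show "bij_betw inv' (stab r) (stab r)"
    by (rule bij_betw_byWitness[where f' = inv'])
       (auto simp: stab_inv permutes_inv_inv[OF stab_permutes])
qed

definition row_sum :: "(nat \<Rightarrow> nat) \<Rightarrow> (nat \<Rightarrow> nat) \<Rightarrow> complex"
  where "row_sum r = (\<Sum>p\<in>stab r. delta p)"

definition col_sum :: "(nat \<Rightarrow> nat) \<Rightarrow> (nat \<Rightarrow> nat) \<Rightarrow> complex"
  where "col_sum c = (\<Sum>q\<in>stab c. of_int (sign q) *\<^sub>F delta q)"

lemma row_sum_in [simp, intro]: "row_sum r \<in> alg"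
  unfolding row_sum_def by (intro functions_on_sum functions_on_closed) (simp add: stab_permutes)

lemma col_sum_in [simp, intro]: "col_sum c \<in> alg"
  unfolding col_sum_def by (intro functions_on_sum functions_on_closed) (simp add: stab_permutes)

lemma delta_row_sum:
  assumes "p \<in> stab r"
  shows "delta p \<star> row_sum r = row_sum r" "row_sum r \<star> delta p = row_sum r"
proof -
  have "delta p \<star> row_sum r = (\<Sum>q\<in>stab r. delta (p \<circ> q))"
    unfolding row_sum_def bilinear_ext_sum
    by (intro sum.cong refl) (simp add: conv_delta stab_permutes[OF assms] stab_permutes)
  then show "delta p \<star> row_sum r = row_sum r"
    unfolding row_sum_def by (simp add: sum.reindex_bij_betw[OF stab_bij(1)[OF assms]])
  have "row_sum r \<star> delta p = (\<Sum>q\<in>stab r. delta (q \<circ> p))"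
    unfolding row_sum_def bilinear_ext_sum
    by (intro sum.cong refl) (simp add: conv_delta stab_permutes[OF assms] stab_permutes)
  then show "row_sum r \<star> delta p = row_sum r"
    unfolding row_sum_def by (simp add: sum.reindex_bij_betw[OF stab_bij(2)[OF assms]])
qed

lemma sign_mult: "p permutes {1..k} \<Longrightarrow> q permutes {1..k} \<Longrightarrow> sign (p \<circ> q) = sign p * sign q"
  by (intro sign_compose permutation_permutes[THEN iffD2] exI[of _ "{1..k}"]) auto

lemma sign_square: "complex_of_int (sign p) * of_int (sign p) = 1"
  by (simp add: sign_def)

lemma delta_col_sum:
  assumes "p \<in> stab c"
  shows "delta p \<star> col_sum c = of_int (sign p) *\<^sub>F col_sum c"
    "col_sum c \<star> delta p = of_int (sign p) *\<^sub>F col_sum c"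
proof -
  have s: "of_int (sign q) *\<^sub>F delta (p \<circ> q) =
      of_int (sign p) *\<^sub>F (of_int (sign (p \<circ> q)) *\<^sub>F delta (p \<circ> q) :: _ \<Rightarrow> complex)"
    "of_int (sign q) *\<^sub>F delta (q \<circ> p) =
      of_int (sign p) *\<^sub>F (of_int (sign (q \<circ> p)) *\<^sub>F delta (q \<circ> p) :: _ \<Rightarrow> complex)"
    if "q \<in> stab c" for q
    using sign_square[of p] that
    by (simp_all add: sign_mult stab_permutes[OF assms] stab_permutes mult.assoc[symmetric])
  have "delta p \<star> col_sum c = (\<Sum>q\<in>stab c. of_int (sign p) *\<^sub>F (of_int (sign (p \<circ> q)) *\<^sub>F delta (p \<circ> q)))"
    unfolding col_sum_def bilinear_ext_sum bilinear_ext_scale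
    by (intro sum.cong refl, subst s[symmetric]) (simp_all add: conv_delta stab_permutes[OF assms] stab_permutes)
  then show "delta p \<star> col_sum c = of_int (sign p) *\<^sub>F col_sum c"
    unfolding col_sum_def
    by (simp add: sum.reindex_bij_betw[OF stab_bij(1)[OF assms], of "\<lambda>q. of_int (sign q) *\<^sub>F delta q"]
          fun_vs.scale_sum_right[symmetric] del: fun_vs.scale_scale)
  have "col_sum c \<star> delta p = (\<Sum>q\<in>stab c. of_int (sign p) *\<^sub>F (of_int (sign (q \<circ> p)) *\<^sub>F delta (q \<circ> p)))"
    unfolding col_sum_def bilinear_ext_sum bilinear_ext_scale
    by (intro sum.cong refl, subst s(2)[symmetric]) (simp_all add: conv_delta stab_permutes[OF assms] stab_permutes)
  then show "col_sum c \<star> delta p = of_int (sign p) *\<^sub>F col_sum c"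
    unfolding col_sum_def
    by (simp add: sum.reindex_bij_betw[OF stab_bij(2)[OF assms], of "\<lambda>q. of_int (sign q) *\<^sub>F delta q"]
          fun_vs.scale_sum_right[symmetric] del: fun_vs.scale_scale)
qed

lemma star_row_sum: "star (row_sum r) = row_sum r"
proof -
  have "star (row_sum r) = (\<Sum>p\<in>stab r. delta (inv' p))"
    unfolding row_sum_def star_sum by (intro sum.cong refl) (simp add: star_delta stab_permutes)
  then show ?thesis
    by (simp add: row_sum_def sum.reindex_bij_betw[OF stab_bij(3)[OF id_stab]])
qed

lemma star_col_sum: "star (col_sum c) = col_sum c"
proof -
  have "star (col_sum c) = (\<Sum>p\<in>stab c. of_int (sign (inv' p)) *\<^sub>F delta (inv' p))"
    unfolding col_sum_def star_sum star_scale
    by (intro sum.cong refl)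
       (simp add: star_delta stab_permutes sign_inverse permutation_permutes[THEN iffD2]
          exI[of "\<lambda>S. finite S \<and> _ permutes S" "{1..k}"])
  then show ?thesis
    by (simp add: col_sum_def sum.reindex_bij_betw[OF stab_bij(3)[OF id_stab],
          of "\<lambda>q. of_int (sign q) *\<^sub>F delta q"])
qed

lemma row_sum_square: "row_sum r \<star> row_sum r = of_nat (card (stab r)) *\<^sub>F row_sum r"
proof -
  have "row_sum r \<star> row_sum r = (\<Sum>p\<in>stab r. delta p \<star> row_sum r)"
    by (subst (1) row_sum_def) (rule bilinear_ext_sum)
  also have "\<dots> = (\<Sum>p\<in>stab r. row_sum r)"
    by (intro sum.cong refl) (simp add: delta_row_sum)
  finally show ?thesis by (simp add: fun_eq_iff)
qed

lemma col_sum_square: "col_sum c \<star> col_sum c = of_nat (card (stab c)) *\<^sub>F col_sum c"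
proof -
  have "col_sum c \<star> col_sum c = (\<Sum>p\<in>stab c. of_int (sign p) *\<^sub>F (delta p \<star> col_sum c))"
    by (subst (1) col_sum_def) (simp only: bilinear_ext_sum bilinear_ext_scale)
  also have "\<dots> = (\<Sum>p\<in>stab c. col_sum c)"
    by (intro sum.cong refl) (simp add: delta_col_sum sign_square)
  finally show ?thesis by (simp add: fun_eq_iff)
qed

lemma card_stab_nonzero [simp]: "card (stab r) \<noteq> 0"
  using id_stab finite_stab by (metis card_0_eq empty_iff)

text \<open>If \<open>g\<close> moves two points of one row into a common column, the transposition
  of these points is absorbed on the left and produces a sign on the right.\<close>

lemma row_delta_col_eq_0:
  assumes g: "g permutes {1..k}" and xy: "x \<in> {1..k}" "y \<in> {1..k}" "x \<noteq> y"
    and r: "r x = r y" and c: "c (inv' g x) = c (inv' g y)"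
  shows "row_sum r \<star> delta g \<star> col_sum c = 0"
proof -
  let ?t = "Transposition.transpose x y" and ?t' = "Transposition.transpose (inv' g x) (inv' g y)"
  have g': "inv' g x \<in> {1..k}" "inv' g y \<in> {1..k}" "inv' g x \<noteq> inv' g y"
    using permutes_in_image[OF permutes_inv[OF g]] permutes_inj[OF permutes_inv[OF g]] xy
    by (auto simp: inj_eq)
  have t: "?t \<in> stab r"
    using xy r by (intro stabI permutes_swap_id) (auto simp: Transposition.transpose_def)
  have t': "?t' \<in> stab c"
    using g' c by (intro stabI permutes_swap_id) (auto simp: Transposition.transpose_def)
  have tg: "?t \<circ> g = g \<circ> ?t'"
    using permutes_inverses[OF g] permutes_inj[OF g]
    by (auto simp: fun_eq_iff Transposition.transpose_def inj_eq)
  have "row_sum r \<star> delta g \<star> col_sum c = row_sum r \<star> (delta ?t \<star> delta g) \<star> col_sum c"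
    by (simp add: conv_assoc[symmetric] delta_row_sum[OF t])
  also have "delta ?t \<star> delta g = delta g \<star> delta ?t'"
    using g by (simp add: conv_delta stab_permutes[OF t] stab_permutes[OF t'] tg)
  also have "row_sum r \<star> (delta g \<star> delta ?t') \<star> col_sum c = row_sum r \<star> delta g \<star> (delta ?t' \<star> col_sum c)"
    by (simp add: conv_assoc)
  also have "\<dots> = - (row_sum r \<star> delta g \<star> col_sum c)"
    using g'(3) by (simp add: delta_col_sum[OF t'] bilinear_ext_scale sign_swap_id)
  finally have neg: "row_sum r \<star> delta g \<star> col_sum c = - (row_sum r \<star> delta g \<star> col_sum c)" .
  show ?thesis
  proof
    fix z show "(row_sum r \<star> delta g \<star> col_sum c) z = 0 z"
      using fun_cong[OF neg, of z] by simp
  qed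
qed

text \<open>A permutation in both the row group and the column group fixes every point, as row and
  column determine the point; so the identity factors only trivially. This is how the product of the
  two sums is seen to be nonzero.\<close>

lemma row_col_one:
  assumes "inj_on (\<lambda>x. (r x, c x)) {1..k}"
  shows "(row_sum r \<star> col_sum c) id = 1"
proof -
  have triv: "p = id \<and> q = id" if p: "p \<in> stab r" and q: "q \<in> stab c" and pq: "p \<circ> q = id" for p q
  proof -
    have P: "p permutes {1..k}" "q permutes {1..k}" using p q by (simp_all add: stab_permutes)
    have "p = inv' q" using P(2) pq by (metis comp_assoc comp_id id_comp permutes_inv_o(1))
    then have pc: "p \<in> stab c" using stab_inv[OF q] by simp
    have "p x = x" for x
    proof (cases "x \<in> {1..k}")
      case True
      then show ?thesis
        using stab_apply[OF p True] stab_apply[OF pc True]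
        by (intro inj_onD[OF assms]) simp_all
    qed (use P(1) in \<open>auto simp: permutes_def\<close>)
    then have "p = id" by auto
    then show ?thesis using pq by simp
  qed
  have "(row_sum r \<star> col_sum c) id =
      (\<Sum>p\<in>stab r. \<Sum>q\<in>stab c. of_int (sign q) * (delta p \<star> delta q) id)"
    by (subst sum.swap)
       (simp add: row_sum_def col_sum_def bilinear_ext_sum bilinear_ext_scale sum_distrib_left)
  also have "\<dots> = (\<Sum>p\<in>stab r. \<Sum>q\<in>stab c. if p = id then if q = id then 1 else 0 else 0)"
  proof (intro sum.cong refl)
    fix p q assume pq: "p \<in> stab r" "q \<in> stab c"
    have "(delta p \<star> delta q) id = (if p \<circ> q = id then 1 else 0)"
      using pq by (auto simp: conv_delta stab_permutes delta_apply)
    then show "of_int (sign q) * (delta p \<star> delta q) id = (if p = id then if q = id then 1 else 0 else 0)"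
      using triv[OF pq] by (auto simp: sign_id)
  qed
  also have "\<dots> = (\<Sum>p\<in>stab r. if p = id then 1 else 0)"
  proof (intro sum.cong refl)
    fix p show "(\<Sum>q\<in>stab c. if p = id then if q = id then 1 else 0 else 0) = (if p = id then 1 else (0::complex))"
      by (cases "p = id") simp_all
  qed
  finally show ?thesis by simp
qed

end

section \<open>Column counts of a partition and the dominance argument\<close>

definition col_count :: "nat list \<Rightarrow> nat \<Rightarrow> nat"
  where "col_count \<mu> m = (\<Sum>i<length \<mu>. min (\<mu> ! i) m)"

lemma cells_eq: "cells \<mu> = Sigma {..<length \<mu>} (\<lambda>i. {..<\<mu> ! i})"
  by (auto simp: cells_def)

lemma finite_cells [simp]: "finite (cells \<mu>)"
  by (simp add: cells_eq)

lemma card_cells: "card (cells \<mu>) = sum_list \<mu>"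
  by (simp add: cells_eq sum_list_sum_nth atLeast0LessThan)

lemma down_closed_nat:
  fixes S :: "nat set"
  assumes "finite S" and "\<And>i j. i \<in> S \<Longrightarrow> j \<le> i \<Longrightarrow> j \<in> S"
  shows "i \<in> S \<longleftrightarrow> i < card S"
proof
  assume "i \<in> S"
  then have "{..i} \<subseteq> S" using assms(2) by auto
  then have "card {..i} \<le> card S" using assms(1) by (rule card_mono[rotated])
  then show "i < card S" by simp
next
  assume i: "i < card S"
  show "i \<in> S"
  proof (rule ccontr)
    assume "i \<notin> S"
    then have "S \<subseteq> {..<i}" using assms(2)[of _ i] by (meson lessThan_iff not_le subsetI)
    then have "card S \<le> card {..<i}" by (intro card_mono) auto
    then show False using i by simp
  qed
qed

text \<open>The rows longer than \<open>m\<close> form an initial segment because the parts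
  decrease, so they are described by their number, the length of a column.\<close>

lemma partition_nth_iff:
  assumes "is_partition k \<mu>"
  shows "i < length \<mu> \<and> m < \<mu> ! i \<longleftrightarrow> i < card {i. i < length \<mu> \<and> m < \<mu> ! i}"
proof -
  have "\<mu> ! i \<le> \<mu> ! j" if "i < length \<mu>" "j \<le> i" for i j
    using assms that sorted_wrt_iff_nth_less[of "(\<ge>)" \<mu>]
    by (cases "j = i") (auto simp: is_partition_def)
  then have "i \<in> {i. i < length \<mu> \<and> m < \<mu> ! i} \<longleftrightarrow> i < card {i. i < length \<mu> \<and> m < \<mu> ! i}"
    by (intro down_closed_nat) (auto intro: le_less_trans less_le_trans)
  then show ?thesis by simp
qed

lemma col_count_Suc: "col_count \<mu> (Suc m) = col_count \<mu> m + card {i. i < length \<mu> \<and> m < \<mu> ! i}"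
proof -
  have "col_count \<mu> (Suc m) = (\<Sum>i<length \<mu>. min (\<mu> ! i) m + (if m < \<mu> ! i then 1 else 0))"
    unfolding col_count_def by (intro sum.cong) auto
  also have "\<dots> = col_count \<mu> m + card ({..<length \<mu>} \<inter> {i. m < \<mu> ! i})"
    by (simp add: sum.distrib col_count_def sum.If_cases)
  also have "{..<length \<mu>} \<inter> {i. m < \<mu> ! i} = {i. i < length \<mu> \<and> m < \<mu> ! i}" by auto
  finally show ?thesis .
qed

text \<open>Successive differences of column counts are the column lengths, which decide membership
  of each cell; since parts are nonzero, the first column determines the number of rows.\<close>

lemma col_count_inject:
  assumes "is_partition k \<kappa>" "is_partition l \<mu>" and eq: "\<And>m. col_count \<kappa> m = col_count \<mu> m"
  shows "\<kappa> = \<mu>"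
proof -
  have N: "card {i. i < length \<kappa> \<and> m < \<kappa> ! i} = card {i. i < length \<mu> \<and> m < \<mu> ! i}" for m
    using eq[of m] eq[of "Suc m"] by (simp add: col_count_Suc)
  then have iff: "i < length \<kappa> \<and> m < \<kappa> ! i \<longleftrightarrow> i < length \<mu> \<and> m < \<mu> ! i" for i m
    using partition_nth_iff[OF assms(1), of i m] partition_nth_iff[OF assms(2), of i m] by simp
  have pos: "0 < \<kappa> ! i" if "i < length \<kappa>" for i
    using assms(1) nth_mem[OF that] by (metis is_partition_def neq0_conv)
  have pos': "0 < \<mu> ! i" if "i < length \<mu>" for i
    using assms(2) nth_mem[OF that] by (metis is_partition_def neq0_conv)
  have len: "i < length \<kappa> \<longleftrightarrow> i < length \<mu>" for i
    using iff[of i 0] pos pos' by blast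
  then have len': "length \<kappa> = length \<mu>"
    using less_irrefl linorder_neqE_nat by metis
  show ?thesis
  proof (rule nth_equalityI[OF len'])
    fix i assume i: "i < length \<kappa>"
    then have "m < \<kappa> ! i \<longleftrightarrow> m < \<mu> ! i" for m using iff[of i m] len by blast
    then show "\<kappa> ! i = \<mu> ! i" using less_irrefl linorder_neqE_nat by metis
  qed
qed

context
  fixes D :: "'x set" and r c :: "'x \<Rightarrow> nat" and \<mu> :: "nat list"
  assumes D: "finite D" and inj: "inj_on (\<lambda>x. (r x, c x)) D"
    and r_less: "\<And>x. x \<in> D \<Longrightarrow> r x < length \<mu>"
    and r_card: "\<And>i. i < length \<mu> \<Longrightarrow> card {x \<in> D. r x = i} = \<mu> ! i"
begin

lemma card_row_part: "i < length \<mu> \<Longrightarrow> card {x \<in> D. r x = i \<and> c x < m} \<le> min (\<mu> ! i) m"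
proof -
  assume i: "i < length \<mu>"
  have "card {x \<in> D. r x = i \<and> c x < m} \<le> card {x \<in> D. r x = i}"
    using D by (intro card_mono) auto
  moreover have "card {x \<in> D. r x = i \<and> c x < m} \<le> card {..<m}"
    using D inj by (intro card_inj_on_le[of c]) (auto simp: inj_on_def)
  ultimately show ?thesis using r_card[OF i] by simp
qed

lemma card_cols: "card {x \<in> D. c x < m} = (\<Sum>i<length \<mu>. card {x \<in> D. r x = i \<and> c x < m})"
proof -
  have "{x \<in> D. c x < m} = (\<Union>i<length \<mu>. {x \<in> D. r x = i \<and> c x < m})"
    using r_less by auto
  then show ?thesis
    using D by (simp only:) (subst card_UN_disjoint, auto)
qed

text \<open>In each row the points have distinct columns, so the first \<open>m\<close> columns
  contain at most \<open>m\<close> of them and at most as many as the row is long. This is the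
  combinatorial lemma behind the dominance order, for an arbitrary column assignment
  \<open>c\<close>.\<close>

lemma dominance: "card {x \<in> D. c x < m} \<le> col_count \<mu> m"
  unfolding card_cols col_count_def by (intro sum_mono card_row_part) simp

text \<open>Equality of the totals forces equality in the bound of every row. Taking
  \<open>m\<close> to be the length of the row of \<open>x\<close> shows that the whole row occupies
  columns below its length.\<close>

lemma dominance_eq:
  assumes eq: "\<And>m. card {x \<in> D. c x < m} = col_count \<mu> m" and x: "x \<in> D"
  shows "c x < \<mu> ! r x"
proof -
  let ?i = "r x"
  have i: "?i < length \<mu>" using r_less[OF x] .
  have "card {y \<in> D. r y = ?i \<and> c y < \<mu> ! ?i} = min (\<mu> ! ?i) (\<mu> ! ?i)"
  proof (rule sum_mono_inv[where I = "{..<length \<mu>}" and i = ?i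
        and f = "\<lambda>i. card {y \<in> D. r y = i \<and> c y < \<mu> ! ?i}" and g = "\<lambda>i. min (\<mu> ! i) (\<mu> ! ?i)"])
    show "(\<Sum>i<length \<mu>. card {y \<in> D. r y = i \<and> c y < \<mu> ! ?i}) = (\<Sum>i<length \<mu>. min (\<mu> ! i) (\<mu> ! ?i))"
      using eq[of "\<mu> ! ?i"] by (simp add: card_cols col_count_def)
  qed (use i card_row_part in auto)
  then have "{y \<in> D. r y = ?i \<and> c y < \<mu> ! ?i} = {y \<in> D. r y = ?i}"
    using D r_card[OF i] by (intro card_subset_eq) auto
  then show ?thesis using x by blast
qed

end

text \<open>An arbitrary bijective filling, fixed once and for all; its rows and columns need not
  increase.\<close>

definition std_tableau :: "nat list \<Rightarrow> nat \<times> nat \<Rightarrow> nat"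
  where "std_tableau \<mu> = (SOME t. tableau \<mu> t)"

definition row_of :: "nat list \<Rightarrow> nat \<Rightarrow> nat"
  where "row_of \<mu> x = fst (inv_into (cells \<mu>) (std_tableau \<mu>) x)"

definition col_of :: "nat list \<Rightarrow> nat \<Rightarrow> nat"
  where "col_of \<mu> x = snd (inv_into (cells \<mu>) (std_tableau \<mu>) x)"

lemma tableau_std: "tableau \<mu> (std_tableau \<mu>)"
proof -
  have "\<exists>t. bij_betw t (cells \<mu>) {1..sum_list \<mu>}"
    by (rule finite_same_card_bij) (simp_all add: card_cells)
  then have "\<exists>t. tableau \<mu> t" by (simp add: tableau_def)
  then show ?thesis unfolding std_tableau_def by (rule someI_ex)
qed

context
  fixes \<mu> k
  assumes \<mu>: "is_partition k \<mu>"
begin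

lemma std_bij: "bij_betw (std_tableau \<mu>) (cells \<mu>) {1..k}"
  using tableau_std[of \<mu>] \<mu> by (simp add: tableau_def is_partition_def)

lemma std_pos:
  assumes "x \<in> {1..k}"
  shows "(row_of \<mu> x, col_of \<mu> x) \<in> cells \<mu>" "std_tableau \<mu> (row_of \<mu> x, col_of \<mu> x) = x"
  using assms std_bij by (auto simp: row_of_def col_of_def bij_betw_def inv_into_into f_inv_into_f)

lemma pos_std:
  assumes "c \<in> cells \<mu>"
  shows "row_of \<mu> (std_tableau \<mu> c) = fst c" "col_of \<mu> (std_tableau \<mu> c) = snd c"
    "std_tableau \<mu> c \<in> {1..k}"
  using assms std_bij by (auto simp: row_of_def col_of_def bij_betw_def inv_into_f_f)

lemma inj_on_pos: "inj_on (\<lambda>x. (row_of \<mu> x, col_of \<mu> x)) {1..k}"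
  by (rule inj_on_inverseI[where g = "std_tableau \<mu>"]) (rule std_pos(2))

lemma bij_std_Collect: "bij_betw (std_tableau \<mu>) {c \<in> cells \<mu>. P c} {x \<in> {1..k}. P (row_of \<mu> x, col_of \<mu> x)}"
proof -
  have "std_tableau \<mu> ` {c \<in> cells \<mu>. P c} = {x \<in> {1..k}. P (row_of \<mu> x, col_of \<mu> x)}"
  proof (intro subset_antisym subsetI)
    fix x assume "x \<in> {x \<in> {1..k}. P (row_of \<mu> x, col_of \<mu> x)}"
    then show "x \<in> std_tableau \<mu> ` {c \<in> cells \<mu>. P c}"
      using std_pos[of x] by (intro image_eqI[of _ _ "(row_of \<mu> x, col_of \<mu> x)"]) auto
  qed (use pos_std in auto)
  then show ?thesis
    using std_bij by (auto simp: bij_betw_def intro: inj_on_subset)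
qed

lemma row_of_less: "x \<in> {1..k} \<Longrightarrow> row_of \<mu> x < length \<mu>"
  using std_pos(1)[of x] by (simp add: cells_def)

lemma card_row_of: "i < length \<mu> \<Longrightarrow> card {x \<in> {1..k}. row_of \<mu> x = i} = \<mu> ! i"
proof -
  assume i: "i < length \<mu>"
  have "card {x \<in> {1..k}. row_of \<mu> x = i} = card {c \<in> cells \<mu>. fst c = i}"
    using bij_betw_same_card[OF bij_std_Collect[of "\<lambda>c. fst c = i"]] by simp
  also have "{c \<in> cells \<mu>. fst c = i} = Pair i ` {..<\<mu> ! i}"
    using i by (auto simp: cells_def)
  also have "card \<dots> = \<mu> ! i" by (simp add: card_image inj_on_def)
  finally show ?thesis .
qed

lemma card_col_of: "card {x \<in> {1..k}. col_of \<mu> x < m} = col_count \<mu> m"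
proof -
  have "card {x \<in> {1..k}. col_of \<mu> x < m} = card {c \<in> cells \<mu>. snd c < m}"
    using bij_betw_same_card[OF bij_std_Collect[of "\<lambda>c. snd c < m"]] by simp
  also have "{c \<in> cells \<mu>. snd c < m} = Sigma {..<length \<mu>} (\<lambda>i. {..<min (\<mu> ! i) m})"
    by (auto simp: cells_def)
  also have "card \<dots> = col_count \<mu> m" by (simp add: col_count_def)
  finally show ?thesis .
qed

lemma card_col_of_perm:
  assumes g: "g permutes {1..k}"
  shows "card {x \<in> {1..k}. col_of \<mu> (inv' g x) < m} = col_count \<mu> m"
proof -
  have "{x \<in> {1..k}. col_of \<mu> (inv' g x) < m} = g ` {x \<in> {1..k}. col_of \<mu> x < m}"
  proof (intro subset_antisym subsetI)
    fix x assume "x \<in> {x \<in> {1..k}. col_of \<mu> (inv' g x) < m}"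
    then show "x \<in> g ` {x \<in> {1..k}. col_of \<mu> x < m}"
      using permutes_in_image[OF permutes_inv[OF g], of x] permutes_inverses(1)[OF g, of x]
      by (intro image_eqI[of _ _ "inv' g x"]) auto
  next
    fix x assume "x \<in> g ` {x \<in> {1..k}. col_of \<mu> x < m}"
    then show "x \<in> {x \<in> {1..k}. col_of \<mu> (inv' g x) < m}"
      using permutes_in_image[OF g] permutes_inverses(2)[OF g] by auto
  qed
  then have "card {x \<in> {1..k}. col_of \<mu> (inv' g x) < m} = card {x \<in> {1..k}. col_of \<mu> x < m}"
    using permutes_inj_on[OF g] by (simp add: card_image)
  then show ?thesis using card_col_of[of m] by (rule trans)
qed

end

section \<open>Products of row sums, group elements and column sums\<close>

context symmetric_group_algebra
begin

definition "rs \<mu> = row_sum (row_of \<mu>)"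
definition "cs \<mu> = col_sum (col_of \<mu>)"

lemma rs_in [simp, intro]: "rs \<mu> \<in> alg" and cs_in [simp, intro]: "cs \<mu> \<in> alg"
  by (simp_all add: rs_def cs_def)

lemma row_delta_col_nonzero:
  assumes g: "g permutes {1..k}" and nz: "row_sum r \<star> delta g \<star> col_sum c \<noteq> 0"
  shows "inj_on (\<lambda>x. (r x, c (inv' g x))) {1..k}"
  using row_delta_col_eq_0[OF g] nz by (intro inj_onI) (metis Pair_inject)

text \<open>If the product is nonzero, no two points share both a row and, after moving by
  \<open>g\<close>, a column. As both tableaux have the same shape, dominance is an equality and
  every pair of a row and a moved column is a cell. This factors \<open>g\<close> into an element of
  the row group and one of the column group, which the two sums absorb up to a sign.\<close>

lemma row_delta_col_scalar:
  assumes \<mu>: "is_partition k \<mu>" and g: "g permutes {1..k}"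
  shows "\<exists>d. rs \<mu> \<star> delta g \<star> cs \<mu> = d *\<^sub>F (rs \<mu> \<star> cs \<mu>)"
proof (cases "rs \<mu> \<star> delta g \<star> cs \<mu> = 0")
  case True
  then show ?thesis by (intro exI[of _ 0]) simp
next
  case False
  let ?c = "\<lambda>x. col_of \<mu> (inv' g x)"
  have inj: "inj_on (\<lambda>x. (row_of \<mu> x, ?c x)) {1..k}"
    using row_delta_col_nonzero[OF g] False by (simp add: rs_def cs_def)
  have cell: "(row_of \<mu> x, ?c x) \<in> cells \<mu>" if "x \<in> {1..k}" for x
    using dominance_eq[OF _ inj row_of_less[OF \<mu>] card_row_of[OF \<mu>] card_col_of_perm[OF \<mu> g] that]
      row_of_less[OF \<mu> that] by (simp add: cells_def)
  \<comment> \<open>The row permutation that moves each \<open>x\<close> within its row to the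
    column of \<open>inv' g x\<close>; then \<open>s \<circ> g\<close> preserves columns.\<close>
  define s where "s x = (if x \<in> {1..k} then std_tableau \<mu> (row_of \<mu> x, ?c x) else x)" for x
  have s_in: "s x \<in> {1..k}" if "x \<in> {1..k}" for x
    using pos_std(3)[OF \<mu> cell[OF that]] that by (simp add: s_def)
  have s_pos: "row_of \<mu> (s x) = row_of \<mu> x" "col_of \<mu> (s x) = ?c x" if "x \<in> {1..k}" for x
    using pos_std(1,2)[OF \<mu> cell[OF that]] that by (simp_all add: s_def)
  have "inj_on s {1..k}"
  proof (rule inj_onI)
    fix x y assume xy: "x \<in> {1..k}" "y \<in> {1..k}" and "s x = s y"
    then have "(row_of \<mu> x, ?c x) = (row_of \<mu> y, ?c y)"
      using s_pos[OF xy(1)] s_pos[OF xy(2)] by metis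
    then show "x = y" using inj_onD[OF inj _ xy] by blast
  qed
  then have "bij_betw s {1..k} {1..k}"
    using s_in by (intro bij_betw_imageI endo_inj_surj) auto
  then have s_perm: "s permutes {1..k}"
    by (rule bij_imp_permutes) (simp only: s_def if_False)
  have s_stab: "s \<in> stab (row_of \<mu>)" by (intro stabI s_perm s_pos)
  let ?q = "s \<circ> g"
  have q_stab: "?q \<in> stab (col_of \<mu>)"
  proof (intro stabI permutes_compose[OF g s_perm])
    fix x assume "x \<in> {1..k}"
    then have "g x \<in> {1..k}" using permutes_in_image[OF g] by blast
    then show "col_of \<mu> (?q x) = col_of \<mu> x"
      using s_pos(2) permutes_inverses(2)[OF g] by simp
  qed
  have "g = inv' s \<circ> ?q" by (simp add: o_assoc permutes_inv_o[OF s_perm])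
  then have "delta g = delta (inv' s) \<star> delta ?q"
    using stab_permutes[OF q_stab] permutes_inv[OF s_perm] by (simp add: conv_delta)
  then have "rs \<mu> \<star> delta g \<star> cs \<mu> = (rs \<mu> \<star> delta (inv' s)) \<star> (delta ?q \<star> cs \<mu>)"
    by (simp add: conv_assoc)
  also have "\<dots> = of_int (sign ?q) *\<^sub>F (rs \<mu> \<star> cs \<mu>)"
    by (simp add: rs_def cs_def delta_row_sum[OF stab_inv[OF s_stab]] delta_col_sum[OF q_stab]
          bilinear_ext_scale)
  finally show ?thesis by blast
qed

lemma row_conv_col_scalar:
  assumes \<mu>: "is_partition k \<mu>" and x: "x \<in> alg"
  shows "\<exists>d. rs \<mu> \<star> x \<star> cs \<mu> = d *\<^sub>F (rs \<mu> \<star> cs \<mu>)"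
proof -
  obtain d where d: "\<And>g. g permutes {1..k} \<Longrightarrow> rs \<mu> \<star> delta g \<star> cs \<mu> = d g *\<^sub>F (rs \<mu> \<star> cs \<mu>)"
    using row_delta_col_scalar[OF \<mu>] by metis
  have "rs \<mu> \<star> x \<star> cs \<mu> = (\<Sum>g\<in>carrier (sym_group k). x g *\<^sub>F (rs \<mu> \<star> delta g \<star> cs \<mu>))"
    by (subst conv_expand(2)[OF x]) (simp add: bilinear_ext_sum bilinear_ext_scale)
  also have "\<dots> = (\<Sum>g\<in>carrier (sym_group k). x g * d g) *\<^sub>F (rs \<mu> \<star> cs \<mu>)"
    by (simp add: d fun_vs.scale_sum_left)
  finally show ?thesis by blast
qed

text \<open>A nonvanishing product compares all column counts of the two shapes in one direction. If
  it occurs in both orders, the counts agree and so do the shapes.\<close>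

lemma row_conv_col_eq_0:
  assumes "is_partition k \<kappa>" "is_partition k \<mu>" "\<kappa> \<noteq> \<mu>"
  shows "(\<forall>x\<in>alg. rs \<kappa> \<star> x \<star> cs \<mu> = 0) \<or> (\<forall>x\<in>alg. rs \<mu> \<star> x \<star> cs \<kappa> = 0)"
proof (rule ccontr)
  assume contr: "\<not> ?thesis"
  have le: "col_count \<tau> m \<le> col_count \<sigma> m"
    if \<sigma>: "is_partition k \<sigma>" and \<tau>: "is_partition k \<tau>" and x: "x \<in> alg" "rs \<sigma> \<star> x \<star> cs \<tau> \<noteq> 0" for \<sigma> \<tau> x m
  proof -
    have "rs \<sigma> \<star> x \<star> cs \<tau> = (\<Sum>g\<in>carrier (sym_group k). x g *\<^sub>F (rs \<sigma> \<star> delta g \<star> cs \<tau>))"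
      by (subst conv_expand(2)[OF x(1)]) (simp add: bilinear_ext_sum bilinear_ext_scale)
    then have "\<not> (\<forall>g\<in>carrier (sym_group k). rs \<sigma> \<star> delta g \<star> cs \<tau> = 0)"
      using x(2) by auto
    then obtain g where g: "g permutes {1..k}" "rs \<sigma> \<star> delta g \<star> cs \<tau> \<noteq> 0"
      unfolding Ball_def sym_group_simps by blast
    have "inj_on (\<lambda>x. (row_of \<sigma> x, col_of \<tau> (inv' g x))) {1..k}"
      using row_delta_col_nonzero[OF g(1)] g(2) by (simp add: rs_def cs_def)
    from dominance[OF finite_atLeastAtMost this row_of_less[OF \<sigma>] card_row_of[OF \<sigma>], of m]
    show ?thesis by (simp only: card_col_of_perm[OF \<tau> g(1)])
  qed
  from contr obtain x y where "x \<in> alg" "rs \<kappa> \<star> x \<star> cs \<mu> \<noteq> 0" "y \<in> alg" "rs \<mu> \<star> y \<star> cs \<kappa> \<noteq> 0"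
    by blast
  then have "col_count \<kappa> m = col_count \<mu> m" for m
    using le[OF assms(1,2)] le[OF assms(2,1)] by (intro le_antisym) blast+
  then show False using col_count_inject[OF assms(1,2)] assms(3) by blast
qed

definition young :: "nat list \<Rightarrow> (nat \<Rightarrow> nat) \<Rightarrow> complex"
  where "young \<mu> = rs \<mu> \<star> cs \<mu> \<star> rs \<mu>"

lemma young_in [simp, intro]: "young \<mu> \<in> alg"
  by (simp add: young_def)

lemma star_rs [simp]: "star (rs \<mu>) = rs \<mu>" and star_cs [simp]: "star (cs \<mu>) = cs \<mu>"
  by (simp_all add: rs_def cs_def star_row_sum star_col_sum)

lemma star_young [simp]: "star (young \<mu>) = young \<mu>"
  by (simp add: young_def star_conv conv_assoc)

text \<open>With \<open>x = rs \<mu> \<star> cs \<mu>\<close>, the product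
  \<open>x \<star> star x\<close> is a multiple of \<open>young \<mu>\<close>, because the column
  sum squares to a multiple of itself; and \<open>x\<close> is nonzero, its coefficient at the
  identity being 1.\<close>

lemma young_nonzero:
  assumes \<mu>: "is_partition k \<mu>"
  shows "young \<mu> \<noteq> 0"
proof
  assume "young \<mu> = 0"
  let ?x = "rs \<mu> \<star> cs \<mu>"
  have "?x \<star> star ?x = rs \<mu> \<star> (cs \<mu> \<star> cs \<mu>) \<star> rs \<mu>"
    by (simp add: star_conv conv_assoc)
  also have "\<dots> = of_nat (card (stab (col_of \<mu>))) *\<^sub>F young \<mu>"
    by (simp add: cs_def col_sum_square young_def bilinear_ext_scale)
  finally have "?x \<star> star ?x = 0" using \<open>young \<mu> = 0\<close> by simp
  then have "?x = 0" using conv_star_eq_0_iff[of ?x] by simp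
  then show False
    using row_col_one[OF inj_on_pos[OF \<mu>]] by (simp add: rs_def cs_def)
qed

lemma young_scalar:
  assumes \<mu>: "is_partition k \<mu>" and x: "x \<in> alg"
  shows "\<exists>d. young \<mu> \<star> x \<star> young \<mu> = d *\<^sub>F young \<mu>"
proof -
  obtain d where d: "rs \<mu> \<star> (cs \<mu> \<star> rs \<mu> \<star> x \<star> rs \<mu>) \<star> cs \<mu> = d *\<^sub>F (rs \<mu> \<star> cs \<mu>)"
    using row_conv_col_scalar[OF \<mu>, of "cs \<mu> \<star> rs \<mu> \<star> x \<star> rs \<mu>"] by auto
  have "young \<mu> \<star> x \<star> young \<mu> = rs \<mu> \<star> (cs \<mu> \<star> rs \<mu> \<star> x \<star> rs \<mu>) \<star> cs \<mu> \<star> rs \<mu>"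
    by (simp add: young_def conv_assoc)
  then show ?thesis unfolding d by (auto simp: young_def bilinear_ext_scale)
qed

text \<open>The vanishing row-column product occurs inside
  \<open>young \<kappa> \<star> x \<star> young \<mu>\<close> either as it stands or after
  \<open>star\<close>, which reverses the factors and fixes row and column sums.\<close>

lemma young_orthogonal:
  assumes "is_partition k \<kappa>" "is_partition k \<mu>" "\<kappa> \<noteq> \<mu>" "x \<in> alg"
  shows "young \<kappa> \<star> x \<star> young \<mu> = 0"
  using row_conv_col_eq_0[OF assms(1-3)]
proof
  assume *: "\<forall>x\<in>alg. rs \<kappa> \<star> x \<star> cs \<mu> = 0"
  have "young \<kappa> \<star> x \<star> young \<mu> = rs \<kappa> \<star> cs \<kappa> \<star> (rs \<kappa> \<star> (x \<star> rs \<mu>) \<star> cs \<mu>) \<star> rs \<mu>"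
    by (simp add: young_def conv_assoc)
  then show ?thesis using * by simp
next
  assume *: "\<forall>x\<in>alg. rs \<mu> \<star> x \<star> cs \<kappa> = 0"
  have "star (cs \<kappa> \<star> (rs \<kappa> \<star> x) \<star> rs \<mu>) = rs \<mu> \<star> star (rs \<kappa> \<star> x) \<star> cs \<kappa>"
    by (simp add: star_conv conv_assoc)
  also have "\<dots> = 0" using * by simp
  finally have "star (star (cs \<kappa> \<star> (rs \<kappa> \<star> x) \<star> rs \<mu>)) = star 0" by simp
  then have "cs \<kappa> \<star> (rs \<kappa> \<star> x) \<star> rs \<mu> = 0"
    by (subst (asm) star_star) (auto simp: star_def fun_eq_iff)
  moreover have "young \<kappa> \<star> x \<star> young \<mu> = rs \<kappa> \<star> (cs \<kappa> \<star> (rs \<kappa> \<star> x) \<star> rs \<mu>) \<star> cs \<mu> \<star> rs \<mu>"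
    by (simp add: young_def conv_assoc)
  ultimately show ?thesis by simp
qed

definition "young_factor \<mu> = (SOME d. young \<mu> \<star> young \<mu> = d *\<^sub>F young \<mu>)"

text \<open>The factor is nonzero by positivity, the symmetrizer being self-adjoint and nonzero.
  Comparing the square with its adjoint shows that the factor is real, so that dividing by it keeps
  the idempotent self-adjoint.\<close>

lemma young_square:
  assumes \<mu>: "is_partition k \<mu>"
  shows "young \<mu> \<star> young \<mu> = young_factor \<mu> *\<^sub>F young \<mu>" "young_factor \<mu> \<noteq> 0"
    "cnj (young_factor \<mu>) = young_factor \<mu>"
proof -
  have "\<exists>d. young \<mu> \<star> young \<mu> = d *\<^sub>F young \<mu>"
    using young_scalar[OF \<mu>, of "delta id"] conv_one(2)[of "young \<mu>"] by simp
  then show sq: "young \<mu> \<star> young \<mu> = young_factor \<mu> *\<^sub>F young \<mu>"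
    unfolding young_factor_def by (rule someI_ex)
  show "young_factor \<mu> \<noteq> 0"
    using sq conv_star_eq_0_iff[of "young \<mu>"] young_nonzero[OF \<mu>] by auto
  have "young_factor \<mu> *\<^sub>F young \<mu> = star (young_factor \<mu> *\<^sub>F young \<mu>)"
    unfolding sq[symmetric] by (simp add: star_conv)
  also have "\<dots> = cnj (young_factor \<mu>) *\<^sub>F young \<mu>"
    by (simp add: star_scale)
  finally have "young_factor \<mu> *\<^sub>F young \<mu> = cnj (young_factor \<mu>) *\<^sub>F young \<mu>" .
  then show "cnj (young_factor \<mu>) = young_factor \<mu>"
    using young_nonzero[OF \<mu>] by (metis fun_vs.scale_right_imp_eq)
qed

definition young_idem :: "nat list \<Rightarrow> (nat \<Rightarrow> nat) \<Rightarrow> complex"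
  where "young_idem \<mu> = inverse (young_factor \<mu>) *\<^sub>F young \<mu>"

lemma young_idem_in [simp, intro]: "young_idem \<mu> \<in> alg"
  by (simp add: young_idem_def)

lemma young_idem:
  assumes \<mu>: "is_partition k \<mu>"
  shows "young_idem \<mu> \<star> young_idem \<mu> = young_idem \<mu>" "young_idem \<mu> \<noteq> 0"
    "star (young_idem \<mu>) = young_idem \<mu>"
  using young_square[OF \<mu>] young_nonzero[OF \<mu>]
  by (simp_all add: young_idem_def bilinear_ext_scale star_scale)

lemma young_idem_scalar:
  assumes \<mu>: "is_partition k \<mu>" and x: "x \<in> alg"
  shows "\<exists>d. young_idem \<mu> \<star> x \<star> young_idem \<mu> = d *\<^sub>F young_idem \<mu>"
proof -
  obtain d where "young \<mu> \<star> x \<star> young \<mu> = d *\<^sub>F young \<mu>" using young_scalar[OF assms] by blast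
  then show ?thesis
    by (intro exI[of _ "inverse (young_factor \<mu>) * d"])
       (simp add: young_idem_def bilinear_ext_scale mult_ac)
qed

lemma young_idem_orthogonal:
  assumes "is_partition k \<kappa>" "is_partition k \<mu>" "\<kappa> \<noteq> \<mu>" "x \<in> alg"
  shows "young_idem \<kappa> \<star> x \<star> young_idem \<mu> = 0"
  using young_orthogonal[OF assms] by (simp add: young_idem_def bilinear_ext_scale)

text \<open>Polytabloids lead to the left ideal of \<open>cs \<mu> \<star> rs \<mu>\<close>, whereas
  \<open>young_idem \<mu>\<close> has a further row sum in front; the two generate the same left
  ideal. Removing the extra factor depends on a scalar being nonzero.\<close>

lemma young_idem_generates:
  assumes \<mu>: "is_partition k \<mu>"
  shows "\<exists>u\<in>alg. young_idem \<mu> = u \<star> (cs \<mu> \<star> rs \<mu>)" "\<exists>v\<in>alg. cs \<mu> \<star> rs \<mu> = v \<star> young_idem \<mu>"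
proof -
  show "\<exists>u\<in>alg. young_idem \<mu> = u \<star> (cs \<mu> \<star> rs \<mu>)"
    by (intro bexI[of _ "inverse (young_factor \<mu>) *\<^sub>F rs \<mu>"])
       (simp_all add: young_idem_def young_def bilinear_ext_scale conv_assoc)
  let ?n = "of_nat (card (stab (row_of \<mu>))) :: complex"
  obtain d where d: "rs \<mu> \<star> (cs \<mu> \<star> rs \<mu>) \<star> cs \<mu> = d *\<^sub>F (rs \<mu> \<star> cs \<mu>)"
    using row_conv_col_scalar[OF \<mu>, of "cs \<mu> \<star> rs \<mu>"] by auto
  have "young_factor \<mu> *\<^sub>F young \<mu> = young \<mu> \<star> young \<mu>"
    using young_square(1)[OF \<mu>] by simp
  also have "\<dots> = rs \<mu> \<star> cs \<mu> \<star> (rs \<mu> \<star> rs \<mu>) \<star> cs \<mu> \<star> rs \<mu>"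
    by (simp add: young_def conv_assoc)
  also have "\<dots> = ?n *\<^sub>F (rs \<mu> \<star> (cs \<mu> \<star> rs \<mu>) \<star> cs \<mu> \<star> rs \<mu>)"
    unfolding rs_def row_sum_square by (simp add: bilinear_ext_scale conv_assoc)
  also have "\<dots> = (?n * d) *\<^sub>F young \<mu>"
    unfolding d by (simp add: young_def bilinear_ext_scale)
  \<comment> \<open>Squaring the symmetrizer produces the same \<open>d\<close>, times the order of
    the row group; so \<open>d\<close> is nonzero because \<open>young_factor \<mu>\<close>
    is.\<close>
  finally have nd: "young_factor \<mu> = ?n * d"
    using young_nonzero[OF \<mu>] by (metis fun_vs.scale_right_imp_eq)
  then have d0: "d \<noteq> 0" using young_square(2)[OF \<mu>] by auto
  \<comment> \<open>The adjoint turns the relation for row-column products into the one for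
    column-row products.\<close>
  have "star (rs \<mu> \<star> (cs \<mu> \<star> rs \<mu>) \<star> cs \<mu>) = star (d *\<^sub>F (rs \<mu> \<star> cs \<mu>))" using d by simp
  then have "cs \<mu> \<star> young \<mu> = cnj d *\<^sub>F (cs \<mu> \<star> rs \<mu>)"
    by (simp add: star_conv star_scale young_def conv_assoc)
  then have "cs \<mu> \<star> rs \<mu> = ((young_factor \<mu> / cnj d) *\<^sub>F cs \<mu>) \<star> young_idem \<mu>"
    using d0 young_square(2)[OF \<mu>] by (simp add: young_idem_def bilinear_ext_scale)
  then show "\<exists>v\<in>alg. cs \<mu> \<star> rs \<mu> = v \<star> young_idem \<mu>" by blast
qed

end

section \<open>Cycle types\<close>

definition cyc :: "('x \<Rightarrow> 'x) \<Rightarrow> 'x \<Rightarrow> 'x set"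
  where "cyc p x = range (\<lambda>n. (p ^^ n) x)"

definition per :: "('x \<Rightarrow> 'x) \<Rightarrow> 'x \<Rightarrow> nat"
  where "per p x = (LEAST m. 0 < m \<and> (p ^^ m) x = x)"

context
  fixes p :: "'x \<Rightarrow> 'x" and S :: "'x set"
  assumes p: "p permutes S" and S: "finite S"
begin

lemma funpow_in: "x \<in> S \<Longrightarrow> (p ^^ n) x \<in> S"
  by (induction n) (auto simp: permutes_in_image[OF p])

lemma funpow_eq_iff_diff:
  assumes "i \<le> j"
  shows "(p ^^ i) x = (p ^^ j) x \<longleftrightarrow> (p ^^ (j - i)) x = x"
proof -
  have "(p ^^ j) x = (p ^^ i) ((p ^^ (j - i)) x)"
    using assms by (metis comp_apply funpow_add le_add_diff_inverse)
  moreover have "inj (p ^^ i)" by (rule inj_fn[OF permutes_inj[OF p]])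
  ultimately show ?thesis by (auto simp: inj_eq)
qed

lemma per:
  assumes x: "x \<in> S"
  shows "0 < per p x" "(p ^^ per p x) x = x"
proof -
  have "\<not> inj (\<lambda>n. (p ^^ n) x)"
    using S funpow_in[OF x] finite_imageD[of "\<lambda>n. (p ^^ n) x" UNIV]
    by (metis finite_subset image_subsetI infinite_UNIV_nat)
  then obtain i j where "i < j" "(p ^^ i) x = (p ^^ j) x"
    unfolding inj_def by (metis linorder_neqE_nat)
  then have "0 < j - i \<and> (p ^^ (j - i)) x = x"
    using funpow_eq_iff_diff[of i j x] by simp
  then show "0 < per p x" "(p ^^ per p x) x = x"
    unfolding per_def by (metis (mono_tags, lifting) LeastI)+
qed

lemma funpow_eq_iff:
  assumes x: "x \<in> S"
  shows "(p ^^ i) x = (p ^^ j) x \<longleftrightarrow> i mod per p x = j mod per p x"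
proof -
  let ?m = "per p x"
  have le: "a = b" if ab: "a \<le> b" "b < ?m" "(p ^^ a) x = (p ^^ b) x" for a b
  proof (rule ccontr)
    assume "a \<noteq> b"
    then have "0 < b - a \<and> (p ^^ (b - a)) x = x" using ab funpow_eq_iff_diff[OF ab(1)] by simp
    then have "?m \<le> b - a" unfolding per_def by (rule Least_le)
    then show False using ab by linarith
  qed
  have m: "(p ^^ i) x = (p ^^ (i mod ?m)) x" for i
    using funpow_mod_eq[OF per(2)[OF x], of i] by simp
  have lt: "i mod ?m < ?m" for i using per(1)[OF x] by simp
  have "(p ^^ (i mod ?m)) x = (p ^^ (j mod ?m)) x \<Longrightarrow> i mod ?m = j mod ?m"
    using le[of "i mod ?m" "j mod ?m"] le[of "j mod ?m" "i mod ?m"] lt by (metis nle_le)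
  then show ?thesis using m by metis
qed

lemma cyc_subset: "x \<in> S \<Longrightarrow> cyc p x \<subseteq> S"
  using funpow_in by (auto simp: cyc_def)

lemma cyc_self: "x \<in> cyc p x"
  unfolding cyc_def by (rule range_eqI[of _ _ 0]) simp

lemma cyc_funpow:
  assumes x: "x \<in> S"
  shows "cyc p ((p ^^ i) x) = cyc p x"
proof (intro subset_antisym subsetI)
  fix y assume "y \<in> cyc p ((p ^^ i) x)"
  then obtain n where "y = (p ^^ n) ((p ^^ i) x)" by (auto simp: cyc_def)
  then have "y = (p ^^ (n + i)) x" by (simp add: funpow_add)
  then show "y \<in> cyc p x" by (auto simp: cyc_def)
next
  fix y assume "y \<in> cyc p x"
  then obtain n where n: "y = (p ^^ n) x" by (auto simp: cyc_def)
  \<comment> \<open>Exponents are natural numbers: going back \<open>i\<close> steps along the cycle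
    amounts to going forward \<open>i * (per p x - 1)\<close> steps.\<close>
  let ?m = "n + i * (per p x - 1)"
  have "?m + i = n + i * per p x"
    using per(1)[OF x] by (cases "per p x") auto
  then have "(?m + i) mod per p x = n mod per p x" by (simp only: mod_mult_self1)
  then have "(p ^^ (?m + i)) x = y" unfolding n funpow_eq_iff[OF x] .
  then have "y = (p ^^ ?m) ((p ^^ i) x)" by (simp add: funpow_add)
  then show "y \<in> cyc p ((p ^^ i) x)" by (auto simp: cyc_def)
qed

lemma cyc_eq:
  assumes "x \<in> S" "y \<in> cyc p x"
  shows "cyc p y = cyc p x"
proof -
  obtain n where "y = (p ^^ n) x" using assms(2) by (auto simp: cyc_def)
  then show ?thesis using cyc_funpow[OF assms(1)] by simp
qed

lemma card_cyc:
  assumes x: "x \<in> S"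
  shows "card (cyc p x) = per p x"
proof -
  have "cyc p x = (\<lambda>n. (p ^^ n) x) ` {..<per p x}"
  proof (intro subset_antisym subsetI)
    fix y assume "y \<in> cyc p x"
    then obtain n where "y = (p ^^ n) x" by (auto simp: cyc_def)
    then have "y = (p ^^ (n mod per p x)) x" using funpow_eq_iff[OF x, of n "n mod per p x"] by simp
    then show "y \<in> (\<lambda>n. (p ^^ n) x) ` {..<per p x}" using per(1)[OF x] by auto
  qed (auto simp: cyc_def)
  moreover have "inj_on (\<lambda>n. (p ^^ n) x) {..<per p x}"
    by (rule inj_onI) (simp add: funpow_eq_iff[OF x])
  ultimately show ?thesis by (simp add: card_image)
qed

end

definition cycle_reps :: "nat \<Rightarrow> (nat \<Rightarrow> nat) \<Rightarrow> nat set"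
  where "cycle_reps k p = {x \<in> {1..k}. x = Min (cyc p x)}"

text \<open>Fixed points count as cycles of length 1 and the lengths are listed in decreasing order,
  so that the result is a partition of \<open>k\<close>.\<close>

definition cycle_type :: "nat \<Rightarrow> (nat \<Rightarrow> nat) \<Rightarrow> nat list"
  where "cycle_type k p = rev (sort (map (per p) (sorted_list_of_set (cycle_reps k p))))"

context
  fixes k :: nat and p :: "nat \<Rightarrow> nat"
  assumes p: "p permutes {1..k}"
begin

lemmas p_facts = p finite_atLeastAtMost[of 1 k]

lemma finite_cycle_reps [simp]: "finite (cycle_reps k p)"
  by (simp add: cycle_reps_def)

lemma cycle_repsD: "r \<in> cycle_reps k p \<Longrightarrow> r \<in> {1..k}" "r \<in> cycle_reps k p \<Longrightarrow> Min (cyc p r) = r"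
  by (simp_all add: cycle_reps_def)

lemma rep_funpow: "r \<in> cycle_reps k p \<Longrightarrow> Min (cyc p ((p ^^ i) r)) = r"
  using cyc_funpow[OF p_facts cycle_repsD(1)] cycle_repsD(2) by simp

lemma ex_cycle_rep:
  assumes x: "x \<in> {1..k}"
  shows "\<exists>r\<in>cycle_reps k p. \<exists>i. x = (p ^^ i) r"
proof -
  let ?r = "Min (cyc p x)"
  have fin: "finite (cyc p x)"
    using cyc_subset[OF p_facts x] finite_atLeastAtMost by (rule finite_subset)
  have r: "?r \<in> cyc p x" by (rule Min_in[OF fin]) (use cyc_self[OF p_facts, of x] in auto)
  have eq: "cyc p ?r = cyc p x" by (rule cyc_eq[OF p_facts x r])
  have "?r \<in> cycle_reps k p"
    using cyc_subset[OF p_facts x] r eq unfolding cycle_reps_def by auto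
  moreover have "x \<in> cyc p ?r" unfolding eq by (rule cyc_self[OF p_facts])
  ultimately show ?thesis by (auto simp: cyc_def)
qed

lemma sum_per: "(\<Sum>r\<in>cycle_reps k p. per p r) = k"
proof -
  have "(\<Sum>r\<in>cycle_reps k p. per p r) = (\<Sum>r\<in>cycle_reps k p. card (cyc p r))"
    by (intro sum.cong refl) (simp only: card_cyc[OF p_facts cycle_repsD(1)])
  also have "\<dots> = card (\<Union>r\<in>cycle_reps k p. cyc p r)"
  proof (rule card_UN_disjoint[symmetric])
    show "\<forall>r\<in>cycle_reps k p. finite (cyc p r)"
      using cyc_subset[OF p_facts cycle_repsD(1)] finite_subset by blast
    show "\<forall>r\<in>cycle_reps k p. \<forall>s\<in>cycle_reps k p. r \<noteq> s \<longrightarrow> cyc p r \<inter> cyc p s = {}"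
    proof (intro ballI impI, rule ccontr)
      fix r s assume rs: "r \<in> cycle_reps k p" "s \<in> cycle_reps k p" "r \<noteq> s" "cyc p r \<inter> cyc p s \<noteq> {}"
      then obtain y where "y \<in> cyc p r" "y \<in> cyc p s" by blast
      then have "cyc p r = cyc p s"
        using cyc_eq[OF p_facts cycle_repsD(1)] rs(1,2) by metis
      then show False using cycle_repsD(2) rs by metis
    qed
  qed simp
  also have "(\<Union>r\<in>cycle_reps k p. cyc p r) = {1..k}"
  proof
    show "(\<Union>r\<in>cycle_reps k p. cyc p r) \<subseteq> {1..k}"
      using cyc_subset[OF p_facts cycle_repsD(1)] by blast
    show "{1..k} \<subseteq> (\<Union>r\<in>cycle_reps k p. cyc p r)"
      using ex_cycle_rep by (fastforce simp: cyc_def)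
  qed
  finally show ?thesis by simp
qed

lemma is_partition_cycle_type: "is_partition k (cycle_type k p)"
proof -
  have "sum_list (cycle_type k p) = sum_list (map (per p) (sorted_list_of_set (cycle_reps k p)))"
    unfolding cycle_type_def
    by (metis mset_rev mset_sort sum_mset_sum_list)
  also have "\<dots> = k"
    using sum_per by (simp add: sum_list_distinct_conv_sum_set)
  finally have "sum_list (cycle_type k p) = k" .
  moreover have "0 \<notin> set (cycle_type k p)"
  proof -
    have "per p r \<noteq> 0" if "r \<in> cycle_reps k p" for r
      using per(1)[OF p_facts cycle_repsD(1)[OF that]] by simp
    then show ?thesis by (force simp: cycle_type_def)
  qed
  moreover have "sorted_wrt (\<ge>) (cycle_type k p)"
    unfolding cycle_type_def by (simp add: sorted_wrt_rev)
  ultimately show ?thesis by (simp add: is_partition_def)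
qed

end

text \<open>Sorting both lists by their keys makes the key lists equal; elements in equal positions
  are then matched.\<close>

lemma bij_matching:
  assumes "mset (map f xs) = mset (map g ys)" "distinct xs" "distinct ys"
  shows "\<exists>h. bij_betw h (set xs) (set ys) \<and> (\<forall>x\<in>set xs. g (h x) = (f x :: 'z :: linorder))"
proof -
  let ?xs = "sort_key f xs" and ?ys = "sort_key g ys"
  have "map f ?xs = sort (map f xs)"
    by (rule properties_for_sort[symmetric]) simp_all
  moreover have "map g ?ys = sort (map g ys)"
    by (rule properties_for_sort[symmetric]) simp_all
  moreover have "sort (map f xs) = sort (map g ys)"
    using assms(1) by (metis properties_for_sort sorted_sort mset_sort)
  ultimately have eq: "map f ?xs = map g ?ys" by simp
  then have len: "length ?xs = length ?ys" by (metis length_map)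
  let ?n = "length ?xs"
  have bx: "bij_betw ((!) ?xs) {..<?n} (set xs)"
    by (rule bij_betw_nth) (use assms in simp_all)
  have by': "bij_betw ((!) ?ys) {..<?n} (set ys)"
    by (rule bij_betw_nth) (use assms len in simp_all)
  let ?h = "(!) ?ys \<circ> inv_into {..<?n} ((!) ?xs)"
  have "bij_betw ?h (set xs) (set ys)"
    by (rule bij_betw_trans[OF bij_betw_inv_into[OF bx] by'])
  moreover have "g (?h x) = f x" if x: "x \<in> set xs" for x
  proof -
    let ?i = "inv_into {..<?n} ((!) ?xs) x"
    have i: "?i < ?n" "?xs ! ?i = x"
      using bij_betwE[OF bij_betw_inv_into[OF bx]] x bij_betw_inv_into_right[OF bx x] by auto
    have "g (?ys ! ?i) = map g ?ys ! ?i" using i(1) len by simp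
    also have "\<dots> = f x" unfolding eq[symmetric] using i by simp
    finally show ?thesis by simp
  qed
  ultimately show ?thesis by blast
qed

text \<open>The conjugating map sends \<open>(p ^^ i) r\<close> to \<open>(q ^^ i) (h r)\<close>,
  where \<open>h\<close> matches representatives of cycles of equal length. It intertwines
  \<open>p\<close> and \<open>q\<close> by construction.\<close>

lemma cycle_type_conjugate:
  assumes p: "p permutes {1..k}" and q: "q permutes {1..k}" and eq: "cycle_type k p = cycle_type k q"
  shows "\<exists>g. g permutes {1..k} \<and> q = g \<circ> p \<circ> inv' g"
proof -
  let ?X = "{1..k}"
  note pf = p finite_atLeastAtMost[of 1 k] and qf = q finite_atLeastAtMost[of 1 k]
  have "mset (map (per p) (sorted_list_of_set (cycle_reps k p))) =
        mset (map (per q) (sorted_list_of_set (cycle_reps k q)))"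
    using eq unfolding cycle_type_def by (metis mset_rev mset_sort)
  then obtain h where h: "bij_betw h (cycle_reps k p) (cycle_reps k q)"
    and h_per: "\<And>r. r \<in> cycle_reps k p \<Longrightarrow> per q (h r) = per p r"
    using bij_matching[of "per p" "sorted_list_of_set (cycle_reps k p)" "per q"
        "sorted_list_of_set (cycle_reps k q)"] finite_cycle_reps[OF p] finite_cycle_reps[OF q]
    by auto
  \<comment> \<open>Any exponent reaching \<open>x\<close> from its representative will do: it is
    unique modulo the cycle length, which \<open>h\<close> preserves.\<close>
  define idx where "idx x = (SOME i. x = (p ^^ i) (Min (cyc p x)))" for x
  define g where "g x = (if x \<in> ?X then (q ^^ idx x) (h (Min (cyc p x))) else x)" for x
  have hr: "h r \<in> cycle_reps k q" if "r \<in> cycle_reps k p" for r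
    using h that by (auto simp: bij_betw_def)
  have g_eq: "g ((p ^^ i) r) = (q ^^ i) (h r)" if r: "r \<in> cycle_reps k p" for r i
  proof -
    have rX: "r \<in> ?X" by (rule cycle_repsD(1)[OF p r])
    have "(p ^^ i) r = (p ^^ idx ((p ^^ i) r)) r"
      using someI[of "\<lambda>j. (p ^^ i) r = (p ^^ j) (Min (cyc p ((p ^^ i) r)))" i]
      unfolding idx_def rep_funpow[OF p r] by simp
    then have "i mod per q (h r) = idx ((p ^^ i) r) mod per q (h r)"
      using funpow_eq_iff[OF pf rX] h_per[OF r] by simp
    then have "(q ^^ idx ((p ^^ i) r)) (h r) = (q ^^ i) (h r)"
      using funpow_eq_iff[OF qf cycle_repsD(1)[OF q hr[OF r]]] by simp
    then show ?thesis
      using funpow_in[OF pf rX, of i] unfolding g_def rep_funpow[OF p r] by (simp only: if_True)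
  qed
  have g_in: "g x \<in> ?X" if x: "x \<in> ?X" for x
  proof -
    obtain r i where r: "r \<in> cycle_reps k p" "x = (p ^^ i) r" using ex_cycle_rep[OF p x] by blast
    show ?thesis
      unfolding r(2) g_eq[OF r(1)] by (rule funpow_in[OF qf cycle_repsD(1)[OF q hr[OF r(1)]]])
  qed
  have "inj_on g ?X"
  proof (rule inj_onI)
    fix x y assume x: "x \<in> ?X" and y: "y \<in> ?X" and gxy: "g x = g y"
    obtain r i where r: "r \<in> cycle_reps k p" "x = (p ^^ i) r" using ex_cycle_rep[OF p x] by blast
    obtain s j where s: "s \<in> cycle_reps k p" "y = (p ^^ j) s" using ex_cycle_rep[OF p y] by blast
    have e: "(q ^^ i) (h r) = (q ^^ j) (h s)" using gxy g_eq r s by simp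
    then have "h r = h s"
      using rep_funpow[OF q hr[OF r(1)], of i] rep_funpow[OF q hr[OF s(1)], of j] by simp
    then have rs: "r = s" using h r(1) s(1) by (auto simp: bij_betw_def inj_on_def)
    then have "i mod per p r = j mod per p r"
      using e funpow_eq_iff[OF qf cycle_repsD(1)[OF q hr[OF r(1)]]] h_per[OF r(1)] by simp
    then show "x = y"
      using funpow_eq_iff[OF pf cycle_repsD(1)[OF p r(1)]] r(2) s(2) rs by simp
  qed
  then have "bij_betw g ?X ?X"
    using g_in by (intro bij_betw_imageI endo_inj_surj) auto
  then have g: "g permutes ?X"
    by (rule bij_imp_permutes) (simp only: g_def if_False)
  have "g \<circ> p = q \<circ> g"
  proof
    fix x
    show "(g \<circ> p) x = (q \<circ> g) x"
    proof (cases "x \<in> ?X")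
      case True
      obtain r i where r: "r \<in> cycle_reps k p" "x = (p ^^ i) r" using ex_cycle_rep[OF p True] by blast
      show ?thesis using g_eq[OF r(1), of "Suc i"] g_eq[OF r(1), of i] r(2) by simp
    next
      case False
      then show ?thesis using p q g by (simp add: permutes_not_in)
    qed
  qed
  then have "q = g \<circ> p \<circ> inv' g" by (simp add: comp_assoc permutes_inv_o[OF g])
  then show ?thesis using g by blast
qed

lemma finite_partitions: "finite {\<mu>. is_partition k \<mu>}"
proof (rule finite_subset)
  show "{\<mu>. is_partition k \<mu>} \<subseteq> {xs. set xs \<subseteq> {..k} \<and> length xs \<le> k}"
  proof clarify
    fix \<mu> assume \<mu>: "is_partition k \<mu>"
    have "x \<le> k" if "x \<in> set \<mu>" for x
      using member_le_sum_list[OF that] \<mu> by (simp add: is_partition_def)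
    moreover have "length \<mu> \<le> k"
    proof -
      have "sum_list (map (\<lambda>_. 1) \<mu>) \<le> sum_list (map (\<lambda>x. x) \<mu>)"
        using \<mu> by (intro sum_list_mono) (metis One_nat_def Suc_leI is_partition_def neq0_conv)
      then show ?thesis using \<mu> by (simp add: sum_list_triv is_partition_def)
    qed
    ultimately show "set \<mu> \<subseteq> {..k} \<and> length \<mu> \<le> k" by auto
  qed
qed (rule finite_lists_length_le, simp)

section \<open>Completeness of the Young symmetrizers\<close>

context symmetric_group_algebra
begin

definition "parts = {\<mu>. is_partition k \<mu>}"
definition "central_young \<mu> = conj_sum (young_idem \<mu>)"

lemma central_young_in [simp, intro]: "central_young \<mu> \<in> alg"
  by (simp add: central_young_def)

lemma central_young_orthogonal:
  assumes "\<kappa> \<in> parts" "\<mu> \<in> parts" "\<kappa> \<noteq> \<mu>"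
  shows "central_young \<kappa> \<star> central_young \<mu> = 0"
proof -
  have "delta g \<star> young_idem \<kappa> \<star> delta (inv' g) \<star> (delta h \<star> young_idem \<mu> \<star> delta (inv' h)) = 0"
    if "g permutes {1..k}" "h permutes {1..k}" for g h
  proof -
    have zero: "young_idem \<kappa> \<star> (delta (inv' g) \<star> delta h) \<star> young_idem \<mu> = 0"
      using assms by (intro young_idem_orthogonal) (auto simp: parts_def)
    have "delta g \<star> young_idem \<kappa> \<star> delta (inv' g) \<star> (delta h \<star> young_idem \<mu> \<star> delta (inv' h)) =
      delta g \<star> (young_idem \<kappa> \<star> (delta (inv' g) \<star> delta h) \<star> young_idem \<mu>) \<star> delta (inv' h)"
      by (simp only: conv_assoc)
    then show ?thesis unfolding zero by simp
  qed
  then show ?thesis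
    by (simp add: central_young_def conj_sum_def bilinear_ext_sum)
qed

text \<open>By idempotency and self-adjointness, the value of \<open>young_idem \<mu>\<close> at the
  identity is its squared norm; summing over conjugates multiplies this value by the group
  order.\<close>

lemma central_young_nonzero:
  assumes "\<mu> \<in> parts"
  shows "central_young \<mu> \<noteq> 0"
proof -
  have \<mu>: "is_partition k \<mu>" using assms by (simp add: parts_def)
  have "young_idem \<mu> id \<noteq> 0"
    using young_idem[OF \<mu>] conv_star_eq_0_iff[of "young_idem \<mu>"] by simp
  moreover have "card (carrier (sym_group k)) \<noteq> 0"
    using one_closed finite_carrier by (metis card_0_eq empty_iff)
  ultimately have "central_young \<mu> id \<noteq> 0"
    using conj_sum_one[of "young_idem \<mu>"] by (simp add: central_young_def del: card_eq_0_iff)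
  then show ?thesis by auto
qed

lemma central_young_square:
  assumes "\<mu> \<in> parts"
  shows "central_young \<mu> \<star> central_young \<mu> \<noteq> 0"
proof -
  have "star (central_young \<mu>) = central_young \<mu>"
    using assms young_idem(3) by (simp add: central_young_def star_conj_sum parts_def)
  then have "(central_young \<mu> \<star> central_young \<mu>) id \<noteq> 0"
    using conv_star_eq_0_iff[of "central_young \<mu>"] central_young_nonzero[OF assms] by simp
  then show ?thesis by auto
qed

definition "type_indicator \<mu> = (\<lambda>g. if g permutes {1..k} \<and> cycle_type k g = \<mu> then 1 else 0 :: complex)"

text \<open>Permutations of equal cycle type are conjugate, so a class function is determined by one
  value per partition.\<close>

lemma class_function_in_span:
  assumes z: "z \<in> alg"
    and cf: "\<And>g h. g permutes {1..k} \<Longrightarrow> h permutes {1..k} \<Longrightarrow> z (h \<circ> g \<circ> inv' h) = z g"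
  shows "z \<in> fun_vs.span (type_indicator ` parts)"
proof -
  define rep where "rep \<mu> = (SOME g. g permutes {1..k} \<and> cycle_type k g = \<mu>)" for \<mu>
  have "z = (\<Sum>\<mu>\<in>parts. z (rep \<mu>) *\<^sub>F type_indicator \<mu>)"
  proof
    fix g
    show "z g = (\<Sum>\<mu>\<in>parts. z (rep \<mu>) *\<^sub>F type_indicator \<mu>) g"
    proof (cases "g permutes {1..k}")
      case True
      let ?t = "cycle_type k g"
      have t: "?t \<in> parts" using is_partition_cycle_type[OF True] by (simp add: parts_def)
      have "rep ?t permutes {1..k} \<and> cycle_type k (rep ?t) = ?t"
        unfolding rep_def by (rule someI[of _ g]) (use True in simp)
      then obtain h where h: "h permutes {1..k}" "g = h \<circ> rep ?t \<circ> inv' h" "rep ?t permutes {1..k}"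
        using cycle_type_conjugate[of "rep ?t" k g] True by metis
      then have "z g = z (rep ?t)" using cf by metis
      also have "\<dots> = (\<Sum>\<mu>\<in>parts. if \<mu> = ?t then z (rep \<mu>) else 0)"
        using t finite_partitions[of k] by (simp add: parts_def)
      also have "\<dots> = (\<Sum>\<mu>\<in>parts. z (rep \<mu>) *\<^sub>F type_indicator \<mu>) g"
        using True by (auto simp: type_indicator_def intro!: sum.cong)
      finally show ?thesis .
    next
      case False
      then have "z g = 0" using z unfolding functions_on_def by simp
      moreover have "type_indicator \<mu> g = 0" for \<mu> using False by (simp add: type_indicator_def)
      ultimately show ?thesis by simp
    qed
  qed
  also have "\<dots> \<in> fun_vs.span (type_indicator ` parts)"
    by (intro fun_vs.span_sum fun_vs.span_scale fun_vs.span_base) simp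
  finally show ?thesis .
qed

text \<open>The central elements are orthogonal with nonzero squares, hence independent, and there
  are as many of them as partitions of \<open>k\<close>. Class functions are spanned by that many
  indicators, so the central elements span them all, in particular the identity.\<close>

theorem one_eq_sum_central_young: "\<exists>c. delta id = (\<Sum>\<mu>\<in>parts. c \<mu> *\<^sub>F central_young \<mu>)"
proof -
  have fin: "finite parts" using finite_partitions by (simp add: parts_def)
  have inj: "inj_on central_young parts"
    using central_young_orthogonal central_young_square by (metis inj_onI)
  let ?Z = "central_young ` parts" and ?T = "type_indicator ` parts"
  have indep: "\<not> fun_vs.dependent ?Z"
  proof (rule fun_vs.independent_if_scalars_zero)
    fix u z assume sum: "(\<Sum>z\<in>?Z. u z *\<^sub>F z) = 0" and "z \<in> ?Z"
    then obtain \<mu> where \<mu>: "\<mu> \<in> parts" "z = central_young \<mu>" by blast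
    have "0 = (\<Sum>\<nu>\<in>parts. u (central_young \<nu>) *\<^sub>F central_young \<nu>) \<star> central_young \<mu>"
      using sum inj by (simp add: sum.reindex)
    also have "\<dots> = (\<Sum>\<nu>\<in>parts. if \<nu> = \<mu> then u z *\<^sub>F (central_young \<mu> \<star> central_young \<mu>) else 0)"
      unfolding bilinear_ext_sum bilinear_ext_scale
      using \<mu> central_young_orthogonal by (intro sum.cong refl) auto
    also have "\<dots> = u z *\<^sub>F (central_young \<mu> \<star> central_young \<mu>)"
      using \<mu>(1) fin by simp
    finally show "u z = 0" using central_young_square[OF \<mu>(1)] by (metis fun_vs.scale_eq_0_iff)
  qed (use fin in simp)
  have Z_T: "?Z \<subseteq> fun_vs.span ?T"
  proof clarify
    fix \<mu> assume "\<mu> \<in> parts"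
    show "central_young \<mu> \<in> fun_vs.span ?T"
      using conj_sum_class_function[of "young_idem \<mu>"]
      by (intro class_function_in_span) (simp_all add: central_young_def)
  qed
  have one_T: "delta id \<in> fun_vs.span ?T"
  proof (rule class_function_in_span)
    show "delta id \<in> alg" by (simp add: permutes_id)
    fix g h :: "nat \<Rightarrow> nat" assume h: "h permutes {1..k}"
    have "h \<circ> g \<circ> inv' h = id \<longleftrightarrow> g = id"
      using permutes_inv_o[OF h] by (metis comp_assoc comp_id id_comp)
    then show "delta id (h \<circ> g \<circ> inv' h) = delta id g" by (simp add: delta_apply)
  qed
  have "delta id \<in> fun_vs.span ?Z"
  proof (rule ccontr)
    assume n: "delta id \<notin> fun_vs.span ?Z"
    then have "\<not> fun_vs.dependent (insert (delta id) ?Z)"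
      using indep by (rule fun_vs.independent_insertI)
    then have "card (insert (delta id) ?Z) \<le> card ?T"
      using fun_vs.independent_span_bound[of ?T "insert (delta id) ?Z"] Z_T one_T fin by simp
    moreover have "card (insert (delta id) ?Z) = Suc (card parts)"
      using n fin inj by (subst card_insert_disjoint) (auto simp: card_image intro: fun_vs.span_base)
    moreover have "card ?T \<le> card parts" by (rule card_image_le[OF fin])
    ultimately show False by simp
  qed
  then obtain u where "delta id = (\<Sum>z\<in>?Z. u z *\<^sub>F z)"
    using fin by (auto simp: fun_vs.span_finite)
  then show ?thesis
    using inj by (intro exI[of _ "u \<circ> central_young"]) (simp add: sum.reindex)
qed

end

section \<open>Specht modules as left ideals\<close>

lemma perm_tabloid_of: "perm_tabloid p (tabloid_of \<mu> t) = tabloid_of \<mu> (p \<circ> t)"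
  by (auto simp: perm_tabloid_def tabloid_of_def)

lemma perm_tabloid_comp: "perm_tabloid (p \<circ> q) T = perm_tabloid p (perm_tabloid q T)"
  by (simp add: perm_tabloid_def image_comp)

lemma perm_tabloid_id [simp]: "perm_tabloid id T = T"
  by (simp add: perm_tabloid_def)

lemma finite_tabloids [simp]: "finite (tabloids \<mu>)"
proof (rule finite_subset)
  show "tabloids \<mu> \<subseteq> {xs. set xs \<subseteq> Pow {1..sum_list \<mu>} \<and> length xs = length \<mu>}"
  proof clarify
    fix T assume "T \<in> tabloids \<mu>"
    then obtain t where t: "bij_betw t (cells \<mu>) {1..sum_list \<mu>}" "T = tabloid_of \<mu> t"
      by (auto simp: tabloids_def tableau_def)
    show "set T \<subseteq> Pow {1..sum_list \<mu>} \<and> length T = length \<mu>"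
      using bij_betwE[OF t(1)] by (auto simp: t(2) tabloid_of_def simp del: One_nat_def)
  qed
qed (simp add: finite_lists_length_eq)

context symmetric_group_algebra
begin

lemma stab_iff_image:
  assumes p: "p permutes {1..k}"
  shows "p \<in> stab r \<longleftrightarrow> (\<forall>j. p ` {x \<in> {1..k}. r x = j} = {x \<in> {1..k}. r x = j})"
proof
  assume ps: "p \<in> stab r"
  show "\<forall>j. p ` {x \<in> {1..k}. r x = j} = {x \<in> {1..k}. r x = j}"
  proof (intro allI subset_antisym subsetI)
    fix j x assume "x \<in> {x \<in> {1..k}. r x = j}"
    then show "x \<in> p ` {x \<in> {1..k}. r x = j}"
      using stab_apply[OF stab_inv[OF ps], of x] permutes_inverses(1)[OF p, of x]
      by (intro image_eqI[of _ _ "inv' p x"]) auto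
  qed (use stab_apply[OF ps] in auto)
next
  assume *: "\<forall>j. p ` {x \<in> {1..k}. r x = j} = {x \<in> {1..k}. r x = j}"
  show "p \<in> stab r"
  proof (rule stabI[OF p])
    fix x assume "x \<in> {1..k}"
    then have "p x \<in> p ` {y \<in> {1..k}. r y = r x}" by blast
    then show "r (p x) = r x" unfolding *[rule_format, of "r x"] by blast
  qed
qed

end

locale specht = symmetric_group_algebra k for k +
  fixes \<mu>
  assumes \<mu>: "is_partition k \<mu>"
begin

definition "T\<^sub>0 = tabloid_of \<mu> (std_tableau \<mu>)"

text \<open>The orbit map of a fixed tabloid, extended linearly: it presents the tabloid module as a
  quotient of the group algebra.\<close>

definition \<Theta> :: "((nat \<Rightarrow> nat) \<Rightarrow> complex) \<Rightarrow> nat set list \<Rightarrow> complex"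
  where "\<Theta> x = bilinear_ext (carrier (sym_group k)) (tabloids \<mu>) perm_tabloid x (delta T\<^sub>0)"

lemma sum_list_\<mu>: "sum_list \<mu> = k"
  using \<mu> by (simp add: is_partition_def)

lemma tableau_comp:
  assumes "tableau \<mu> t" "p permutes {1..k}"
  shows "tableau \<mu> (p \<circ> t)"
  using assms bij_betw_trans[of t "cells \<mu>" "{1..k}" p "{1..k}"] permutes_imp_bij[of p "{1..k}"]
  by (simp add: tableau_def sum_list_\<mu>)

lemma T\<^sub>0_in [simp]: "T\<^sub>0 \<in> tabloids \<mu>"
  unfolding T\<^sub>0_def tabloids_def using tableau_std by blast

lemma perm_tabloid_in: "p permutes {1..k} \<Longrightarrow> T \<in> tabloids \<mu> \<Longrightarrow> perm_tabloid p T \<in> tabloids \<mu>"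
  unfolding tabloids_def using tableau_comp perm_tabloid_of by blast

lemma tableau_perm:
  assumes t: "tableau \<mu> t"
  obtains g where "g permutes {1..k}" "\<And>c. c \<in> cells \<mu> \<Longrightarrow> t c = g (std_tableau \<mu> c)"
proof -
  have bt: "bij_betw t (cells \<mu>) {1..k}" using t by (simp add: tableau_def sum_list_\<mu>)
  let ?i = "inv_into (cells \<mu>) (std_tableau \<mu>)"
  define g where "g x = (if x \<in> {1..k} then t (?i x) else x)" for x
  have "bij_betw (t \<circ> ?i) {1..k} {1..k}"
    by (rule bij_betw_trans[OF bij_betw_inv_into[OF std_bij[OF \<mu>]] bt])
  then have "bij_betw g {1..k} {1..k}"
    by (rule iffD1[OF bij_betw_cong, rotated]) (simp only: g_def comp_def if_True)
  then have "g permutes {1..k}"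
    by (rule bij_imp_permutes) (simp only: g_def if_False)
  moreover have "t c = g (std_tableau \<mu> c)" if c: "c \<in> cells \<mu>" for c
  proof -
    have "?i (std_tableau \<mu> c) = c"
      by (rule bij_betw_inv_into_left[OF std_bij[OF \<mu>] c])
    then show ?thesis
      unfolding g_def using pos_std(3)[OF \<mu> c] by (simp only: if_True)
  qed
  ultimately show ?thesis by (rule that)
qed

lemma tabloid_of_perm:
  assumes "\<And>c. c \<in> cells \<mu> \<Longrightarrow> t c = g (std_tableau \<mu> c)"
  shows "tabloid_of \<mu> t = perm_tabloid g T\<^sub>0"
  unfolding T\<^sub>0_def perm_tabloid_of
  using assms by (auto simp: tabloid_of_def) (metis+)

lemma T\<^sub>0_eq: "T\<^sub>0 = map (\<lambda>i. {x \<in> {1..k}. row_of \<mu> x = i}) [0..<length \<mu>]"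
proof -
  have "{std_tableau \<mu> (i, j) |j. (i, j) \<in> cells \<mu>} = {x \<in> {1..k}. row_of \<mu> x = i}" for i
  proof (intro subset_antisym subsetI)
    fix x assume "x \<in> {x \<in> {1..k}. row_of \<mu> x = i}"
    then have x: "x \<in> {1..k}" "row_of \<mu> x = i" by blast+
    show "x \<in> {std_tableau \<mu> (i, j) |j. (i, j) \<in> cells \<mu>}"
      using std_pos[OF \<mu> x(1)] unfolding x(2) by (auto intro!: exI[of _ "col_of \<mu> x"])
  next
    fix x assume "x \<in> {std_tableau \<mu> (i, j) |j. (i, j) \<in> cells \<mu>}"
    then obtain j where "x = std_tableau \<mu> (i, j)" "(i, j) \<in> cells \<mu>" by blast
    then show "x \<in> {x \<in> {1..k}. row_of \<mu> x = i}"
      using pos_std(1,3)[OF \<mu>, of "(i, j)"] by simp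
  qed
  then show ?thesis by (simp add: T\<^sub>0_def tabloid_of_def)
qed

lemma column_eq:
  assumes "\<And>c. c \<in> cells \<mu> \<Longrightarrow> t c = g (std_tableau \<mu> c)"
  shows "{t (i, j) |i. (i, j) \<in> cells \<mu>} = g ` {x \<in> {1..k}. col_of \<mu> x = j}"
proof (intro subset_antisym subsetI)
  fix y assume "y \<in> g ` {x \<in> {1..k}. col_of \<mu> x = j}"
  then obtain x where x: "x \<in> {1..k}" "col_of \<mu> x = j" "y = g x" by blast
  have c: "(row_of \<mu> x, j) \<in> cells \<mu>" "std_tableau \<mu> (row_of \<mu> x, j) = x"
    using std_pos[OF \<mu> x(1)] unfolding x(2) by blast+
  then have "y = t (row_of \<mu> x, j)" using assms[OF c(1)] x(3) by simp
  then show "y \<in> {t (i, j) |i. (i, j) \<in> cells \<mu>}" using c(1) by blast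
next
  fix y assume "y \<in> {t (i, j) |i. (i, j) \<in> cells \<mu>}"
  then obtain i where i: "(i, j) \<in> cells \<mu>" "y = t (i, j)" by blast
  then show "y \<in> g ` {x \<in> {1..k}. col_of \<mu> x = j}"
    using assms[OF i(1)] pos_std(2,3)[OF \<mu> i(1)]
    by (intro image_eqI[of _ _ "std_tableau \<mu> (i, j)"]) auto
qed

lemma perm_T\<^sub>0_eq_iff:
  assumes p: "p permutes {1..k}"
  shows "perm_tabloid p T\<^sub>0 = T\<^sub>0 \<longleftrightarrow> p \<in> stab (row_of \<mu>)"
proof -
  have "perm_tabloid p T\<^sub>0 = T\<^sub>0 \<longleftrightarrow>
      (\<forall>i<length \<mu>. p ` {x \<in> {1..k}. row_of \<mu> x = i} = {x \<in> {1..k}. row_of \<mu> x = i})"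
    unfolding T\<^sub>0_eq perm_tabloid_def map_map map_eq_conv comp_def set_upt Ball_def atLeastLessThan_iff
    by (simp only: le0 simp_thms)
  also have "\<dots> \<longleftrightarrow> (\<forall>i. p ` {x \<in> {1..k}. row_of \<mu> x = i} = {x \<in> {1..k}. row_of \<mu> x = i})"
  proof -
    have empty: "{x \<in> {1..k}. row_of \<mu> x = i} = {}" if "\<not> i < length \<mu>" for i
      using row_of_less[OF \<mu>] that by blast
    have "p ` {x \<in> {1..k}. row_of \<mu> x = i} = {x \<in> {1..k}. row_of \<mu> x = i}"
      if "\<not> i < length \<mu>" for i
      unfolding empty[OF that] by simp
    then show ?thesis by blast
  qed
  also have "\<dots> \<longleftrightarrow> p \<in> stab (row_of \<mu>)" by (rule stab_iff_image[OF p, symmetric])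
  finally show ?thesis .
qed

lemma perm_T\<^sub>0_eq_iff2:
  assumes p: "p permutes {1..k}" and g: "g permutes {1..k}"
  shows "perm_tabloid p T\<^sub>0 = perm_tabloid g T\<^sub>0 \<longleftrightarrow> inv' p \<circ> g \<in> stab (row_of \<mu>)"
proof -
  have "perm_tabloid p T\<^sub>0 = perm_tabloid g T\<^sub>0 \<longleftrightarrow> perm_tabloid (inv' p \<circ> g) T\<^sub>0 = T\<^sub>0"
    by (metis g p perm_tabloid_comp perm_tabloid_id permutes_inv_o)
  then show ?thesis using perm_T\<^sub>0_eq_iff[OF permutes_compose[OF g permutes_inv[OF p]]] by simp
qed

lemma \<Theta>_linear:
  "\<Theta> (x + y) = \<Theta> x + \<Theta> y" "\<Theta> (c *\<^sub>F x) = c *\<^sub>F \<Theta> x" "\<Theta> (\<Sum>i\<in>I. h i) = (\<Sum>i\<in>I. \<Theta> (h i))" "\<Theta> 0 = 0"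
  by (simp_all add: \<Theta>_def bilinear_ext_add bilinear_ext_scale bilinear_ext_sum)

lemma \<Theta>_delta: "p permutes {1..k} \<Longrightarrow> \<Theta> (delta p) = delta (perm_tabloid p T\<^sub>0)"
  by (simp add: \<Theta>_def bilinear_ext_delta perm_tabloid_in)

lemma \<Theta>_conv: "\<Theta> (r \<star> x) = r \<odot>\<^bsub>specht_module \<mu>\<^esub> \<Theta> x"
  unfolding \<Theta>_def
  by (simp add: specht_module_def sum_list_\<mu>, rule bilinear_ext_assoc)
     (auto simp: permutes_compose perm_tabloid_in perm_tabloid_comp)

lemma \<Theta>_row: "\<Theta> (x \<star> rs \<mu>) = of_nat (card (stab (row_of \<mu>))) *\<^sub>F \<Theta> x"
proof -
  have "\<Theta> (rs \<mu>) = (\<Sum>p\<in>stab (row_of \<mu>). delta T\<^sub>0)"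
    unfolding rs_def row_sum_def \<Theta>_linear
  proof (intro sum.cong refl)
    fix p assume p: "p \<in> stab (row_of \<mu>)"
    show "\<Theta> (delta p) = delta T\<^sub>0"
      using perm_T\<^sub>0_eq_iff[OF stab_permutes[OF p]] p by (simp add: \<Theta>_delta stab_permutes)
  qed
  also have "\<dots> = of_nat (card (stab (row_of \<mu>))) *\<^sub>F delta T\<^sub>0"
    by (simp add: fun_eq_iff)
  finally have "\<Theta> (rs \<mu>) = of_nat (card (stab (row_of \<mu>))) *\<^sub>F delta T\<^sub>0" .
  moreover have "r \<odot>\<^bsub>specht_module \<mu>\<^esub> f = bilinear_ext (carrier (sym_group k)) (tabloids \<mu>) perm_tabloid r f" for r f
    by (simp add: specht_module_def sum_list_\<mu>)
  ultimately show ?thesis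
    unfolding \<Theta>_conv by (simp add: bilinear_ext_scale) (simp add: \<Theta>_def)
qed

text \<open>Two group elements give the same tabloid exactly when they lie in the same left coset of
  the row group, so the coefficient at \<open>perm_tabloid g T\<^sub>0\<close> sums \<open>x\<close>
  over the coset of \<open>g\<close>, as does right multiplication by the row sum.\<close>

lemma \<Theta>_inverse:
  assumes x: "x \<in> alg" and g: "g permutes {1..k}"
  shows "\<Theta> x (perm_tabloid g T\<^sub>0) = (x \<star> rs \<mu>) g"
proof -
  have "\<Theta> x = (\<Sum>p\<in>carrier (sym_group k). x p *\<^sub>F \<Theta> (delta p))"
    using arg_cong[OF functions_on_expand[OF finite_carrier x], of \<Theta>] by (simp add: \<Theta>_linear)
  moreover have "x \<star> rs \<mu> = (\<Sum>p\<in>carrier (sym_group k). x p *\<^sub>F (delta p \<star> rs \<mu>))"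
    by (rule conv_expand(1)[OF x])
  moreover have "\<Theta> (delta p) (perm_tabloid g T\<^sub>0) = (delta p \<star> rs \<mu>) g"
    if p: "p permutes {1..k}" for p
  proof -
    have "(delta p \<star> rs \<mu>) g = (\<Sum>q\<in>stab (row_of \<mu>). if q = inv' p \<circ> g then 1 else 0)"
    proof -
      have "g = p \<circ> q \<longleftrightarrow> q = inv' p \<circ> g" for q
        using permutes_inv_o[OF p] by (metis comp_assoc id_comp)
      then show ?thesis
        unfolding rs_def row_sum_def bilinear_ext_sum sum_fun_apply
        by (intro sum.cong refl) (simp add: conv_delta stab_permutes p delta_apply)
    qed
    then show ?thesis
      using perm_T\<^sub>0_eq_iff2[OF p g] by (simp add: \<Theta>_delta[OF p] delta_apply eq_commute)
  qed
  ultimately show ?thesis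
    by (simp only: sum_fun_apply scale_fun_apply) (rule sum.cong[OF refl], simp)
qed

text \<open>The column group of the translated tableau is the conjugate by \<open>g\<close> of the
  original one, with unchanged signs, and \<open>g \<circ> q \<circ> inv' g\<close> applied to the
  translated tabloid is \<open>g \<circ> q\<close> applied to \<open>T\<^sub>0\<close>.\<close>

lemma polytabloid_eq:
  assumes g: "g permutes {1..k}" and t: "\<And>c. c \<in> cells \<mu> \<Longrightarrow> t c = g (std_tableau \<mu> c)"
  shows "polytabloid \<mu> t = \<Theta> (delta g \<star> cs \<mu>)"
proof
  fix T
  have conj: "g \<circ> q \<circ> inv' g permutes {1..k}" if "q permutes {1..k}" for q
    by (intro permutes_compose permutes_inv g that)
  have col: "{t (i, j) |i. (i, j) \<in> cells \<mu>} = g ` {x \<in> {1..k}. col_of \<mu> x = j}" for j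
    by (rule column_eq) (rule t)
  have stabilizer: "p \<in> column_stabilizer \<mu> t \<longleftrightarrow> p permutes {1..k} \<and>
      (\<forall>j. p ` (g ` {x \<in> {1..k}. col_of \<mu> x = j}) = g ` {x \<in> {1..k}. col_of \<mu> x = j})" for p
    by (simp only: column_stabilizer_def mem_Collect_eq sum_list_\<mu> col[symmetric])
  have mem: "g \<circ> q \<circ> inv' g \<in> column_stabilizer \<mu> t \<longleftrightarrow> q \<in> stab (col_of \<mu>)"
    if q: "q permutes {1..k}" for q
  proof -
    have "(g \<circ> q \<circ> inv' g) ` (g ` A) = g ` A \<longleftrightarrow> q ` A = A" for A
    proof -
      have "(g \<circ> q \<circ> inv' g) ` (g ` A) = g ` (q ` A)"
        by (simp add: image_comp comp_def permutes_inverses(2)[OF g])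
      then show ?thesis using inj_image_eq_iff[OF permutes_inj[OF g]] by simp
    qed
    then show ?thesis
      unfolding stabilizer stab_iff_image[OF q] using conj[OF q] by (simp only: simp_thms)
  qed
  have bij: "bij_betw (\<lambda>q. g \<circ> q \<circ> inv' g) (stab (col_of \<mu>)) (column_stabilizer \<mu> t)"
  proof (rule bij_betw_byWitness[where f' = "\<lambda>p. inv' g \<circ> p \<circ> g"])
    have *: "inv' g \<circ> (g \<circ> q \<circ> inv' g) \<circ> g = q" "g \<circ> (inv' g \<circ> q \<circ> g) \<circ> inv' g = q" for q
      using permutes_inv_o[OF g] by (metis comp_assoc comp_id id_comp)+
    then show "\<forall>q\<in>stab (col_of \<mu>). inv' g \<circ> (g \<circ> q \<circ> inv' g) \<circ> g = q"
      "\<forall>q\<in>column_stabilizer \<mu> t. g \<circ> (inv' g \<circ> q \<circ> g) \<circ> inv' g = q" by blast+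
    show "(\<lambda>q. g \<circ> q \<circ> inv' g) ` stab (col_of \<mu>) \<subseteq> column_stabilizer \<mu> t"
      using mem stab_permutes by blast
    show "(\<lambda>p. inv' g \<circ> p \<circ> g) ` column_stabilizer \<mu> t \<subseteq> stab (col_of \<mu>)"
    proof clarify
      fix p assume p: "p \<in> column_stabilizer \<mu> t"
      then have "p permutes {1..k}" by (simp only: column_stabilizer_def mem_Collect_eq sum_list_\<mu>)
      then have "inv' g \<circ> p \<circ> g permutes {1..k}" by (intro permutes_compose permutes_inv g)
      then show "inv' g \<circ> p \<circ> g \<in> stab (col_of \<mu>)" using mem[of "inv' g \<circ> p \<circ> g"] p *(2) by simp
    qed
  qed
  have sgn: "sign (g \<circ> q \<circ> inv' g) = sign q" if q: "q \<in> stab (col_of \<mu>)" for q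
  proof -
    have "permutation g" using g permutation_permutes finite_atLeastAtMost by blast
    then have "sign (inv' g) = sign g" by (rule sign_inverse)
    then show ?thesis
      using sign_mult[OF permutes_compose[OF stab_permutes[OF q] g] permutes_inv[OF g]]
        sign_mult[OF g stab_permutes[OF q]] by (simp add: sign_def)
  qed
  have tabloid: "tabloid_of \<mu> t = perm_tabloid g T\<^sub>0"
    by (rule tabloid_of_perm) (rule t)
  have tab: "perm_tabloid (g \<circ> q \<circ> inv' g) (tabloid_of \<mu> t) = perm_tabloid (g \<circ> q) T\<^sub>0" for q
    unfolding tabloid perm_tabloid_comp[symmetric]
    by (simp add: comp_assoc permutes_inv_o[OF g])
  have "polytabloid \<mu> t T =
      (\<Sum>q\<in>stab (col_of \<mu>). if perm_tabloid (g \<circ> q) T\<^sub>0 = T then of_int (sign q) else 0)"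
    unfolding polytabloid_def sum.reindex_bij_betw[OF bij, symmetric]
    by (intro sum.cong refl) (simp add: tab sgn)
  also have "\<dots> = (\<Sum>q\<in>stab (col_of \<mu>). of_int (sign q) * \<Theta> (delta g \<star> delta q) T)"
  proof (intro sum.cong refl)
    fix q assume q: "q \<in> stab (col_of \<mu>)"
    have "\<Theta> (delta g \<star> delta q) = delta (perm_tabloid (g \<circ> q) T\<^sub>0)"
      using g stab_permutes[OF q] by (simp add: conv_delta \<Theta>_delta permutes_compose)
    then show "(if perm_tabloid (g \<circ> q) T\<^sub>0 = T then of_int (sign q) else 0) =
        of_int (sign q) * \<Theta> (delta g \<star> delta q) T"
      by (auto simp: delta_apply)
  qed
  also have "\<dots> = \<Theta> (delta g \<star> cs \<mu>) T"
    by (simp add: cs_def col_sum_def bilinear_ext_sum bilinear_ext_scale \<Theta>_linear)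
  finally show "polytabloid \<mu> t T = \<Theta> (delta g \<star> cs \<mu>) T" .
qed

lemma polytabloids_eq: "polytabloids \<mu> = (\<lambda>g. \<Theta> (delta g \<star> cs \<mu>)) ` carrier (sym_group k)"
proof (intro subset_antisym subsetI)
  fix e assume "e \<in> polytabloids \<mu>"
  then obtain t where t: "tableau \<mu> t" "e = polytabloid \<mu> t" by (auto simp: polytabloids_def)
  obtain g where g: "g permutes {1..k}" "\<And>c. c \<in> cells \<mu> \<Longrightarrow> t c = g (std_tableau \<mu> c)"
    using tableau_perm[OF t(1)] by metis
  then show "e \<in> (\<lambda>g. \<Theta> (delta g \<star> cs \<mu>)) ` carrier (sym_group k)"
    using polytabloid_eq[OF g] t(2) by simp
next
  fix e assume "e \<in> (\<lambda>g. \<Theta> (delta g \<star> cs \<mu>)) ` carrier (sym_group k)"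
  then obtain g where g: "g permutes {1..k}" "e = \<Theta> (delta g \<star> cs \<mu>)" by auto
  then have "e = polytabloid \<mu> (g \<circ> std_tableau \<mu>)"
    by (simp add: polytabloid_eq)
  then show "e \<in> polytabloids \<mu>"
    unfolding polytabloids_def using tableau_comp[OF tableau_std g(1)] by blast
qed

text \<open>Polytabloids form a set, so distinct permutations may give the same one. In one
  direction a permutation is chosen for each polytabloid, in the other the coefficients over each
  fibre are added up.\<close>

lemma carrier_specht: "carrier (specht_module \<mu>) = {\<Theta> (x \<star> cs \<mu>) | x. x \<in> alg}"
proof -
  let ?G = "carrier (sym_group k)" and ?e = "\<lambda>g. \<Theta> (delta g \<star> cs \<mu>)"
  have car: "carrier (specht_module \<mu>) = {(\<Sum>e\<in>?e ` ?G. c e *\<^sub>F e) | c. True}"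
  proof -
    have "(\<lambda>T. \<Sum>e\<in>?e ` ?G. c e * e T) = (\<Sum>e\<in>?e ` ?G. c e *\<^sub>F e)" for c
      by (rule ext) simp
    then show ?thesis by (simp add: specht_module_def polytabloids_eq)
  qed
  show ?thesis
  proof (intro subset_antisym subsetI)
    fix f assume "f \<in> carrier (specht_module \<mu>)"
    then obtain c where f: "f = (\<Sum>e\<in>?e ` ?G. c e *\<^sub>F e)" by (auto simp: car)
    let ?g = "inv_into ?G ?e"
    have "f = (\<Sum>e\<in>?e ` ?G. c e *\<^sub>F ?e (?g e))"
      unfolding f
    proof (intro sum.cong refl)
      fix e assume "e \<in> ?e ` ?G"
      then have "?e (?g e) = e" by (rule f_inv_into_f)
      then show "c e *\<^sub>F e = c e *\<^sub>F ?e (?g e)" by (simp only:)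
    qed
    also have "\<dots> = \<Theta> ((\<Sum>e\<in>?e ` ?G. c e *\<^sub>F delta (?g e)) \<star> cs \<mu>)"
      by (simp only: bilinear_ext_sum bilinear_ext_scale \<Theta>_linear)
    finally have f': "f = \<Theta> ((\<Sum>e\<in>?e ` ?G. c e *\<^sub>F delta (?g e)) \<star> cs \<mu>)" .
    have "(\<Sum>e\<in>?e ` ?G. c e *\<^sub>F delta (?g e)) \<in> alg"
      by (intro functions_on_sum functions_on_closed inv_into_into)
    then show "f \<in> {\<Theta> (x \<star> cs \<mu>) | x. x \<in> alg}" using f' by blast
  next
    fix f assume "f \<in> {\<Theta> (x \<star> cs \<mu>) | x. x \<in> alg}"
    then obtain x where x: "x \<in> alg" "f = \<Theta> (x \<star> cs \<mu>)" by blast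
    have "f = (\<Sum>g\<in>?G. x g *\<^sub>F ?e g)"
      unfolding x(2) conv_expand(1)[OF x(1)] by (simp only: \<Theta>_linear)
    also have "\<dots> = (\<Sum>e\<in>?e ` ?G. \<Sum>g\<in>{g. g \<in> ?G \<and> ?e g = e}. x g *\<^sub>F ?e g)"
      by (rule sum.image_gen) (rule finite_carrier)
    also have "\<dots> = (\<Sum>e\<in>?e ` ?G. (\<Sum>g\<in>{g. g \<in> ?G \<and> ?e g = e}. x g) *\<^sub>F e)"
      unfolding fun_vs.scale_sum_left
      by (intro sum.cong refl, elim CollectE conjE, simp only:)
    finally show "f \<in> carrier (specht_module \<mu>)"
      unfolding car by (intro CollectI exI[of _ "\<lambda>e. \<Sum>g\<in>{g. g \<in> ?G \<and> ?e g = e}. x g"] conjI TrueI)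
  qed
qed

text \<open>Elements of the left ideal end in a row sum, so a further row sum only scales them, and
  the coefficient formula for \<open>\<Theta>\<close> recovers them. For the image, appending or
  removing a row sum only scales values of \<open>\<Theta>\<close>, which exchanges
  \<open>cs \<mu>\<close> for \<open>cs \<mu> \<star> rs \<mu>\<close> and hence for the
  idempotent.\<close>

theorem \<Theta>_bij: "bij_betw \<Theta> {y \<in> alg. y \<star> young_idem \<mu> = y} (carrier (specht_module \<mu>))"
proof -
  let ?I = "{y \<in> alg. y \<star> young_idem \<mu> = y}" and ?n = "of_nat (card (stab (row_of \<mu>))) :: complex"
  have row: "y \<star> rs \<mu> = ?n *\<^sub>F y" if y: "y \<in> ?I" for y
  proof -
    have "young_idem \<mu> \<star> rs \<mu> = inverse (young_factor \<mu>) *\<^sub>F (rs \<mu> \<star> cs \<mu> \<star> (rs \<mu> \<star> rs \<mu>))"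
      by (simp add: young_idem_def young_def bilinear_ext_scale conv_assoc)
    also have "\<dots> = ?n *\<^sub>F young_idem \<mu>"
      unfolding rs_def row_sum_square
      by (simp add: young_idem_def young_def bilinear_ext_scale rs_def mult.commute)
    finally have "y \<star> young_idem \<mu> \<star> rs \<mu> = ?n *\<^sub>F (y \<star> young_idem \<mu>)"
      by (simp add: conv_assoc bilinear_ext_scale)
    then show ?thesis using y by simp
  qed
  have inj: "inj_on \<Theta> ?I"
  proof (rule inj_onI)
    fix x y assume x: "x \<in> ?I" and y: "y \<in> ?I" and eq: "\<Theta> x = \<Theta> y"
    have "(x \<star> rs \<mu>) = (y \<star> rs \<mu>)"
      using \<Theta>_inverse[of x] \<Theta>_inverse[of y] x y eq
      by (intro functions_on_eqI[of _ "carrier (sym_group k)"]) auto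
    then show "x = y" using row[OF x] row[OF y] by simp
  qed
  have "\<Theta> ` ?I = carrier (specht_module \<mu>)"
  proof (intro subset_antisym subsetI)
    fix f assume "f \<in> \<Theta> ` ?I"
    then obtain y where y: "y \<in> alg" "y \<star> young_idem \<mu> = y" "f = \<Theta> y" by blast
    obtain u where u: "u \<in> alg" "young_idem \<mu> = u \<star> (cs \<mu> \<star> rs \<mu>)"
      using young_idem_generates(1)[OF \<mu>] by blast
    have "y = y \<star> (u \<star> (cs \<mu> \<star> rs \<mu>))" using y(2) u(2) by simp
    then have "f = \<Theta> ((y \<star> u \<star> cs \<mu>) \<star> rs \<mu>)" unfolding y(3) by (simp add: conv_assoc)
    also have "\<dots> = \<Theta> ((?n *\<^sub>F (y \<star> u)) \<star> cs \<mu>)"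
      unfolding \<Theta>_row by (simp add: \<Theta>_linear bilinear_ext_scale)
    finally show "f \<in> carrier (specht_module \<mu>)"
      unfolding carrier_specht by (intro CollectI exI conjI) (assumption, simp)
  next
    fix f assume "f \<in> carrier (specht_module \<mu>)"
    then obtain x where x: "x \<in> alg" "f = \<Theta> (x \<star> cs \<mu>)" unfolding carrier_specht by blast
    obtain v where v: "v \<in> alg" "cs \<mu> \<star> rs \<mu> = v \<star> young_idem \<mu>"
      using young_idem_generates(2)[OF \<mu>] by blast
    let ?y = "inverse ?n *\<^sub>F (x \<star> cs \<mu> \<star> rs \<mu>)"
    have "?y \<star> young_idem \<mu> = ?y"
    proof -
      have "x \<star> cs \<mu> \<star> rs \<mu> = x \<star> v \<star> young_idem \<mu>" by (simp add: conv_assoc v(2))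
      then show ?thesis by (simp add: bilinear_ext_scale conv_assoc young_idem(1)[OF \<mu>])
    qed
    moreover have "f = \<Theta> ?y"
      unfolding \<Theta>_linear \<Theta>_row x(2) by simp
    ultimately show "f \<in> \<Theta> ` ?I" by (intro image_eqI[of _ _ ?y]) auto
  qed
  then show ?thesis using inj by (simp add: bij_betw_def)
qed

end

section \<open>The algebra of the monoid of partial functions\<close>

lemma sum_Pow_insert:
  fixes h :: "'x set \<Rightarrow> 'z :: comm_monoid_add"
  assumes "finite A" "x \<notin> A"
  shows "(\<Sum>D\<in>Pow (insert x A). h D) = (\<Sum>D\<in>Pow A. h D) + (\<Sum>D\<in>Pow A. h (insert x D))"
proof -
  have "inj_on (insert x) (Pow A)"
    using assms(2) by (intro inj_onI) (metis Diff_insert_absorb PowD subsetD)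
  then show ?thesis
    using assms unfolding Pow_insert by (subst sum.union_disjoint) (auto simp: sum.reindex)
qed

lemma card_Diff_insert_Suc:
  assumes "finite C" "x \<in> C" "x \<notin> D"
  shows "card (C - D) = Suc (card (C - insert x D))"
proof -
  have "C - insert x D = C - D - {x}" by blast
  then show ?thesis using card_Suc_Diff1[of "C - D" x] assms by simp
qed

text \<open>The summands for \<open>D\<close> and \<open>insert x D\<close> cancel in pairs.\<close>

lemma alternating_sum_eq_0:
  fixes h :: "'x set \<Rightarrow> 'z \<Rightarrow> complex"
  assumes C: "finite C" and x: "x \<in> C" and h: "\<And>D. h (insert x D) = h D"
  shows "(\<Sum>D\<in>Pow C. (-1) ^ card (C - D) *\<^sub>F h D) = 0"
proof -
  let ?A = "C - {x}"
  have C': "C = insert x ?A" using x by blast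
  have fin: "finite ?A" using C by simp
  have sg: "(-1 :: complex) ^ card (C - D) = - ((-1) ^ card (C - insert x D))" if "D \<in> Pow ?A" for D
    by (subst card_Diff_insert_Suc[OF C x]) (use that in auto)
  have "(\<Sum>D\<in>Pow C. (-1) ^ card (C - D) *\<^sub>F h D) =
      (\<Sum>D\<in>Pow ?A. (-1) ^ card (C - D) *\<^sub>F h D) + (\<Sum>D\<in>Pow ?A. (-1) ^ card (C - insert x D) *\<^sub>F h (insert x D))"
    by (subst (1) C') (rule sum_Pow_insert[OF fin], simp)
  also have "(\<Sum>D\<in>Pow ?A. (-1) ^ card (C - insert x D) *\<^sub>F h (insert x D)) =
      (\<Sum>D\<in>Pow ?A. - ((-1) ^ card (C - D) *\<^sub>F h D))"
    by (intro sum.cong refl) (simp add: sg h)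
  finally show ?thesis by (simp only: sum_negf add.right_inverse)
qed

text \<open>Moebius inversion on the subset lattice. A point of \<open>C\<close> outside
  \<open>Y\<close> pairs off the summands; if \<open>Y\<close> is not a proper subset of
  \<open>C\<close>, only \<open>D = C\<close> can contribute.\<close>

lemma alternating_sum:
  fixes v :: "'z \<Rightarrow> complex"
  assumes C: "finite C"
  shows "(\<Sum>D\<in>Pow C. (-1) ^ card (C - D) *\<^sub>F (if Y \<subseteq> D then v else 0)) = (if Y = C then v else 0)"
proof (cases "Y \<subset> C")
  case True
  then obtain x where x: "x \<in> C" "x \<notin> Y" by blast
  have "Y \<subseteq> insert x D \<longleftrightarrow> Y \<subseteq> D" for D using x by blast
  then have "(\<Sum>D\<in>Pow C. (-1) ^ card (C - D) *\<^sub>F (if Y \<subseteq> D then v else 0)) = 0"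
    by (intro alternating_sum_eq_0[OF C x(1)]) (simp only:)
  moreover have "Y \<noteq> C" using True by blast
  ultimately show ?thesis by (simp only: if_False)
next
  case False
  have "(\<Sum>D\<in>Pow C. (-1) ^ card (C - D) *\<^sub>F (if Y \<subseteq> D then v else 0)) =
      (\<Sum>D\<in>Pow C. if D = C then if Y = C then v else 0 else 0)"
    using False by (intro sum.cong refl) auto
  then show ?thesis using C by simp
qed

section \<open>Moebius idempotents in the algebra of partial functions\<close>

locale partial_functions =
  fixes n :: nat
begin

lemma carrier_PT [simp]: "x \<in> carrier (PT n) \<longleftrightarrow> dom x \<subseteq> {1..n} \<and> ran x \<subseteq> {1..n}"
  by (simp add: PT_def)

lemma mult_PT [simp]: "x \<otimes>\<^bsub>PT n\<^esub> y = x \<circ>\<^sub>m y"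
  by (simp add: PT_def)

lemma one_PT: "\<one>\<^bsub>PT n\<^esub> = partial_identity {1..n}"
  by (simp add: PT_def)

declare One_nat_def [simp del]

lemma map_comp_in: "x \<in> carrier (PT n) \<Longrightarrow> y \<in> carrier (PT n) \<Longrightarrow> x \<circ>\<^sub>m y \<in> carrier (PT n)"
  by (fastforce simp: map_comp_def dom_def ran_def subset_iff split: option.splits)

lemma comp_partial_identity: "x \<circ>\<^sub>m partial_identity A = x |` A"
  by (auto simp: partial_identity_def map_comp_def restrict_map_def fun_eq_iff)

lemma restrict_map_eq_iff: "x |` A = x \<longleftrightarrow> dom x \<subseteq> A"
proof
  assume "x |` A = x"
  then have "dom (x |` A) = dom x" by simp
  then show "dom x \<subseteq> A" by auto
next
  assume A: "dom x \<subseteq> A"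
  show "x |` A = x"
  proof
    fix y show "(x |` A) y = x y"
      using A by (metis domIff restrict_in restrict_out subsetD)
  qed
qed

lemma partial_identity_comp:
  "partial_identity A \<circ>\<^sub>m x = (\<lambda>y. case x y of None \<Rightarrow> None | Some z \<Rightarrow> if z \<in> A then Some z else None)"
  by (auto simp: partial_identity_def map_comp_def restrict_map_def fun_eq_iff split: option.splits)

lemma dom_partial_identity [simp]: "dom (partial_identity A) = A"
  and ran_partial_identity [simp]: "ran (partial_identity A) = A"
  by (auto simp: partial_identity_def dom_def ran_def restrict_map_def split: if_splits)

sublocale finite_monoid "PT n"
proof
  show "x \<otimes>\<^bsub>PT n\<^esub> y \<in> carrier (PT n)" if "x \<in> carrier (PT n)" "y \<in> carrier (PT n)" for x y
    using map_comp_in[OF that] by (simp only: mult_PT)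
  show "x \<otimes>\<^bsub>PT n\<^esub> y \<otimes>\<^bsub>PT n\<^esub> z = x \<otimes>\<^bsub>PT n\<^esub> (y \<otimes>\<^bsub>PT n\<^esub> z)" for x y z
    by (auto simp: map_comp_def fun_eq_iff split: option.splits)
  show "\<one>\<^bsub>PT n\<^esub> \<in> carrier (PT n)" by (simp add: one_PT)
  show "\<one>\<^bsub>PT n\<^esub> \<otimes>\<^bsub>PT n\<^esub> x = x" if "x \<in> carrier (PT n)" for x
    using that by (auto simp: one_PT partial_identity_comp fun_eq_iff ran_def split: option.splits)
  show "x \<otimes>\<^bsub>PT n\<^esub> \<one>\<^bsub>PT n\<^esub> = x" if "x \<in> carrier (PT n)" for x
    using that by (simp add: one_PT comp_partial_identity restrict_map_eq_iff)
  have "finite (\<Union>A\<in>Pow {1..n}. {x :: nat \<rightharpoonup> nat. dom x = A \<and> ran x \<subseteq> {1..n}})"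
  proof (rule finite_UN_I)
    fix A assume "A \<in> Pow {1..n}"
    then have "finite A" using finite_subset by blast
    then show "finite {x :: nat \<rightharpoonup> nat. dom x = A \<and> ran x \<subseteq> {1..n}}"
      by (rule finite_set_of_finite_maps) simp
  qed simp
  moreover have "carrier (PT n) \<subseteq> (\<Union>A\<in>Pow {1..n}. {x. dom x = A \<and> ran x \<subseteq> {1..n}})"
    unfolding PT_def by force
  ultimately show "finite (carrier (PT n))" by (rule finite_subset[rotated])
qed

notation conv (infixl \<open>\<bullet>\<close> 70)

text \<open>The element \<open>f\<^sub>B\<close> of the overview: Moebius inversion of the partial
  identities.\<close>

definition mob :: "nat set \<Rightarrow> (nat \<rightharpoonup> nat) \<Rightarrow> complex"
  where "mob B = (\<Sum>D\<in>Pow B. (-1) ^ card (B - D) *\<^sub>F delta (partial_identity D))"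

lemma mob_in [simp, intro]: "B \<subseteq> {1..n} \<Longrightarrow> mob B \<in> alg"
  unfolding mob_def by (intro functions_on_sum functions_on_closed) auto

lemma delta_mob_sum:
  assumes "s \<in> carrier (PT n)" "B \<subseteq> {1..n}"
  shows "delta s \<bullet> mob B = (\<Sum>D\<in>Pow B. (-1) ^ card (B - D) *\<^sub>F delta (s |` D))"
  unfolding mob_def bilinear_ext_sum bilinear_ext_scale
proof (intro sum.cong refl)
  fix D assume "D \<in> Pow B"
  then have "partial_identity D \<in> carrier (PT n)" using assms(2) by auto
  then show "(-1) ^ card (B - D) *\<^sub>F (delta s \<bullet> delta (partial_identity D)) =
      (-1) ^ card (B - D) *\<^sub>F delta (s |` D)"
    using assms(1) by (simp only: conv_delta mult_PT comp_partial_identity)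
qed

text \<open>At a point of \<open>B\<close> where \<open>s\<close> is undefined, adding the point to
  \<open>D\<close> does not change the restriction of \<open>s\<close> to \<open>D\<close>, so the
  alternating sum cancels.\<close>

lemma delta_mob_eq_0:
  assumes s: "s \<in> carrier (PT n)" and B: "B \<subseteq> {1..n}" and n: "\<not> B \<subseteq> dom s"
  shows "delta s \<bullet> mob B = 0"
proof -
  obtain x where x: "x \<in> B" "s x = None" using n by blast
  have fin: "finite B" using B finite_subset by blast
  have "s |` insert x D = s |` D" for D
    using x(2) by (auto simp: restrict_map_def fun_eq_iff)
  then show ?thesis
    unfolding delta_mob_sum[OF s B] by (intro alternating_sum_eq_0[OF fin x(1)]) (simp only:)
qed

lemma delta_identity_mob:
  assumes B: "B \<subseteq> {1..n}"
  shows "delta (partial_identity B) \<bullet> mob B = mob B"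
proof -
  have restr: "partial_identity B |` D = partial_identity D" if "D \<subseteq> B" for D
    using that by (auto simp: partial_identity_def restrict_map_def fun_eq_iff)
  have p: "partial_identity B \<in> carrier (PT n)" using B by simp
  show ?thesis
    unfolding delta_mob_sum[OF p B] by (subst mob_def) (intro sum.cong refl, simp add: restr)
qed

lemma restrict_carrier: "s \<in> carrier (PT n) \<Longrightarrow> s |` B \<in> carrier (PT n)"
  by (auto simp: ran_def restrict_map_def split: if_splits)

lemma delta_restrict_mob:
  assumes s: "s \<in> carrier (PT n)" and B: "B \<subseteq> {1..n}"
  shows "delta (s |` B) \<bullet> mob B = delta s \<bullet> mob B"
proof -
  have "partial_identity B \<in> carrier (PT n)" using B by simp
  then have "delta (s |` B) = delta s \<bullet> delta (partial_identity B)"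
    using s by (simp only: conv_delta mult_PT comp_partial_identity)
  then show ?thesis by (simp only: conv_assoc delta_identity_mob[OF B])
qed

text \<open>The identity behind the isomorphism of the monoid algebra with the algebra of the category
  of surjections between subsets.\<close>

lemma mob_delta_mob:
  assumes s: "s \<in> carrier (PT n)" and B: "B \<subseteq> {1..n}" and C: "C \<subseteq> {1..n}"
  shows "mob C \<bullet> delta s \<bullet> mob B = (if B \<subseteq> dom s \<and> ran (s |` B) = C then delta s \<bullet> mob B else 0)"
proof (cases "B \<subseteq> dom s")
  case False
  then show ?thesis by (simp add: conv_assoc delta_mob_eq_0[OF s B])
next
  case True
  have summand: "delta (partial_identity D) \<bullet> delta s \<bullet> mob B =
      (if ran (s |` B) \<subseteq> D then delta s \<bullet> mob B else 0)" if D: "D \<in> Pow C" for D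
  proof -
    have pD: "partial_identity D \<in> carrier (PT n)" using D C by auto
    have Ds: "partial_identity D \<circ>\<^sub>m s \<in> carrier (PT n)" by (rule map_comp_in[OF pD s])
    have eq: "delta (partial_identity D) \<bullet> delta s = delta (partial_identity D \<circ>\<^sub>m s)"
      using pD s by (simp only: conv_delta mult_PT)
    show ?thesis
    proof (cases "ran (s |` B) \<subseteq> D")
      case True
      have "z \<in> D" if "y \<in> B" "s y = Some z" for y z
      proof -
        have "(s |` B) y = Some z" using that by simp
        then show ?thesis using True ranI by fast
      qed
      then have "(partial_identity D \<circ>\<^sub>m s) |` B = s |` B"
        by (auto simp: partial_identity_comp restrict_map_def fun_eq_iff split: option.splits)
      then show ?thesis
        unfolding eq using delta_restrict_mob[OF Ds B] delta_restrict_mob[OF s B] True by simp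
    next
      case out: False
      then have "\<not> B \<subseteq> dom (partial_identity D \<circ>\<^sub>m s)"
        by (auto simp: partial_identity_comp restrict_map_def ran_def dom_def subset_iff
              split: option.splits if_splits)
      then show ?thesis unfolding eq using delta_mob_eq_0[OF Ds B] out by simp
    qed
  qed
  have "mob C \<bullet> delta s \<bullet> mob B =
      (\<Sum>D\<in>Pow C. (-1) ^ card (C - D) *\<^sub>F (delta (partial_identity D) \<bullet> delta s \<bullet> mob B))"
    unfolding mob_def[of C] bilinear_ext_sum bilinear_ext_scale ..
  also have "\<dots> = (\<Sum>D\<in>Pow C. (-1) ^ card (C - D) *\<^sub>F (if ran (s |` B) \<subseteq> D then delta s \<bullet> mob B else 0))"
    by (intro sum.cong refl) (simp only: summand)
  also have "\<dots> = (if ran (s |` B) = C then delta s \<bullet> mob B else 0)"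
    using C finite_subset by (intro alternating_sum) blast
  finally show ?thesis using True by simp
qed

lemma mob_idem:
  assumes B: "B \<subseteq> {1..n}"
  shows "mob B \<bullet> mob B = mob B"
proof -
  have p: "partial_identity B \<in> carrier (PT n)" using B by simp
  have "partial_identity B |` B = partial_identity B"
    by (auto simp: partial_identity_def restrict_map_def fun_eq_iff)
  then show ?thesis
    using mob_delta_mob[OF p B B] delta_identity_mob[OF B] by (simp add: conv_assoc)
qed

text \<open>After exchanging the sums, the coefficient of the partial identity on \<open>D\<close>
  is an alternating sum over the sets between \<open>D\<close> and \<open>{1..n}\<close>, which
  vanishes unless \<open>D\<close> is everything.\<close>

lemma sum_mob: "(\<Sum>B\<in>Pow {1..n}. mob B) = delta \<one>\<^bsub>PT n\<^esub>"
proof -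
  let ?N = "{1..n}" and ?d = "\<lambda>D. delta (partial_identity D) :: (nat \<rightharpoonup> nat) \<Rightarrow> complex"
  have "(\<Sum>B\<in>Pow ?N. mob B) = (\<Sum>B\<in>Pow ?N. \<Sum>D\<in>Pow ?N. if D \<subseteq> B then (-1) ^ card (B - D) *\<^sub>F ?d D else 0)"
  proof (intro sum.cong refl)
    fix B assume B: "B \<in> Pow ?N"
    then have sub: "Pow B = {D \<in> Pow ?N. D \<subseteq> B}" by blast
    show "mob B = (\<Sum>D\<in>Pow ?N. if D \<subseteq> B then (-1) ^ card (B - D) *\<^sub>F ?d D else 0)"
      unfolding mob_def sub by (rule sum.inter_filter) simp
  qed
  also have "\<dots> = (\<Sum>D\<in>Pow ?N. \<Sum>B\<in>Pow ?N. if D \<subseteq> B then (-1) ^ card (B - D) *\<^sub>F ?d D else 0)"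
    by (rule sum.swap)
  also have "\<dots> = (\<Sum>D\<in>Pow ?N. if D = ?N then ?d D else 0)"
  proof (intro sum.cong refl)
    fix D assume D: "D \<in> Pow ?N"
    have "(\<Sum>B\<in>Pow ?N. if D \<subseteq> B then (-1) ^ card (B - D) *\<^sub>F ?d D else 0) =
        (\<Sum>B\<in>Pow ?N. (-1) ^ card (?N - B) *\<^sub>F (if D \<subseteq> B then (-1) ^ card (?N - D) *\<^sub>F ?d D else 0))"
    proof (intro sum.cong refl)
      fix B assume B: "B \<in> Pow ?N"
      \<comment> \<open>The sign is rewritten relative to the top set, since
        \<open>alternating_sum\<close> measures it by the complement in the ambient set.\<close>
      have "(-1 :: complex) ^ card (B - D) = (-1) ^ card (?N - B) * (-1) ^ card (?N - D)" if DB: "D \<subseteq> B"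
      proof -
        have "?N - D = (B - D) \<union> (?N - B)" using DB B by blast
        moreover have "finite B" using B finite_subset by blast
        ultimately have "card (?N - D) = card (B - D) + card (?N - B)"
          by (simp only:) (rule card_Un_disjoint, auto)
        then have "(-1 :: complex) ^ card (?N - B) * (-1) ^ card (?N - D) =
            (-1) ^ card (B - D) * ((-1) ^ card (?N - B) * (-1) ^ card (?N - B))"
          by (simp only: power_add mult_ac)
        also have "(-1 :: complex) ^ card (?N - B) * (-1) ^ card (?N - B) = 1"
          by (simp flip: power_mult_distrib)
        finally show ?thesis by simp
      qed
      then show "(if D \<subseteq> B then (-1) ^ card (B - D) *\<^sub>F ?d D else 0) =
          (-1) ^ card (?N - B) *\<^sub>F (if D \<subseteq> B then (-1) ^ card (?N - D) *\<^sub>F ?d D else 0)"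
        by simp
    qed
    also have "\<dots> = (if D = ?N then (-1) ^ card (?N - D) *\<^sub>F ?d D else 0)"
      by (rule alternating_sum) simp
    finally show "(\<Sum>B\<in>Pow ?N. if D \<subseteq> B then (-1) ^ card (B - D) *\<^sub>F ?d D else 0) = (if D = ?N then ?d D else 0)"
      by simp
  qed
  also have "\<dots> = ?d ?N" by simp
  finally show ?thesis by (simp add: one_PT)
qed

text \<open>The defining condition is tested on two partial identities, those on
  \<open>dom x\<close> and on \<open>{1..k}\<close>; each yields one inclusion. The bound on
  \<open>k\<close> places the second in \<open>E n\<close>.\<close>

lemma L_class_eq:
  assumes "k \<le> n"
  shows "L_class n k = {x \<in> carrier (PT n). dom x = {1..k}}"
proof -
  have iff: "x \<circ>\<^sub>m partial_identity A = x \<longleftrightarrow> dom x \<subseteq> A" for x :: "nat \<rightharpoonup> nat" and A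
    by (simp only: comp_partial_identity restrict_map_eq_iff)
  have "L_tilde (PT n) (E n) x (partial_identity {1..k}) \<longleftrightarrow> dom x = {1..k}"
    if x: "x \<in> carrier (PT n)" for x
  proof
    assume L: "L_tilde (PT n) (E n) x (partial_identity {1..k})"
    have "dom x \<subseteq> A \<longleftrightarrow> {1..k} \<subseteq> A" if "A \<subseteq> {1..n}" for A
      using L that iff[of x A] iff[of "partial_identity {1..k}" A]
      unfolding L_tilde_def E_def by simp
    from this[of "dom x"] this[of "{1..k}"] show "dom x = {1..k}" using x assms by auto
  next
    assume "dom x = {1..k}"
    then show "L_tilde (PT n) (E n) x (partial_identity {1..k})"
      unfolding L_tilde_def E_def by (auto simp: iff)
  qed
  then show ?thesis unfolding L_class_def by blast
qed

end

section \<open>The class module and the corner algebra at level k\<close>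

locale pt_level = P: partial_functions n + S: symmetric_group_algebra k for n k :: nat +
  assumes kn: "k \<le> n"
begin

notation P.conv (infixl \<open>\<bullet>\<close> 70)
notation S.conv (infixl \<open>\<star>\<close> 70)

abbreviation "f \<equiv> P.mob {1..k}"
abbreviation "L \<equiv> L_class n k"

definition emb :: "(nat \<Rightarrow> nat) \<Rightarrow> nat \<rightharpoonup> nat"
  where "emb p = (Some \<circ> p) |` {1..k}"

text \<open>\<open>\<psi>\<close> maps the class module isomorphically onto the left ideal of \<open>f\<close>, with inverse \<open>\<chi>\<close>
  (restriction to the class), and \<open>j\<close> is an isomorphism of the group algebra onto \<open>f A f\<close>.\<close>

definition \<psi> :: "((nat \<rightharpoonup> nat) \<Rightarrow> complex) \<Rightarrow> (nat \<rightharpoonup> nat) \<Rightarrow> complex"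
  where "\<psi> x = x \<bullet> f"

definition \<chi> :: "((nat \<rightharpoonup> nat) \<Rightarrow> complex) \<Rightarrow> (nat \<rightharpoonup> nat) \<Rightarrow> complex"
  where "\<chi> x = (\<lambda>y. if y \<in> L then x y else 0)"

definition emb_fun :: "((nat \<Rightarrow> nat) \<Rightarrow> complex) \<Rightarrow> (nat \<rightharpoonup> nat) \<Rightarrow> complex"
  where "emb_fun b = (\<Sum>p\<in>carrier (sym_group k). b p *\<^sub>F delta (emb p))"

definition j :: "((nat \<Rightarrow> nat) \<Rightarrow> complex) \<Rightarrow> (nat \<rightharpoonup> nat) \<Rightarrow> complex"
  where "j b = emb_fun b \<bullet> f"

lemma k_sub: "{1..k} \<subseteq> {1..n}"
  using kn by auto

lemma f_in [simp]: "f \<in> P.alg"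
  using k_sub by simp

lemma L_eq: "L = {x \<in> carrier (PT n). dom x = {1..k}}"
  by (rule P.L_class_eq[OF kn])

lemma L_sub: "x \<in> L \<Longrightarrow> x \<in> carrier (PT n)"
  unfolding L_eq by blast

lemma finite_L [simp]: "finite L"
  by (rule finite_subset[OF _ P.finite_carrier]) (use L_sub in blast)

lemma emb_apply: "emb p x = (if x \<in> {1..k} then Some (p x) else None)"
  by (simp add: emb_def restrict_map_def)

lemma dom_emb [simp]: "dom (emb p) = {1..k}"
  by (auto simp: emb_def)

lemma ran_emb: "p permutes {1..k} \<Longrightarrow> ran (emb p) = {1..k}"
proof -
  assume p: "p permutes {1..k}"
  have "ran (emb p) = p ` {1..k}"
  proof (intro subset_antisym subsetI)
    fix y assume "y \<in> ran (emb p)"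
    then obtain i where i: "emb p i = Some y" unfolding ran_def by blast
    then have "i \<in> {1..k}" unfolding emb_apply by (metis option.distinct(1))
    then show "y \<in> p ` {1..k}" using i unfolding emb_apply by auto
  next
    fix y assume "y \<in> p ` {1..k}"
    then obtain i where "i \<in> {1..k}" "y = p i" by blast
    then show "y \<in> ran (emb p)" using ranI[of "emb p" i y] by (simp only: emb_apply if_True)
  qed
  then show ?thesis using permutes_image[OF p] by simp
qed

lemma emb_in_L: "p permutes {1..k} \<Longrightarrow> emb p \<in> L"
  using k_sub by (simp add: L_eq ran_emb)

lemma emb_in: "p permutes {1..k} \<Longrightarrow> emb p \<in> carrier (PT n)"
  by (rule L_sub[OF emb_in_L])

lemma restrict_emb [simp]: "emb p |` {1..k} = emb p"
  by (simp add: P.restrict_map_eq_iff)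

lemma emb_comp: "q permutes {1..k} \<Longrightarrow> emb p \<circ>\<^sub>m emb q = emb (p \<circ> q)"
  using permutes_in_image[of q "{1..k}"] by (auto simp: map_comp_def emb_apply fun_eq_iff)

lemma emb_id: "emb id = partial_identity {1..k}"
  by (auto simp: emb_def partial_identity_def)

lemma emb_inj: "p permutes {1..k} \<Longrightarrow> q permutes {1..k} \<Longrightarrow> emb p = emb q \<Longrightarrow> p = q"
proof
  fix x assume p: "p permutes {1..k}" and q: "q permutes {1..k}" and eq: "emb p = emb q"
  show "p x = q x"
  proof (cases "x \<in> {1..k}")
    case True
    then show ?thesis using fun_cong[OF eq, of x] by (simp only: emb_apply if_True option.inject)
  next
    case False
    then show ?thesis using p q by (simp add: permutes_not_in)
  qed
qed

lemma emb_surj: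
  assumes x: "x \<in> L" "ran x = {1..k}"
  shows "\<exists>p. p permutes {1..k} \<and> x = emb p"
proof -
  have d: "dom x = {1..k}" using x by (simp add: L_eq)
  define p where "p i = (if i \<in> {1..k} then the (x i) else i)" for i
  have xp: "x i = Some (p i)" if "i \<in> {1..k}" for i
    using that d by (metis domD option.sel p_def)
  have "p ` {1..k} = ran x"
  proof (intro subset_antisym subsetI)
    fix y assume "y \<in> ran x"
    then obtain i where "x i = Some y" by (auto simp: ran_def)
    moreover then have "i \<in> {1..k}" using d by blast
    ultimately show "y \<in> p ` {1..k}" using xp by force
  next
    fix y assume "y \<in> p ` {1..k}"
    then obtain i where "i \<in> {1..k}" "y = p i" by blast
    then show "y \<in> ran x" using xp[of i] ranI[of x i y] by simp
  qed
  then have im: "p ` {1..k} = {1..k}" using x(2) by simp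
  then have "inj_on p {1..k}" by (intro finite_surj_inj) simp_all
  then have "p permutes {1..k}"
    using im by (intro bij_imp_permutes bij_betw_imageI) (simp_all only: p_def if_False)
  moreover have "x = emb p"
  proof
    fix i show "x i = emb p i"
      using xp d by (cases "i \<in> {1..k}") (auto simp: emb_apply domIff)
  qed
  ultimately show ?thesis by blast
qed

lemma \<psi>_linear:
  "\<psi> (x + y) = \<psi> x + \<psi> y" "\<psi> (c *\<^sub>F x) = c *\<^sub>F \<psi> x" "\<psi> (\<Sum>i\<in>I. h i) = (\<Sum>i\<in>I. \<psi> (h i))"
  by (simp_all add: \<psi>_def bilinear_ext_add bilinear_ext_scale bilinear_ext_sum)

lemma \<chi>_linear:
  "\<chi> (x + y) = \<chi> x + \<chi> y" "\<chi> (c *\<^sub>F x) = c *\<^sub>F \<chi> x" "\<chi> (\<Sum>i\<in>I. h i) = (\<Sum>i\<in>I. \<chi> (h i))"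
  by (auto simp: \<chi>_def fun_eq_iff)

lemma \<chi>_in [simp, intro]: "\<chi> x \<in> functions_on L"
  by (simp add: \<chi>_def functions_on_def)

lemma \<psi>_in [simp, intro]: "\<psi> x \<in> P.alg"
  by (simp add: \<psi>_def)

text \<open>The convention that a product leaving the class is zero appears here as a consequence:
  multiplication by \<open>f\<close> on the right kills every \<open>s\<close> undefined somewhere
  on \<open>{1..k}\<close>, and retains only the restriction of the others.\<close>

lemma delta_f:
  assumes "s \<in> carrier (PT n)"
  shows "delta s \<bullet> f = (if s |` {1..k} \<in> L then \<psi> (delta (s |` {1..k})) else 0)"
proof -
  have "s |` {1..k} \<in> L \<longleftrightarrow> {1..k} \<subseteq> dom s"
    using P.restrict_carrier[OF assms, of "{1..k}"] unfolding L_eq by auto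
  then show ?thesis
    using P.delta_mob_eq_0[OF assms k_sub] P.delta_restrict_mob[OF assms k_sub] by (simp add: \<psi>_def)
qed

text \<open>Among the restrictions of \<open>y\<close> in the expansion of
  \<open>\<psi> (delta y)\<close>, only \<open>y\<close> itself has domain \<open>{1..k}\<close>, so
  cutting down to the class removes all correction terms.\<close>

lemma \<chi>_\<psi>_delta:
  assumes y: "y \<in> L"
  shows "\<chi> (\<psi> (delta y)) = delta y"
proof (rule functions_on_eqI[of _ L])
  fix z assume z: "z \<in> L"
  have yd: "dom y = {1..k}" and zd: "dom z = {1..k}" using y z by (simp_all add: L_eq)
  have "\<chi> (\<psi> (delta y)) z = (\<Sum>D\<in>Pow {1..k}. (-1) ^ card ({1..k} - D) * delta (y |` D) z)"
    using z by (simp add: \<chi>_def \<psi>_def P.delta_mob_sum[OF L_sub[OF y] k_sub])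
  also have "\<dots> = (\<Sum>D\<in>Pow {1..k}. if D = {1..k} then delta y z else 0)"
  proof (intro sum.cong refl)
    fix D assume D: "D \<in> Pow {1..k}"
    show "(-1) ^ card ({1..k} - D) * delta (y |` D) z = (if D = {1..k} then delta y z else 0)"
    proof (cases "D = {1..k}")
      case True
      then show ?thesis using yd by (simp add: P.restrict_map_eq_iff[THEN iffD2])
    next
      case False
      have "dom (y |` D) = D" using yd D by auto
      then have "z \<noteq> y |` D" using zd False by metis
      then show ?thesis using False by (simp add: delta_apply)
    qed
  qed
  also have "\<dots> = delta y z" by simp
  finally show "\<chi> (\<psi> (delta y)) z = delta y z" .
qed (use y in auto)

lemma \<chi>_\<psi>:
  assumes x: "x \<in> functions_on L"
  shows "\<chi> (\<psi> x) = x"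
proof -
  have e: "x = (\<Sum>y\<in>L. x y *\<^sub>F delta y)" by (rule functions_on_expand[OF finite_L x])
  have "\<chi> (\<psi> x) = (\<Sum>y\<in>L. x y *\<^sub>F \<chi> (\<psi> (delta y)))"
    by (subst e) (simp only: \<psi>_linear \<chi>_linear)
  also have "\<dots> = (\<Sum>y\<in>L. x y *\<^sub>F delta y)" by (intro sum.cong refl) (simp only: \<chi>_\<psi>_delta)
  finally show ?thesis using e by simp
qed

lemma \<psi>_inj: "x \<in> functions_on L \<Longrightarrow> y \<in> functions_on L \<Longrightarrow> \<psi> x = \<psi> y \<Longrightarrow> x = y"
  using \<chi>_\<psi> by metis

text \<open>Expanding \<open>p = p \<bullet> f\<close> over basis elements, each summand lies in the
  image of \<open>\<psi>\<close>; so \<open>\<psi>\<close> is onto the left ideal, and its left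
  inverse \<open>\<chi>\<close> is a right inverse there.\<close>

lemma \<psi>_\<chi>:
  assumes p: "p \<in> P.alg" "p \<bullet> f = p"
  shows "\<psi> (\<chi> p) = p"
proof -
  let ?G = "carrier (PT n)"
  define u where "u = (\<Sum>s\<in>?G. p s *\<^sub>F (if s |` {1..k} \<in> L then delta (s |` {1..k}) else 0))"
  have u: "u \<in> functions_on L"
    unfolding u_def by (intro functions_on_sum functions_on_closed) auto
  have "p = (\<Sum>s\<in>?G. p s *\<^sub>F (delta s \<bullet> f))"
    using P.conv_expand(1)[OF p(1), of f] p(2) by simp
  also have "\<dots> = \<psi> u"
    unfolding u_def \<psi>_linear
  proof (intro sum.cong refl arg_cong[of _ _ "\<lambda>v. _ *\<^sub>F v"])
    fix s assume "s \<in> ?G"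
    have "\<psi> 0 = 0" by (simp add: \<psi>_def)
    then show "delta s \<bullet> f = \<psi> (if s |` {1..k} \<in> L then delta (s |` {1..k}) else 0)"
      unfolding delta_f[OF \<open>s \<in> ?G\<close>] by (simp only: if_distrib[of \<psi>])
  qed
  finally have "p = \<psi> u" .
  then show ?thesis using \<chi>_\<psi>[OF u] by simp
qed

lemma bilinear_L_delta:
  assumes s: "s \<in> carrier (PT n)" and y: "y \<in> L"
  shows "\<psi> (bilinear_ext (carrier (PT n)) L (\<otimes>\<^bsub>PT n\<^esub>) (delta s) (delta y)) = delta s \<bullet> \<psi> (delta y)"
proof -
  have sy: "s \<circ>\<^sub>m y \<in> carrier (PT n)" by (rule P.map_comp_in[OF s L_sub[OF y]])
  have "dom (s \<circ>\<^sub>m y) \<subseteq> {1..k}"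
    using y by (auto simp: L_eq map_comp_def dom_def split: option.splits)
  then have r: "(s \<circ>\<^sub>m y) |` {1..k} = s \<circ>\<^sub>m y" by (simp only: P.restrict_map_eq_iff)
  have "\<psi> (bilinear_ext (carrier (PT n)) L (\<otimes>\<^bsub>PT n\<^esub>) (delta s) (delta y)) =
      (if s \<circ>\<^sub>m y \<in> L then \<psi> (delta (s \<circ>\<^sub>m y)) else 0)"
    unfolding bilinear_ext_delta[OF P.finite_carrier s finite_L y] P.mult_PT by (simp add: \<psi>_def)
  also have "\<dots> = delta (s \<circ>\<^sub>m y) \<bullet> f" using delta_f[OF sy] r by simp
  also have "\<dots> = delta s \<bullet> \<psi> (delta y)"
    using P.conv_delta[OF s L_sub[OF y]] by (simp add: \<psi>_def P.conv_assoc[symmetric])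
  finally show ?thesis .
qed

lemma smult_L: "a \<odot>\<^bsub>L_module n k\<^esub> x = bilinear_ext (carrier (PT n)) L (\<otimes>\<^bsub>PT n\<^esub>) a x"
  by (simp add: L_module_def)

lemma \<psi>_smult:
  assumes a: "a \<in> P.alg" and x: "x \<in> functions_on L"
  shows "\<psi> (a \<odot>\<^bsub>L_module n k\<^esub> x) = a \<bullet> \<psi> x"
proof -
  let ?G = "carrier (PT n)"
  have ea: "a = (\<Sum>s\<in>?G. a s *\<^sub>F delta s)" by (rule functions_on_expand[OF P.finite_carrier a])
  have ex: "x = (\<Sum>y\<in>L. x y *\<^sub>F delta y)" by (rule functions_on_expand[OF finite_L x])
  have "\<psi> (a \<odot>\<^bsub>L_module n k\<^esub> x) =
      (\<Sum>y\<in>L. x y *\<^sub>F (\<Sum>s\<in>?G. a s *\<^sub>F \<psi> (bilinear_ext ?G L (\<otimes>\<^bsub>PT n\<^esub>) (delta s) (delta y))))"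
    unfolding smult_L by (subst ea, subst ex) (simp only: bilinear_ext_sum bilinear_ext_scale \<psi>_linear)
  also have "\<dots> = (\<Sum>y\<in>L. x y *\<^sub>F (\<Sum>s\<in>?G. a s *\<^sub>F (delta s \<bullet> \<psi> (delta y))))"
    by (intro sum.cong refl arg_cong[of _ _ "\<lambda>v. _ *\<^sub>F v"]) (simp only: bilinear_L_delta)
  also have "\<dots> = a \<bullet> \<psi> x"
    by (subst (2) ea, subst (2) ex) (simp only: bilinear_ext_sum bilinear_ext_scale \<psi>_linear)
  finally show ?thesis .
qed

lemma f_emb_f: "p permutes {1..k} \<Longrightarrow> f \<bullet> delta (emb p) \<bullet> f = delta (emb p) \<bullet> f"
  using P.mob_delta_mob[OF emb_in k_sub k_sub] by (simp add: ran_emb)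

lemma emb_fun_linear:
  "emb_fun (x + y) = emb_fun x + emb_fun y" "emb_fun (c *\<^sub>F x) = c *\<^sub>F emb_fun x"
  "emb_fun (\<Sum>i\<in>I. h i) = (\<Sum>i\<in>I. emb_fun (h i))"
proof -
  show add: "emb_fun (x + y) = emb_fun x + emb_fun y" for x y
    by (simp add: emb_fun_def fun_vs.scale_left_distrib sum.distrib)
  show "emb_fun (c *\<^sub>F x) = c *\<^sub>F emb_fun x"
    by (simp add: emb_fun_def fun_vs.scale_sum_right)
  have "emb_fun 0 = 0" by (simp add: emb_fun_def)
  then show "emb_fun (\<Sum>i\<in>I. h i) = (\<Sum>i\<in>I. emb_fun (h i))"
    by (induction I rule: infinite_finite_induct) (simp_all add: add)
qed

lemma j_linear:
  "j (x + y) = j x + j y" "j (c *\<^sub>F x) = c *\<^sub>F j x" "j (\<Sum>i\<in>I. h i) = (\<Sum>i\<in>I. j (h i))"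
  by (simp_all add: j_def emb_fun_linear bilinear_ext_add bilinear_ext_scale bilinear_ext_sum)

lemma j_delta:
  assumes p: "p permutes {1..k}"
  shows "j (delta p) = delta (emb p) \<bullet> f"
proof -
  have "emb_fun (delta p) = (\<Sum>q\<in>carrier (sym_group k). if q = p then delta (emb p) else 0)"
    unfolding emb_fun_def by (intro sum.cong refl) (simp add: delta_apply)
  then show ?thesis using p by (simp add: j_def)
qed

lemma j_in [simp, intro]: "j b \<in> P.alg"
  by (simp add: j_def)

lemma j_expand:
  assumes "b \<in> S.alg"
  shows "j b = (\<Sum>p\<in>carrier (sym_group k). b p *\<^sub>F j (delta p))"
  using arg_cong[OF functions_on_expand[OF S.finite_carrier assms], of j] by (simp only: j_linear)

lemma f_j: "b \<in> S.alg \<Longrightarrow> f \<bullet> j b = j b"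
  unfolding j_expand bilinear_ext_sum bilinear_ext_scale
  by (intro sum.cong refl) (simp add: j_delta f_emb_f P.conv_assoc[symmetric])

lemma j_f: "j b \<bullet> f = j b"
  by (simp add: j_def P.conv_assoc P.mob_idem[OF k_sub])

lemma j_conv_delta:
  assumes p: "p permutes {1..k}" and q: "q permutes {1..k}"
  shows "j (delta p) \<bullet> j (delta q) = j (delta (p \<circ> q))"
proof -
  have "j (delta p) \<bullet> j (delta q) = delta (emb p) \<bullet> (f \<bullet> delta (emb q) \<bullet> f)"
    using p q by (simp add: j_delta P.conv_assoc)
  also have "\<dots> = delta (emb p) \<bullet> delta (emb q) \<bullet> f"
    unfolding f_emb_f[OF q] by (simp add: P.conv_assoc)
  also have "\<dots> = delta (emb (p \<circ> q)) \<bullet> f"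
    using P.conv_delta[OF emb_in[OF p] emb_in[OF q]] emb_comp[OF q] by simp
  also have "\<dots> = j (delta (p \<circ> q))"
    by (rule j_delta[OF permutes_compose[OF q p], symmetric])
  finally show ?thesis .
qed

lemma j_conv:
  assumes a: "a \<in> S.alg" and b: "b \<in> S.alg"
  shows "j (a \<star> b) = j a \<bullet> j b"
proof -
  let ?G = "carrier (sym_group k)"
  have ea: "a = (\<Sum>p\<in>?G. a p *\<^sub>F delta p)" by (rule functions_on_expand[OF S.finite_carrier a])
  have eb: "b = (\<Sum>p\<in>?G. b p *\<^sub>F delta p)" by (rule functions_on_expand[OF S.finite_carrier b])
  have "j (a \<star> b) = (\<Sum>q\<in>?G. b q *\<^sub>F (\<Sum>p\<in>?G. a p *\<^sub>F j (delta p \<star> delta q)))"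
    by (subst ea, subst eb) (simp only: bilinear_ext_sum bilinear_ext_scale j_linear)
  also have "\<dots> = (\<Sum>q\<in>?G. b q *\<^sub>F (\<Sum>p\<in>?G. a p *\<^sub>F (j (delta p) \<bullet> j (delta q))))"
    by (intro sum.cong refl arg_cong[of _ _ "\<lambda>v. _ *\<^sub>F v"])
       (simp add: S.conv_delta j_conv_delta)
  also have "\<dots> = j a \<bullet> j b"
    by (subst (2) ea, subst (2) eb) (simp only: bilinear_ext_sum bilinear_ext_scale j_linear)
  finally show ?thesis .
qed

lemma j_one: "j (delta id) = f"
  using j_delta[OF permutes_id] P.delta_identity_mob[OF k_sub] by (simp add: emb_id)

lemma emb_fun_apply:
  assumes p: "p permutes {1..k}"
  shows "emb_fun b (emb p) = b p"
proof -
  have "emb_fun b (emb p) = (\<Sum>q\<in>carrier (sym_group k). if q = p then b q else 0)"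
    unfolding emb_fun_def sum_fun_apply
  proof (intro sum.cong refl)
    fix q assume "q \<in> carrier (sym_group k)"
    then have "emb p = emb q \<longleftrightarrow> q = p" using emb_inj[OF p, of q] by auto
    then show "(b q *\<^sub>F delta (emb q)) (emb p) = (if q = p then b q else 0)"
      by (simp add: delta_apply)
  qed
  then show ?thesis using p by simp
qed

lemma emb_fun_in: "emb_fun b \<in> functions_on L"
  unfolding emb_fun_def by (intro functions_on_sum functions_on_closed emb_in_L) simp

lemma j_inj:
  assumes "a \<in> S.alg" "b \<in> S.alg" "j a = j b"
  shows "a = b"
proof (rule functions_on_eqI[OF assms(1,2)])
  fix p assume p: "p \<in> carrier (sym_group k)"
  have "emb_fun a = emb_fun b"
    using assms(3) by (intro \<psi>_inj[OF emb_fun_in emb_fun_in]) (simp add: j_def \<psi>_def)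
  then show "a p = b p" using emb_fun_apply[of p a] emb_fun_apply[of p b] p by simp
qed

text \<open>A basis element survives between two copies of \<open>f\<close> only if it maps
  \<open>{1..k}\<close> onto itself, hence restricts to a permutation.\<close>

lemma corner:
  assumes x: "x \<in> P.alg"
  shows "\<exists>b\<in>S.alg. f \<bullet> x \<bullet> f = j b"
proof -
  have "\<exists>b\<in>S.alg. f \<bullet> delta s \<bullet> f = j b" if s: "s \<in> carrier (PT n)" for s
  proof (cases "{1..k} \<subseteq> dom s \<and> ran (s |` {1..k}) = {1..k}")
    case True
    have "s |` {1..k} \<in> L"
      using True P.restrict_carrier[OF s, of "{1..k}"] unfolding L_eq by auto
    then obtain p where p: "p permutes {1..k}" "s |` {1..k} = emb p" using emb_surj True by blast
    have "f \<bullet> delta s \<bullet> f = delta (s |` {1..k}) \<bullet> f"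
      using P.mob_delta_mob[OF s k_sub k_sub] True P.delta_restrict_mob[OF s k_sub] by simp
    then show ?thesis using p j_delta[OF p(1)] by (intro bexI[of _ "delta p"]) auto
  next
    case False
    then have "f \<bullet> delta s \<bullet> f = 0" using P.mob_delta_mob[OF s k_sub k_sub] by auto
    moreover have "j 0 = 0" by (simp add: j_def emb_fun_def)
    ultimately show ?thesis by (intro bexI[of _ 0]) auto
  qed
  then obtain b where b: "\<And>s. s \<in> carrier (PT n) \<Longrightarrow> b s \<in> S.alg \<and> f \<bullet> delta s \<bullet> f = j (b s)"
    by metis
  have "f \<bullet> x \<bullet> f = (\<Sum>s\<in>carrier (PT n). x s *\<^sub>F (f \<bullet> delta s \<bullet> f))"
    by (subst P.conv_expand(2)[OF x]) (simp only: bilinear_ext_sum bilinear_ext_scale)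
  also have "\<dots> = (\<Sum>s\<in>carrier (PT n). x s *\<^sub>F j (b s))"
    by (intro sum.cong refl) (simp only: b)
  also have "\<dots> = j (\<Sum>s\<in>carrier (PT n). x s *\<^sub>F b s)" by (simp only: j_linear)
  finally show ?thesis using b by (intro bexI[of _ "\<Sum>s\<in>carrier (PT n). x s *\<^sub>F b s"]) auto
qed

lemma L_right_action_in [simp]: "L_right_action n k x b \<in> functions_on L"
  by (simp add: L_right_action_def)

text \<open>Right multiplication by a permutation of \<open>{1..k}\<close> never leaves the class,
  so nothing is truncated; the copy of \<open>f\<close> inside \<open>\<psi>\<close> passes the
  permutation by \<open>f_emb_f\<close>.\<close>

lemma \<psi>_right_action:
  assumes x: "x \<in> functions_on L" and b: "b \<in> S.alg"
  shows "\<psi> (L_right_action n k x b) = \<psi> x \<bullet> j b"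
proof -
  let ?G = "carrier (sym_group k)"
  let ?act = "\<lambda>p x. x \<otimes>\<^bsub>PT n\<^esub> ((Some \<circ> p) |` {1..k})"
  have base: "\<psi> (bilinear_ext ?G L ?act (delta p) (delta y)) = \<psi> (delta y) \<bullet> j (delta p)"
    if p: "p \<in> ?G" and y: "y \<in> L" for p y
  proof -
    have p': "p permutes {1..k}" using p by simp
    have in_L: "y \<circ>\<^sub>m emb p \<in> L"
    proof -
      have y_def: "y i \<noteq> None" if "i \<in> {1..k}" for i using y that by (auto simp: L_eq dom_def)
      have val: "(y \<circ>\<^sub>m emb p) i = (if i \<in> {1..k} then y (p i) else None)" for i
        by (simp add: map_comp_def emb_apply)
      have "(y \<circ>\<^sub>m emb p) i \<noteq> None \<longleftrightarrow> i \<in> {1..k}" for i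
        unfolding val using y_def[of "p i"] permutes_in_image[OF p', of i] by (simp only: split: if_split) blast
      then have "dom (y \<circ>\<^sub>m emb p) = {1..k}" unfolding dom_def by blast
      then show ?thesis
        using P.map_comp_in[OF L_sub[OF y] emb_in[OF p']] unfolding L_eq by blast
    qed
    have "bilinear_ext ?G L ?act (delta p) (delta y) = delta (y \<circ>\<^sub>m emb p)"
      using bilinear_ext_delta[OF S.finite_carrier p finite_L y, of ?act] in_L
      by (simp only: emb_def[symmetric] P.mult_PT if_True)
    then have "\<psi> (bilinear_ext ?G L ?act (delta p) (delta y)) = delta y \<bullet> delta (emb p) \<bullet> f"
      using P.conv_delta[OF L_sub[OF y] emb_in[OF p']] by (simp add: \<psi>_def)
    also have "\<dots> = delta y \<bullet> (f \<bullet> delta (emb p) \<bullet> f)"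
      unfolding f_emb_f[OF p'] by (rule P.conv_assoc)
    finally show ?thesis by (simp only: \<psi>_def j_delta[OF p'] P.conv_assoc)
  qed
  have eb: "b = (\<Sum>p\<in>?G. b p *\<^sub>F delta p)" by (rule functions_on_expand[OF S.finite_carrier b])
  have ex: "x = (\<Sum>y\<in>L. x y *\<^sub>F delta y)" by (rule functions_on_expand[OF finite_L x])
  have "\<psi> (L_right_action n k x b) =
      (\<Sum>y\<in>L. x y *\<^sub>F (\<Sum>p\<in>?G. b p *\<^sub>F \<psi> (bilinear_ext ?G L ?act (delta p) (delta y))))"
    unfolding L_right_action_def
    by (subst eb, subst ex) (simp only: bilinear_ext_sum bilinear_ext_scale \<psi>_linear)
  also have "\<dots> = (\<Sum>y\<in>L. x y *\<^sub>F (\<Sum>p\<in>?G. b p *\<^sub>F (\<psi> (delta y) \<bullet> j (delta p))))"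
    by (intro sum.cong refl arg_cong[of _ _ "\<lambda>v. _ *\<^sub>F v"]) (simp only: base)
  also have "\<dots> = (\<Sum>p\<in>?G. b p *\<^sub>F (\<Sum>y\<in>L. x y *\<^sub>F (\<psi> (delta y) \<bullet> j (delta p))))"
    unfolding fun_vs.scale_sum_right fun_vs.scale_scale
    by (subst sum.swap) (simp only: mult.commute)
  also have "\<dots> = \<psi> x \<bullet> j b"
    by (subst (2) ex, subst (2) eb) (simp only: bilinear_ext_sum bilinear_ext_scale \<psi>_linear j_linear)
  finally show ?thesis .
qed

end

section \<open>The induced modules as left ideals\<close>

lemma left_module_hom_finsum:
  assumes M: "left_module R M" and N: "left_module R N" and h: "h \<in> left_module_hom R M N"
    and B: "finite B" "\<And>b. b \<in> B \<Longrightarrow> g b \<in> carrier M"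
  shows "h (\<Oplus>\<^bsub>M\<^esub>b\<in>B. g b) = (\<Oplus>\<^bsub>N\<^esub>b\<in>B. h (g b))"
proof -
  interpret M: left_module R M by fact
  interpret N: left_module R N by fact
  note hD = left_module_homD[OF h]
  show ?thesis
    using B
  proof (induction B rule: finite_induct)
    case empty
    show ?case using left_module_hom_zero[OF M N h] by simp
  next
    case (insert b B)
    have g: "g \<in> B \<rightarrow> carrier M" "g b \<in> carrier M" using insert.prems by auto
    then have "(\<lambda>b. h (g b)) \<in> B \<rightarrow> carrier N" "h (g b) \<in> carrier N" using hD(1) by auto
    then show ?case using insert g hD(2)[OF g(2) M.M.finsum_closed[OF g(1)]] by simp
  qed
qed

lemma finite_dimensional_transport:
  assumes G: "finite_monoid G"
    and M: "left_module (monoid_algebra G) M" and N: "left_module (monoid_algebra G) N"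
    and iso: "left_module_iso (monoid_algebra G) M N" and fd: "finite_dimensional G M"
  shows "finite_dimensional G N"
proof -
  interpret G: finite_monoid G by fact
  interpret M: left_module "monoid_algebra G" M by fact
  interpret N: left_module "monoid_algebra G" N by fact
  obtain h where h: "h \<in> left_module_hom (monoid_algebra G) M N" and bij: "bij_betw h (carrier M) (carrier N)"
    using iso by (auto simp: left_module_iso_def)
  note hD = left_module_homD[OF h]
  obtain B where B: "finite B" "B \<subseteq> carrier M"
    and span: "\<forall>x\<in>carrier M. \<exists>c. x = (\<Oplus>\<^bsub>M\<^esub>b\<in>B. (\<lambda>g. c b * \<one>\<^bsub>monoid_algebra G\<^esub> g) \<odot>\<^bsub>M\<^esub> b)"
    using fd unfolding finite_dimensional_def by (elim exE conjE)
  have injB: "inj_on h B" using bij B(2) by (auto simp: bij_betw_def intro: inj_on_subset)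
  have scal: "(\<lambda>g. c * \<one>\<^bsub>monoid_algebra G\<^esub> g) \<in> carrier (monoid_algebra G)" for c
    using functions_on_closed(3)[of "delta \<one>\<^bsub>G\<^esub>" "carrier G" c] by (simp add: scale_fun_def)
  show ?thesis
    unfolding finite_dimensional_def
  proof (intro exI[of _ "h ` B"] conjI ballI)
    show "finite (h ` B)" "h ` B \<subseteq> carrier N" using B hD(1) by auto
    fix y assume "y \<in> carrier N"
    then obtain x where x: "x \<in> carrier M" "y = h x" using bij by (auto simp: bij_betw_def)
    obtain c where c: "x = (\<Oplus>\<^bsub>M\<^esub>b\<in>B. (\<lambda>g. c b * \<one>\<^bsub>monoid_algebra G\<^esub> g) \<odot>\<^bsub>M\<^esub> b)"
      using bspec[OF span x(1)] by (elim exE)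
    let ?c = "\<lambda>y. c (inv_into B h y)"
    have "y = (\<Oplus>\<^bsub>N\<^esub>b\<in>B. h ((\<lambda>g. c b * \<one>\<^bsub>monoid_algebra G\<^esub> g) \<odot>\<^bsub>M\<^esub> b))"
      unfolding x(2) by (subst c, rule left_module_hom_finsum[OF M N h B(1)])
        (use B(2) M.smult_closed[OF scal] in blast)
    also have "\<dots> = (\<Oplus>\<^bsub>N\<^esub>b\<in>B. (\<lambda>g. ?c (h b) * \<one>\<^bsub>monoid_algebra G\<^esub> g) \<odot>\<^bsub>N\<^esub> h b)"
    proof (rule N.M.finsum_cong')
      show "(\<lambda>b. (\<lambda>g. ?c (h b) * \<one>\<^bsub>monoid_algebra G\<^esub> g) \<odot>\<^bsub>N\<^esub> h b) \<in> B \<rightarrow> carrier N"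
        using B(2) N.smult_closed[OF scal hD(1)] by blast
      fix b assume b: "b \<in> B"
      then have "?c (h b) = c b" using injB by simp
      then show "h ((\<lambda>g. c b * \<one>\<^bsub>monoid_algebra G\<^esub> g) \<odot>\<^bsub>M\<^esub> b) =
          (\<lambda>g. ?c (h b) * \<one>\<^bsub>monoid_algebra G\<^esub> g) \<odot>\<^bsub>N\<^esub> h b"
        using hD(3)[OF scal] b B(2) by (simp only:) blast
    qed simp
    also have "\<dots> = (\<Oplus>\<^bsub>N\<^esub>y\<in>h ` B. (\<lambda>g. ?c y * \<one>\<^bsub>monoid_algebra G\<^esub> g) \<odot>\<^bsub>N\<^esub> y)"
      by (rule N.M.finsum_reindex[symmetric, OF _ injB])
         (use B(2) N.smult_closed[OF scal hD(1)] in blast)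
    finally show "\<exists>c. y = (\<Oplus>\<^bsub>N\<^esub>b\<in>h ` B. (\<lambda>g. c b * \<one>\<^bsub>monoid_algebra G\<^esub> g) \<odot>\<^bsub>N\<^esub> b)"
      by (intro exI[of _ ?c])
  qed
qed

context finite_monoid
begin

text \<open>The elements \<open>s e\<close> span. Different \<open>s\<close> may give the same
  element, so coefficients are collected over fibres.\<close>

lemma finite_dimensional_left_ideal:
  assumes "ring_idempotent (monoid_algebra G) e"
  shows "finite_dimensional G (left_ideal (monoid_algebra G) e)"
proof -
  interpret ring_idempotent "monoid_algebra G" e by fact
  interpret I: left_module "monoid_algebra G" "left_ideal (monoid_algebra G) e"
    by (rule left_module_left_ideal)
  have e: "e \<in> alg" "e \<star> e = e" using e_closed e_idem by simp_all
  let ?b = "\<lambda>s. delta s \<star> e"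
  let ?B = "?b ` carrier G"
  have B: "?B \<subseteq> carrier (left_ideal (monoid_algebra G) e)"
    using e by (auto simp: conv_assoc)
  have sum: "(\<Oplus>\<^bsub>left_ideal (monoid_algebra G) e\<^esub>b\<in>C. (\<lambda>g. c b * \<one>\<^bsub>monoid_algebra G\<^esub> g)
      \<odot>\<^bsub>left_ideal (monoid_algebra G) e\<^esub> b) = (\<Sum>b\<in>C. c b *\<^sub>F b)" if "finite C" "C \<subseteq> ?B" for C c
    using that
  proof (induction C rule: finite_induct)
    case (insert b C)
    have scal: "(\<lambda>g. c b * \<one>\<^bsub>monoid_algebra G\<^esub> g) \<odot>\<^bsub>left_ideal (monoid_algebra G) e\<^esub> b = c b *\<^sub>F b"
      if "b \<in> ?B" for b
    proof -
      have b: "b \<in> alg" using that by auto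
      have "(\<lambda>g. c b * \<one>\<^bsub>monoid_algebra G\<^esub> g) = c b *\<^sub>F delta \<one>" by (simp add: scale_fun_def)
      then show ?thesis using b by (simp add: bilinear_ext_scale)
    qed
    have in_carrier: "c b *\<^sub>F b \<in> carrier (left_ideal (monoid_algebra G) e)" if "b \<in> ?B" for b
      using that B by (auto simp: bilinear_ext_scale)
    have "(\<lambda>b. (\<lambda>g. c b * \<one>\<^bsub>monoid_algebra G\<^esub> g) \<odot>\<^bsub>left_ideal (monoid_algebra G) e\<^esub> b)
        \<in> C \<rightarrow> carrier (left_ideal (monoid_algebra G) e)"
    proof (rule Pi_I)
      fix x assume "x \<in> C"
      then have x: "x \<in> ?B" using insert.prems by blast
      show "(\<lambda>g. c x * \<one>\<^bsub>monoid_algebra G\<^esub> g) \<odot>\<^bsub>left_ideal (monoid_algebra G) e\<^esub> x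
          \<in> carrier (left_ideal (monoid_algebra G) e)"
        unfolding scal[OF x] by (rule in_carrier[OF x])
    qed
    then show ?case
      using insert scal[of b] in_carrier[of b] by (simp del: left_ideal_iff left_ideal_simps(3))
  qed simp
  show ?thesis
    unfolding finite_dimensional_def
  proof (intro exI[of _ ?B] conjI ballI B)
    fix x assume "x \<in> carrier (left_ideal (monoid_algebra G) e)"
    then have x: "x \<in> alg" "x \<star> e = x" by simp_all
    let ?c = "\<lambda>b. \<Sum>s\<in>{s. s \<in> carrier G \<and> ?b s = b}. x s"
    have "x = (\<Sum>s\<in>carrier G. x s *\<^sub>F ?b s)"
      using conv_expand(1)[OF x(1), of e] x(2) by simp
    also have "\<dots> = (\<Sum>b\<in>?B. \<Sum>s\<in>{s. s \<in> carrier G \<and> ?b s = b}. x s *\<^sub>F ?b s)"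
      by (rule sum.image_gen) simp
    also have "\<dots> = (\<Sum>b\<in>?B. ?c b *\<^sub>F b)"
      unfolding fun_vs.scale_sum_left by (intro sum.cong refl, elim CollectE conjE, simp only:)
    finally have x': "x = (\<Sum>b\<in>?B. ?c b *\<^sub>F b)" .
    show "\<exists>c. x = (\<Oplus>\<^bsub>left_ideal (monoid_algebra G) e\<^esub>b\<in>?B. (\<lambda>g. c b * \<one>\<^bsub>monoid_algebra G\<^esub> g)
        \<odot>\<^bsub>left_ideal (monoid_algebra G) e\<^esub> b)"
      by (rule exI[of _ ?c])
         (rule trans[OF x' sum[OF finite_imageI[OF finite_carrier] order_refl, symmetric]])
  qed simp
qed

end

locale induced = pt_level n k + Sp: specht k \<mu> for n k \<mu>
begin

abbreviation "A \<equiv> monoid_algebra (PT n)"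

definition "e = j (S.young_idem \<mu>)"

definition "I = {y \<in> S.alg. y \<star> S.young_idem \<mu> = y}"

definition "\<iota> = inv_into I Sp.\<Theta>"

text \<open>Multiplication in the algebra, after \<open>\<psi>\<close> has placed the class module
  in \<open>A f\<close> and \<open>j\<close> has placed the Specht module in \<open>f A f\<close>;
  its image is \<open>A e\<close>.\<close>

definition "\<phi> x y = \<psi> x \<bullet> j (\<iota> y)"

lemma e_in [simp]: "e \<in> P.alg"
  by (simp add: e_def)

lemma e_idem: "e \<bullet> e = e"
  unfolding e_def by (simp only: j_conv[symmetric] S.young_idem_in S.young_idem(1)[OF Sp.\<mu>])

lemma e_f: "e \<bullet> f = e" and f_e: "f \<bullet> e = e"
  by (simp_all add: e_def j_f f_j)

lemma j_zero: "j 0 = 0"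
  by (simp add: j_def emb_fun_def)

lemma e_nonzero: "e \<noteq> 0"
proof
  assume "e = 0"
  then have "S.young_idem \<mu> = 0"
    unfolding e_def using j_zero by (intro j_inj) simp_all
  then show False using S.young_idem(2)[OF Sp.\<mu>] by simp
qed

sublocale E: ring_idempotent A e
  using P.ring_monoid_algebra by (intro ring_idempotent.intro ring_idempotent_axioms.intro) (simp_all add: e_idem)

text \<open>The element lies in \<open>f A f\<close>, which is the group algebra, where a Young
  idempotent compresses everything to multiples of itself.\<close>

lemma e_scalar:
  assumes x: "x \<in> P.alg"
  shows "\<exists>d. e \<bullet> x \<bullet> e = d *\<^sub>F e"
proof -
  obtain b where b: "b \<in> S.alg" "f \<bullet> x \<bullet> f = j b" using corner[OF x] by blast
  obtain d where d: "S.young_idem \<mu> \<star> b \<star> S.young_idem \<mu> = d *\<^sub>F S.young_idem \<mu>"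
    using S.young_idem_scalar[OF Sp.\<mu> b(1)] by blast
  have "e \<bullet> x \<bullet> e = (e \<bullet> f) \<bullet> x \<bullet> (f \<bullet> e)" by (simp only: e_f f_e)
  also have "\<dots> = e \<bullet> j b \<bullet> e" unfolding b(2)[symmetric] by (simp only: P.conv_assoc)
  also have "\<dots> = j (S.young_idem \<mu> \<star> b \<star> S.young_idem \<mu>)"
    unfolding e_def using b(1) by (simp add: j_conv)
  also have "\<dots> = d *\<^sub>F e" unfolding d by (simp only: j_linear e_def)
  finally show ?thesis by blast
qed

lemma indecomposable: "indecomposable_module A (left_ideal A e)"
proof (rule E.indecomposable_left_ideal)
  show "e \<noteq> \<zero>\<^bsub>A\<^esub>" using e_nonzero by simp
  fix x assume "x \<in> carrier A"
  then obtain d where d: "e \<bullet> x \<bullet> e = d *\<^sub>F e" using e_scalar by auto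
  show "e \<otimes>\<^bsub>A\<^esub> x \<otimes>\<^bsub>A\<^esub> e = \<zero>\<^bsub>A\<^esub> \<or> (\<exists>y\<in>carrier A. y \<otimes>\<^bsub>A\<^esub> (e \<otimes>\<^bsub>A\<^esub> x \<otimes>\<^bsub>A\<^esub> e) = e)"
  proof (cases "d = 0")
    case True
    then show ?thesis using d by simp
  next
    case False
    have "(inverse d *\<^sub>F delta \<one>\<^bsub>PT n\<^esub>) \<bullet> (e \<bullet> x \<bullet> e) = e"
      unfolding d using False P.conv_one(1)[OF e_in] by (simp only: bilinear_ext_scale fun_vs.scale_scale) simp
    then show ?thesis
      unfolding P.monoid_algebra_simps
      by (intro disjI2 bexI[of _ "inverse d *\<^sub>F delta \<one>\<^bsub>PT n\<^esub>"]) (simp_all add: P.one_closed del: P.carrier_PT)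
  qed
qed

lemma \<Theta>_I: "bij_betw Sp.\<Theta> I (carrier (specht_module \<mu>))"
  unfolding I_def by (rule Sp.\<Theta>_bij)

lemma I_alg: "y \<in> I \<Longrightarrow> y \<in> S.alg"
  by (simp add: I_def)

lemma I_closed: "x \<in> I \<Longrightarrow> y \<in> I \<Longrightarrow> x + y \<in> I" "y \<in> I \<Longrightarrow> r \<star> y \<in> I" "S.young_idem \<mu> \<in> I"
  by (auto simp: I_def bilinear_ext_add S.conv_assoc S.young_idem(1)[OF Sp.\<mu>])

lemma \<iota>_in: "y \<in> carrier (specht_module \<mu>) \<Longrightarrow> \<iota> y \<in> I"
  unfolding \<iota>_def using bij_betwE[OF bij_betw_inv_into[OF \<Theta>_I]] by blast

lemma \<Theta>_\<iota>: "y \<in> carrier (specht_module \<mu>) \<Longrightarrow> Sp.\<Theta> (\<iota> y) = y"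
  unfolding \<iota>_def by (rule bij_betw_inv_into_right[OF \<Theta>_I])

lemma \<iota>_\<Theta>: "u \<in> I \<Longrightarrow> \<iota> (Sp.\<Theta> u) = u"
  unfolding \<iota>_def by (rule bij_betw_inv_into_left[OF \<Theta>_I])

lemma \<Theta>_in: "u \<in> I \<Longrightarrow> Sp.\<Theta> u \<in> carrier (specht_module \<mu>)"
  using bij_betwE[OF \<Theta>_I] by blast

lemma specht_add: "x \<oplus>\<^bsub>specht_module \<mu>\<^esub> y = x + y"
  by (simp add: specht_module_def plus_fun_def)

lemma L_module_simps: "carrier (L_module n k) = functions_on L" "x \<oplus>\<^bsub>L_module n k\<^esub> y = x + y"
  by (simp_all add: L_module_def plus_fun_def)

lemma \<iota>_add:
  assumes "x \<in> carrier (specht_module \<mu>)" "y \<in> carrier (specht_module \<mu>)"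
  shows "x + y \<in> carrier (specht_module \<mu>)" "\<iota> (x + y) = \<iota> x + \<iota> y"
proof -
  have u: "\<iota> x + \<iota> y \<in> I" using assms by (intro I_closed \<iota>_in)
  have eq: "Sp.\<Theta> (\<iota> x + \<iota> y) = x + y" by (simp only: Sp.\<Theta>_linear \<Theta>_\<iota>[OF assms(1)] \<Theta>_\<iota>[OF assms(2)])
  show "x + y \<in> carrier (specht_module \<mu>)" "\<iota> (x + y) = \<iota> x + \<iota> y"
    using \<Theta>_in[OF u] \<iota>_\<Theta>[OF u] unfolding eq by blast+
qed

lemma \<iota>_smult:
  assumes "y \<in> carrier (specht_module \<mu>)"
  shows "r \<odot>\<^bsub>specht_module \<mu>\<^esub> y \<in> carrier (specht_module \<mu>)" "\<iota> (r \<odot>\<^bsub>specht_module \<mu>\<^esub> y) = r \<star> \<iota> y"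
proof -
  have u: "r \<star> \<iota> y \<in> I" using assms by (intro I_closed \<iota>_in)
  have eq: "Sp.\<Theta> (r \<star> \<iota> y) = r \<odot>\<^bsub>specht_module \<mu>\<^esub> y" by (simp only: Sp.\<Theta>_conv \<Theta>_\<iota>[OF assms])
  show "r \<odot>\<^bsub>specht_module \<mu>\<^esub> y \<in> carrier (specht_module \<mu>)" "\<iota> (r \<odot>\<^bsub>specht_module \<mu>\<^esub> y) = r \<star> \<iota> y"
    using \<Theta>_in[OF u] \<iota>_\<Theta>[OF u] unfolding eq by blast+
qed

lemma left_ideal_f:
  assumes "p \<in> P.alg" "p \<bullet> e = p"
  shows "p \<bullet> f = p"
proof -
  have "p \<bullet> f = p \<bullet> (e \<bullet> f)" unfolding P.conv_assoc[symmetric] assms(2) ..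
  then show ?thesis unfolding e_f assms(2) .
qed

text \<open>The generator \<open>y\<^sub>0\<close> is the image of the Young idempotent: every
  \<open>y\<close> is \<open>\<iota> y\<close> applied to it. On a pair \<open>(x, y)\<close> the
  product is \<open>\<psi>\<close> of the right action of \<open>\<iota> y\<close> on
  \<open>x\<close>, which \<open>\<chi>\<close> undoes.\<close>

sublocale T: tensor_recognition A "left_ideal A e" "L_module n k" "specht_module \<mu>"
  "monoid_algebra (sym_group k)" "L_right_action n k" \<phi> "Sp.\<Theta> (S.young_idem \<mu>)" \<chi>
proof (intro tensor_recognition.intro tensor_recognition_axioms.intro E.left_module_left_ideal;
    (unfold L_module_simps P.monoid_algebra_simps S.monoid_algebra_simps specht_add E.left_ideal_iff left_ideal_simps)?)
  fix x x' assume "x \<in> functions_on L" "x' \<in> functions_on L"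
  then show "x + x' \<in> functions_on L" by simp
next
  fix a x x'
  show "a \<odot>\<^bsub>L_module n k\<^esub> x \<in> functions_on L" by (simp add: smult_L)
  show "a \<odot>\<^bsub>L_module n k\<^esub> (x + x') = a \<odot>\<^bsub>L_module n k\<^esub> x + a \<odot>\<^bsub>L_module n k\<^esub> x'"
    by (simp only: smult_L bilinear_ext_add)
next
  fix x r show "L_right_action n k x r \<in> functions_on L" by simp
next
  fix a x r assume a: "a \<in> P.alg" and x: "x \<in> functions_on L" and r: "r \<in> S.alg"
  have ax: "a \<odot>\<^bsub>L_module n k\<^esub> x \<in> functions_on L" by (simp add: smult_L)
  \<comment> \<open>The injective \<open>\<psi>\<close> turns the two actions into left and right
    multiplication, where commuting is associativity.\<close>
  show "a \<odot>\<^bsub>L_module n k\<^esub> L_right_action n k x r = L_right_action n k (a \<odot>\<^bsub>L_module n k\<^esub> x) r"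
    by (rule \<psi>_inj)
       (simp add: smult_L, simp, simp only: \<psi>_smult[OF a] L_right_action_in \<psi>_right_action[OF _ r] x ax P.conv_assoc)
next
  fix y y' assume "y \<in> carrier (specht_module \<mu>)" "y' \<in> carrier (specht_module \<mu>)"
  then show "y + y' \<in> carrier (specht_module \<mu>)" by (rule \<iota>_add)
next
  fix r y assume "y \<in> carrier (specht_module \<mu>)"
  then show "r \<odot>\<^bsub>specht_module \<mu>\<^esub> y \<in> carrier (specht_module \<mu>)" by (rule \<iota>_smult)
next
  fix x y assume x: "x \<in> functions_on L" and y: "y \<in> carrier (specht_module \<mu>)"
  have iy: "\<iota> y \<in> S.alg" "\<iota> y \<star> S.young_idem \<mu> = \<iota> y" using \<iota>_in[OF y] by (simp_all add: I_def)
  have "j (\<iota> y) \<bullet> e = j (\<iota> y)"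
    unfolding e_def by (simp only: j_conv[symmetric] iy S.young_idem_in)
  then show "\<phi> x y \<in> P.alg \<and> \<phi> x y \<bullet> e = \<phi> x y"
    by (simp add: \<phi>_def P.conv_assoc)
  have yi: "y = \<iota> y \<odot>\<^bsub>specht_module \<mu>\<^esub> Sp.\<Theta> (S.young_idem \<mu>)"
    by (simp only: Sp.\<Theta>_conv[symmetric] iy \<Theta>_\<iota>[OF y])
  have "\<chi> (\<phi> x y) = L_right_action n k x (\<iota> y)"
    unfolding \<phi>_def \<psi>_right_action[OF x iy(1), symmetric] by (rule \<chi>_\<psi>) simp
  then show "\<exists>r\<in>S.alg. y = r \<odot>\<^bsub>specht_module \<mu>\<^esub> Sp.\<Theta> (S.young_idem \<mu>) \<and> \<chi> (\<phi> x y) = L_right_action n k x r"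
    using iy(1) yi by blast
next
  fix x x' y
  show "\<phi> (x + x') y = \<phi> x y + \<phi> x' y" by (simp only: \<phi>_def \<psi>_linear bilinear_ext_add)
next
  fix x y y' assume "y \<in> carrier (specht_module \<mu>)" "y' \<in> carrier (specht_module \<mu>)"
  then show "\<phi> x (y + y') = \<phi> x y + \<phi> x y'"
    by (simp only: \<phi>_def \<iota>_add(2) j_linear bilinear_ext_add)
next
  fix x r y assume x: "x \<in> functions_on L" and r: "r \<in> S.alg" and y: "y \<in> carrier (specht_module \<mu>)"
  show "\<phi> (L_right_action n k x r) y = \<phi> x (r \<odot>\<^bsub>specht_module \<mu>\<^esub> y)"
    by (simp only: \<phi>_def \<iota>_smult(2)[OF y] \<psi>_right_action[OF x r] j_conv[OF r I_alg[OF \<iota>_in[OF y]]] P.conv_assoc)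
next
  show "Sp.\<Theta> (S.young_idem \<mu>) \<in> carrier (specht_module \<mu>)" by (intro \<Theta>_in I_closed)
next
  show "\<chi> \<in> left_module_hom A (left_ideal A e) (L_module n k)"
  proof (rule left_module_homI; (unfold L_module_simps P.monoid_algebra_simps E.left_ideal_iff left_ideal_simps)?)
    show "\<chi> x \<in> functions_on L" for x by simp
    show "\<chi> (x + y) = \<chi> x + \<chi> y" for x y by (rule \<chi>_linear)
    fix a p assume a: "a \<in> P.alg" and p: "p \<in> P.alg \<and> p \<bullet> e = p"
    have pf: "p \<bullet> f = p" using p by (intro left_ideal_f) blast+
    have "\<psi> (\<chi> (a \<bullet> p)) = a \<bullet> p"
      by (rule \<psi>_\<chi>) (simp, simp only: P.conv_assoc pf)
    also have "\<dots> = \<psi> (a \<odot>\<^bsub>L_module n k\<^esub> \<chi> p)"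
      using p pf by (simp only: \<psi>_smult[OF a \<chi>_in] \<psi>_\<chi>)
    finally show "\<chi> (a \<bullet> p) = a \<odot>\<^bsub>L_module n k\<^esub> \<chi> p"
      by (rule \<psi>_inj[rotated 2]) (simp_all add: smult_L)
  qed
next
  fix p assume p: "p \<in> P.alg \<and> p \<bullet> e = p"
  then have "\<psi> (\<chi> p) = p" by (intro \<psi>_\<chi> left_ideal_f) blast+
  then show "\<phi> (\<chi> p) (Sp.\<Theta> (S.young_idem \<mu>)) = p"
    using p by (simp only: \<phi>_def \<iota>_\<Theta>[OF I_closed(3)] e_def)
qed

lemma left_module_induced: "left_module A (induced_module n k \<mu>)"
  unfolding induced_module_def by (rule T.left_module_tensor)

lemma induced_iso: "left_module_iso A (left_ideal A e) (induced_module n k \<mu>)"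
  unfolding induced_module_def by (rule T.tensor_iso)

lemma finite_dimensional_induced: "finite_dimensional (PT n) (induced_module n k \<mu>)"
  by (rule finite_dimensional_transport[OF P.finite_monoid_axioms E.left_module_left_ideal
        left_module_induced induced_iso P.finite_dimensional_left_ideal[OF E.ring_idempotent_axioms]])

lemma indecomposable_induced: "indecomposable_module A (induced_module n k \<mu>)"
  by (rule indecomposable_transport[OF E.left_module_left_ideal left_module_induced induced_iso indecomposable])

lemma projective_induced: "projective_module TYPE('u) TYPE('v) A (induced_module n k \<mu>)"
  by (rule projective_transport[OF E.left_module_left_ideal induced_iso E.projective_left_ideal])

end

section \<open>Every indecomposable projective module is induced\<close>

lemma (in left_module) finsum_nonzeroE:
  assumes "(\<Oplus>\<^bsub>M\<^esub>i\<in>I. g i) \<noteq> \<zero>\<^bsub>M\<^esub>" "\<And>i. i \<in> I \<Longrightarrow> g i \<in> carrier M"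
  obtains i where "i \<in> I" "g i \<noteq> \<zero>\<^bsub>M\<^esub>"
proof -
  have "\<exists>i\<in>I. g i \<noteq> \<zero>\<^bsub>M\<^esub>"
  proof (rule ccontr)
    assume "\<not> ?thesis"
    then have "(\<Oplus>\<^bsub>M\<^esub>i\<in>I. g i) = \<zero>\<^bsub>M\<^esub>" by (intro M.add.finprod_one_eqI) blast
    then show False using assms(1) by simp
  qed
  then show ?thesis using that by blast
qed

section \<open>Free modules and dual bases\<close>

context finite_monoid
begin

text \<open>The free module of rank \<open>m\<close>, encoded by sequences that vanish from
  \<open>m\<close> on, so that one type serves all ranks; it is the type in the projectivity
  assumption of the theorem.\<close>

definition free_module :: "nat \<Rightarrow> ('a \<Rightarrow> complex, nat \<Rightarrow> 'a \<Rightarrow> complex) module" where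
  "free_module m = \<lparr>carrier = {F. (\<forall>i<m. F i \<in> alg) \<and> (\<forall>i\<ge>m. F i = 0)},
     monoid.mult = undefined, monoid.one = undefined,
     ring.zero = 0, ring.add = (+), smult = (\<lambda>a F i. a \<star> F i)\<rparr>"

lemma free_module_simps [simp]:
  "F \<in> carrier (free_module m) \<longleftrightarrow> (\<forall>i<m. F i \<in> alg) \<and> (\<forall>i\<ge>m. F i = 0)"
  "\<zero>\<^bsub>free_module m\<^esub> = 0" "F \<oplus>\<^bsub>free_module m\<^esub> F' = F + F'"
  "a \<odot>\<^bsub>free_module m\<^esub> F = (\<lambda>i. a \<star> F i)"
  by (simp_all add: free_module_def)

lemma left_module_free: "left_module (monoid_algebra G) (free_module m)"
proof (intro left_module.intro left_module_axioms.intro ring_monoid_algebra)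
  show "abelian_group (free_module m)"
  proof (rule abelian_groupI)
    fix F assume "F \<in> carrier (free_module m)"
    then have "- F \<in> carrier (free_module m)" by auto
    moreover have "- F \<oplus>\<^bsub>free_module m\<^esub> F = \<zero>\<^bsub>free_module m\<^esub>" by simp
    ultimately show "\<exists>y\<in>carrier (free_module m). y \<oplus>\<^bsub>free_module m\<^esub> F = \<zero>\<^bsub>free_module m\<^esub>" by blast
  qed (auto simp: add.assoc add.commute)
  show "a \<odot>\<^bsub>free_module m\<^esub> F \<in> carrier (free_module m)" if "F \<in> carrier (free_module m)" for a F
    using that by simp
  show "(a \<oplus>\<^bsub>monoid_algebra G\<^esub> b) \<odot>\<^bsub>free_module m\<^esub> F =
      a \<odot>\<^bsub>free_module m\<^esub> F \<oplus>\<^bsub>free_module m\<^esub> b \<odot>\<^bsub>free_module m\<^esub> F" for a b F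
    by (simp add: plus_fun_def[of "\<lambda>i. a \<star> F i"] bilinear_ext_add)
  show "a \<odot>\<^bsub>free_module m\<^esub> (F \<oplus>\<^bsub>free_module m\<^esub> F') =
      a \<odot>\<^bsub>free_module m\<^esub> F \<oplus>\<^bsub>free_module m\<^esub> a \<odot>\<^bsub>free_module m\<^esub> F'" for a F F'
    by (simp add: plus_fun_def[of "\<lambda>i. a \<star> F i"] bilinear_ext_add)
  show "(a \<otimes>\<^bsub>monoid_algebra G\<^esub> b) \<odot>\<^bsub>free_module m\<^esub> F = a \<odot>\<^bsub>free_module m\<^esub> (b \<odot>\<^bsub>free_module m\<^esub> F)" for a b F
    by (simp add: conv_assoc)
  show "\<one>\<^bsub>monoid_algebra G\<^esub> \<odot>\<^bsub>free_module m\<^esub> F = F" if "F \<in> carrier (free_module m)" for F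
  proof
    fix i
    show "(\<one>\<^bsub>monoid_algebra G\<^esub> \<odot>\<^bsub>free_module m\<^esub> F) i = F i"
      using that by (cases "i < m") simp_all
  qed
qed

text \<open>A finite spanning set gives a surjection from a free module onto \<open>Q\<close>;
  lifting the identity of \<open>Q\<close> gives a section, whose coordinates are the functionals
  \<open>\<sigma> i\<close>.\<close>

lemma dual_basis:
  fixes Q :: "('a \<Rightarrow> complex, 'q) module"
  assumes Q: "left_module (monoid_algebra G) Q" and fd: "finite_dimensional G Q"
    and proj: "projective_module TYPE(nat \<Rightarrow> 'a \<Rightarrow> complex) TYPE('q) (monoid_algebra G) Q"
  shows "\<exists>m (b :: nat \<Rightarrow> 'q) (\<sigma> :: nat \<Rightarrow> 'q \<Rightarrow> 'a \<Rightarrow> complex).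
     (\<forall>i<m. b i \<in> carrier Q \<and> (\<forall>q\<in>carrier Q. \<sigma> i q \<in> alg \<and>
        (\<forall>q'\<in>carrier Q. \<sigma> i (q \<oplus>\<^bsub>Q\<^esub> q') = \<sigma> i q + \<sigma> i q') \<and>
        (\<forall>a\<in>alg. \<sigma> i (a \<odot>\<^bsub>Q\<^esub> q) = a \<star> \<sigma> i q))) \<and>
     (\<forall>q\<in>carrier Q. q = (\<Oplus>\<^bsub>Q\<^esub>i\<in>{..<m}. \<sigma> i q \<odot>\<^bsub>Q\<^esub> b i))"
proof -
  interpret Q: left_module "monoid_algebra G" Q by fact
  obtain B where B: "finite B" "B \<subseteq> carrier Q"
    and span: "\<forall>x\<in>carrier Q. \<exists>c. x = (\<Oplus>\<^bsub>Q\<^esub>b\<in>B. (\<lambda>g. c b * \<one>\<^bsub>monoid_algebra G\<^esub> g) \<odot>\<^bsub>Q\<^esub> b)"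
    using fd unfolding finite_dimensional_def by (elim exE conjE)
  define m where "m = card B"
  obtain b where b: "bij_betw b {..<m} B"
    using ex_bij_betw_nat_finite[OF B(1)] unfolding m_def atLeast0LessThan by blast
  have bQ: "b i \<in> carrier Q" if "i < m" for i
    using bij_betwE[OF b] that B(2) by blast
  let ?U = "free_module m"
  define \<pi> where "\<pi> F = (\<Oplus>\<^bsub>Q\<^esub>i\<in>{..<m}. F i \<odot>\<^bsub>Q\<^esub> b i)" for F :: "nat \<Rightarrow> 'a \<Rightarrow> complex"
  have tQ: "F i \<odot>\<^bsub>Q\<^esub> b i \<in> carrier Q" if "F \<in> carrier ?U" "i < m" for F i
    using that bQ by (intro Q.smult_closed) auto
  have \<pi>: "\<pi> \<in> left_module_hom (monoid_algebra G) ?U Q"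
  proof (rule left_module_homI)
    fix F F' assume F: "F \<in> carrier ?U" and F': "F' \<in> carrier ?U"
    show "\<pi> F \<in> carrier Q" unfolding \<pi>_def using tQ[OF F] by (intro Q.M.finsum_closed) auto
    have "\<pi> (F \<oplus>\<^bsub>?U\<^esub> F') = (\<Oplus>\<^bsub>Q\<^esub>i\<in>{..<m}. F i \<odot>\<^bsub>Q\<^esub> b i \<oplus>\<^bsub>Q\<^esub> F' i \<odot>\<^bsub>Q\<^esub> b i)"
      unfolding \<pi>_def
    proof (rule Q.M.finsum_cong')
      fix i assume "i \<in> {..<m}"
      then show "(F \<oplus>\<^bsub>?U\<^esub> F') i \<odot>\<^bsub>Q\<^esub> b i = F i \<odot>\<^bsub>Q\<^esub> b i \<oplus>\<^bsub>Q\<^esub> F' i \<odot>\<^bsub>Q\<^esub> b i"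
        using F F' bQ Q.smult_l_distr[of "F i" "F' i" "b i"] by simp
    qed (use tQ[OF F] tQ[OF F'] in auto)
    also have "\<dots> = \<pi> F \<oplus>\<^bsub>Q\<^esub> \<pi> F'"
      unfolding \<pi>_def using tQ[OF F] tQ[OF F'] by (intro Q.M.finsum_addf) auto
    finally show "\<pi> (F \<oplus>\<^bsub>?U\<^esub> F') = \<pi> F \<oplus>\<^bsub>Q\<^esub> \<pi> F'" .
  next
    fix a F assume a: "a \<in> carrier (monoid_algebra G)" and F: "F \<in> carrier ?U"
    have "(\<lambda>x. a \<odot>\<^bsub>Q\<^esub> x) (\<Oplus>\<^bsub>Q\<^esub>i\<in>I. F i \<odot>\<^bsub>Q\<^esub> b i) = (\<Oplus>\<^bsub>Q\<^esub>i\<in>I. a \<odot>\<^bsub>Q\<^esub> (F i \<odot>\<^bsub>Q\<^esub> b i))"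
      if "finite I" "I \<subseteq> {..<m}" for I
      using that
    proof (induction I rule: finite_induct)
      case (insert i I)
      have g: "(\<lambda>i. F i \<odot>\<^bsub>Q\<^esub> b i) \<in> I \<rightarrow> carrier Q" "F i \<odot>\<^bsub>Q\<^esub> b i \<in> carrier Q"
        using insert.prems tQ[OF F] by auto
      then have g': "(\<lambda>i. a \<odot>\<^bsub>Q\<^esub> (F i \<odot>\<^bsub>Q\<^esub> b i)) \<in> I \<rightarrow> carrier Q" "a \<odot>\<^bsub>Q\<^esub> (F i \<odot>\<^bsub>Q\<^esub> b i) \<in> carrier Q"
        using Q.smult_closed[OF a] by auto
      show ?case
        using insert g g' Q.smult_r_distr[OF a g(2) Q.M.finsum_closed[OF g(1)]] by simp
    qed (simp add: Q.smult_zero_right[OF a])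
    then have "a \<odot>\<^bsub>Q\<^esub> \<pi> F = (\<Oplus>\<^bsub>Q\<^esub>i\<in>{..<m}. a \<odot>\<^bsub>Q\<^esub> (F i \<odot>\<^bsub>Q\<^esub> b i))"
      unfolding \<pi>_def by blast
    also have "\<dots> = \<pi> (a \<odot>\<^bsub>?U\<^esub> F)"
      unfolding \<pi>_def
    proof (rule Q.M.finsum_cong')
      fix i assume "i \<in> {..<m}"
      then show "a \<odot>\<^bsub>Q\<^esub> (F i \<odot>\<^bsub>Q\<^esub> b i) = (a \<odot>\<^bsub>?U\<^esub> F) i \<odot>\<^bsub>Q\<^esub> b i"
        using F a bQ Q.smult_assoc[of a "F i" "b i"] by simp
    next
      show "(\<lambda>i. (a \<odot>\<^bsub>?U\<^esub> F) i \<odot>\<^bsub>Q\<^esub> b i) \<in> {..<m} \<rightarrow> carrier Q"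
        using F a bQ by (intro Pi_I Q.smult_closed) auto
    qed simp
    finally show "\<pi> (a \<odot>\<^bsub>?U\<^esub> F) = a \<odot>\<^bsub>Q\<^esub> \<pi> F" by simp
  qed
  have surj: "\<pi> ` carrier ?U = carrier Q"
  proof (intro subset_antisym subsetI)
    fix x assume x: "x \<in> carrier Q"
    obtain c where c: "x = (\<Oplus>\<^bsub>Q\<^esub>b\<in>B. (\<lambda>g. c b * \<one>\<^bsub>monoid_algebra G\<^esub> g) \<odot>\<^bsub>Q\<^esub> b)"
      using bspec[OF span x] by (elim exE)
    define F where "F i = (if i < m then c (b i) *\<^sub>F delta \<one> else 0)" for i
    have F: "F \<in> carrier ?U" by (simp add: F_def)
    have scal: "(\<lambda>g. d * \<one>\<^bsub>monoid_algebra G\<^esub> g) = d *\<^sub>F delta \<one>" for d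
      by (simp add: scale_fun_def)
    have "x = (\<Oplus>\<^bsub>Q\<^esub>y\<in>b ` {..<m}. (c y *\<^sub>F delta \<one>) \<odot>\<^bsub>Q\<^esub> y)"
      using c b unfolding scal by (simp add: bij_betw_def)
    also have "\<dots> = (\<Oplus>\<^bsub>Q\<^esub>i\<in>{..<m}. (c (b i) *\<^sub>F delta \<one>) \<odot>\<^bsub>Q\<^esub> b i)"
      using b bQ by (intro Q.M.finsum_reindex) (auto simp: bij_betw_def intro!: Q.smult_closed)
    also have "\<dots> = \<pi> F"
      unfolding \<pi>_def
    proof (rule Q.M.finsum_cong')
      fix i assume "i \<in> {..<m}"
      then show "(c (b i) *\<^sub>F delta \<one>) \<odot>\<^bsub>Q\<^esub> b i = F i \<odot>\<^bsub>Q\<^esub> b i" by (simp add: F_def)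
    qed (use tQ[OF F] in auto)
    finally show "x \<in> \<pi> ` carrier ?U" using F by blast
  qed (use left_module_homD(1)[OF \<pi>] in blast)
  have "(\<lambda>q. q) \<in> left_module_hom (monoid_algebra G) Q Q" by (rule left_module_homI) simp_all
  then obtain s where s: "s \<in> left_module_hom (monoid_algebra G) Q ?U" "\<forall>q\<in>carrier Q. \<pi> (s q) = q"
    using proj[unfolded projective_module_def, rule_format, OF left_module_free Q \<pi> _ surj] by blast
  note sD = left_module_homD[OF s(1)]
  show ?thesis
  proof (intro exI[of _ m] exI[of _ b] exI[of _ "\<lambda>i q. s q i"] conjI allI impI ballI)
    fix i assume i: "i < m"
    show "b i \<in> carrier Q" by (rule bQ[OF i])
    fix q assume q: "q \<in> carrier Q"
    show "s q i \<in> alg" using sD(1)[OF q] i by simp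
    show "s (q \<oplus>\<^bsub>Q\<^esub> q') i = s q i + s q' i" if "q' \<in> carrier Q" for q'
      using sD(2)[OF q that] by simp
    show "s (a \<odot>\<^bsub>Q\<^esub> q) i = a \<star> s q i" if "a \<in> alg" for a
      using sD(3)[of a q] that q by simp
  next
    fix q assume "q \<in> carrier Q"
    then show "q = (\<Oplus>\<^bsub>Q\<^esub>i\<in>{..<m}. s q i \<odot>\<^bsub>Q\<^esub> b i)"
      using s(2) by (simp only: \<pi>_def)
  qed
qed

lemma ex_summand_smult_nonzero:
  assumes Q: "left_module (monoid_algebra G) Q" and x: "x \<in> alg" and q: "q \<in> carrier Q"
    and nz: "x \<odot>\<^bsub>Q\<^esub> q \<noteq> \<zero>\<^bsub>Q\<^esub>" and sum: "x = (\<Sum>i\<in>I. g i)" and I: "finite I" "\<And>i. i \<in> I \<Longrightarrow> g i \<in> alg"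
  shows "\<exists>i\<in>I. g i \<odot>\<^bsub>Q\<^esub> q \<noteq> \<zero>\<^bsub>Q\<^esub>"
proof (rule ccontr)
  interpret Q: left_module "monoid_algebra G" Q by fact
  assume "\<not> ?thesis"
  then have z: "g i \<odot>\<^bsub>Q\<^esub> q = \<zero>\<^bsub>Q\<^esub>" if "i \<in> I" for i using that by blast
  have "(\<Sum>i\<in>J. g i) \<odot>\<^bsub>Q\<^esub> q = \<zero>\<^bsub>Q\<^esub>" if "finite J" "J \<subseteq> I" for J
    using that
  proof (induction J rule: finite_induct)
    case empty
    have "0 \<odot>\<^bsub>Q\<^esub> q = \<zero>\<^bsub>Q\<^esub>" using Q.smult_zero_left[OF q] by (simp only: monoid_algebra_simps)
    then show ?case by (simp only: sum.empty)
  next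
    case (insert i J)
    have "(\<Sum>i\<in>J. g i) \<in> alg" "g i \<in> alg" using insert.prems I(2) by (auto intro!: functions_on_sum)
    then have "(g i + (\<Sum>i\<in>J. g i)) \<odot>\<^bsub>Q\<^esub> q = g i \<odot>\<^bsub>Q\<^esub> q \<oplus>\<^bsub>Q\<^esub> (\<Sum>i\<in>J. g i) \<odot>\<^bsub>Q\<^esub> q"
      using Q.smult_l_distr[of "g i" "\<Sum>i\<in>J. g i" q] q by (simp only: monoid_algebra_simps)
    also have "\<dots> = \<zero>\<^bsub>Q\<^esub>"
      using insert.IH insert.prems z[of i] by (simp only: insert_subset Q.M.l_zero Q.M.zero_closed)
    finally show ?case by (simp only: sum.insert[OF insert.hyps])
  qed
  then show False using nz sum I(1) by blast
qed

end

section \<open>Comparison of levels and classification of the projectives\<close>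

context partial_functions
begin

text \<open>No function maps \<open>B\<close> onto the larger set \<open>C\<close>.\<close>

lemma mob_conv_mob_eq_0:
  assumes B: "B \<subseteq> {1..n}" and C: "C \<subseteq> {1..n}" and less: "card B < card C" and x: "x \<in> alg"
  shows "mob C \<bullet> x \<bullet> mob B = 0"
proof -
  have "mob C \<bullet> delta s \<bullet> mob B = 0" if s: "s \<in> carrier (PT n)" for s
  proof -
    have "ran (s |` B) \<noteq> C" if dom: "B \<subseteq> dom s"
    proof
      assume ran: "ran (s |` B) = C"
      have "ran (s |` B) \<subseteq> (\<lambda>y. the (s y)) ` B"
      proof
        fix z assume "z \<in> ran (s |` B)"
        then obtain y where "(s |` B) y = Some z" unfolding ran_def by blast
        then have "y \<in> B" "s y = Some z" by (auto simp: restrict_map_def split: if_splits)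
        then show "z \<in> (\<lambda>y. the (s y)) ` B" by (intro image_eqI[of _ _ y]) simp_all
      qed
      then have "card C \<le> card B"
        using ran finite_subset[OF B finite_atLeastAtMost] by (metis surj_card_le)
      then show False using less by simp
    qed
    then show ?thesis using mob_delta_mob[OF s B C] by auto
  qed
  then show ?thesis
    by (subst conv_expand(2)[OF x]) (simp add: bilinear_ext_sum bilinear_ext_scale)
qed

text \<open>A bijection between \<open>B\<close> and \<open>{1..card B}\<close> and its inverse both
  belong to the monoid and carry one Moebius idempotent to the other. This reduces arbitrary sets to
  initial segments.\<close>

lemma mob_factor:
  assumes B: "B \<subseteq> {1..n}"
  shows "\<exists>u\<in>alg. \<exists>w\<in>alg. mob B = u \<bullet> mob {1..card B} \<bullet> w"
proof -
  let ?k = "card B"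
  have fin: "finite B" by (rule finite_subset[OF B]) simp
  have k: "{1..?k} \<subseteq> {1..n}" using card_mono[OF _ B] by simp
  obtain h where h: "bij_betw h {1..?k} B"
    using finite_same_card_bij[of "{1..?k}" B] fin by auto
  let ?h' = "inv_into {1..?k} h"
  have h': "bij_betw ?h' B {1..?k}" by (rule bij_betw_inv_into[OF h])
  define u where "u i = (if i \<in> {1..?k} then Some (h i) else None)" for i
  define w where "w y = (if y \<in> B then Some (?h' y) else None)" for y
  have dom_u: "dom u = {1..?k}" by (auto simp: u_def dom_def)
  have dom_w: "dom w = B" by (auto simp: w_def dom_def)
  have ran_u: "ran u = B"
  proof -
    have "ran u = h ` {1..?k}" unfolding ran_def u_def by (force split: if_splits)
    then show ?thesis using h by (simp add: bij_betw_def)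
  qed
  have ran_w: "ran w = {1..?k}"
  proof -
    have "ran w = ?h' ` B" unfolding ran_def w_def by (force split: if_splits)
    then show ?thesis using h' by (simp add: bij_betw_def)
  qed
  have u: "u \<in> carrier (PT n)" and w: "w \<in> carrier (PT n)"
    using B k by (simp_all add: dom_u ran_u dom_w ran_w)
  have "u \<circ>\<^sub>m w = partial_identity B"
  proof
    fix y show "(u \<circ>\<^sub>m w) y = partial_identity B y"
    proof (cases "y \<in> B")
      case True
      then have "?h' y \<in> {1..?k}" "h (?h' y) = y"
        using bij_betwE[OF h'] bij_betw_inv_into_right[OF h] by blast+
      then show ?thesis using True by (simp add: map_comp_def u_def w_def partial_identity_def)
    next
      case False
      then show ?thesis by (simp add: map_comp_def w_def partial_identity_def)
    qed
  qed
  then have uw: "delta u \<bullet> delta w = delta (partial_identity B)"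
    using conv_delta[OF u w] by simp
  have wB: "w |` B = w" using dom_w by (simp add: restrict_map_eq_iff)
  have "mob {1..?k} \<bullet> delta w \<bullet> mob B = delta w \<bullet> mob B"
    using mob_delta_mob[OF w B k] by (simp add: dom_w wB ran_w)
  then have "delta u \<bullet> mob {1..?k} \<bullet> (delta w \<bullet> mob B) = delta u \<bullet> delta w \<bullet> mob B"
    by (simp add: conv_assoc)
  also have "\<dots> = mob B" unfolding uw by (rule delta_identity_mob[OF B])
  finally have "mob B = delta u \<bullet> mob {1..?k} \<bullet> (delta w \<bullet> mob B)" by simp
  moreover have "delta u \<in> alg" using u by (rule functions_on_closed)
  ultimately show ?thesis using bilinear_ext_in by blast
qed

text \<open>An isomorphism provides a nonzero element between the two idempotents, which bounds one
  level by the other; the inverse isomorphism gives the opposite bound. At equal levels the element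
  comes from the group algebra, where distinct shapes are orthogonal.\<close>

lemma left_ideal_iso_imp_eq:
  assumes "induced n k \<mu>" "induced n l \<nu>"
    and iso: "left_module_iso (monoid_algebra (PT n)) (left_ideal (monoid_algebra (PT n)) (induced.e n k \<mu>))
      (left_ideal (monoid_algebra (PT n)) (induced.e n l \<nu>))"
  shows "k = l \<and> \<mu> = \<nu>"
proof -
  have half: "l \<le> k \<and> (k = l \<longrightarrow> \<mu> = \<nu>)"
    if X: "induced n k \<mu>" and Y: "induced n l \<nu>"
      and iso: "left_module_iso (monoid_algebra (PT n)) (left_ideal (monoid_algebra (PT n)) (induced.e n l \<nu>))
      (left_ideal (monoid_algebra (PT n)) (induced.e n k \<mu>))"
    for k \<mu> l \<nu>
  proof -
    interpret X: induced n k \<mu> by fact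
    interpret Y: induced n l \<nu> by fact
    obtain x where x: "x \<in> alg" "Y.e \<bullet> x \<bullet> X.e \<noteq> 0"
      using Y.E.left_ideal_iso_nonzero[OF X.E.ring_idempotent_axioms iso] Y.e_nonzero by auto
    have "Y.e \<bullet> x \<bullet> X.e = Y.e \<bullet> (Y.f \<bullet> x \<bullet> X.f) \<bullet> X.e"
    proof -
      have "Y.e \<bullet> (Y.f \<bullet> x \<bullet> X.f) \<bullet> X.e = (Y.e \<bullet> Y.f) \<bullet> x \<bullet> (X.f \<bullet> X.e)" by (simp only: conv_assoc)
      then show ?thesis by (simp only: Y.e_f X.f_e)
    qed
    then have nz: "Y.f \<bullet> x \<bullet> X.f \<noteq> 0" using x(2) by auto
    have le: "l \<le> k"
    proof (rule ccontr)
      assume "\<not> l \<le> k"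
      then have "Y.f \<bullet> x \<bullet> X.f = 0"
        by (intro mob_conv_mob_eq_0 X.k_sub Y.k_sub x(1)) simp
      then show False using nz by simp
    qed
    moreover have "\<mu> = \<nu>" if kl: "k = l"
    proof (rule ccontr)
      assume neq: "\<mu> \<noteq> \<nu>"
      obtain b where b: "b \<in> X.S.alg" "X.f \<bullet> x \<bullet> X.f = X.j b" using X.corner[OF x(1)] by blast
      have \<nu>: "is_partition k \<nu>" using Y.Sp.\<mu> kl by simp
      have Ye: "Y.e = X.j (X.S.young_idem \<nu>)" unfolding Y.e_def kl ..
      have "Y.e \<bullet> x \<bullet> X.e = Y.e \<bullet> (X.f \<bullet> x \<bullet> X.f) \<bullet> X.e"
        using \<open>Y.e \<bullet> x \<bullet> X.e = Y.e \<bullet> (Y.f \<bullet> x \<bullet> X.f) \<bullet> X.e\<close> kl by simp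
      also have "\<dots> = X.j (X.S.conv (X.S.conv (X.S.young_idem \<nu>) b) (X.S.young_idem \<mu>))"
        unfolding b(2) Ye X.e_def using b(1) by (simp only: X.j_conv X.S.young_idem_in bilinear_ext_in)
      also have "\<dots> = 0"
        using X.S.young_idem_orthogonal[OF \<nu> X.Sp.\<mu> neq[symmetric] b(1)] X.j_zero by (simp only:)
      finally show False using x(2) by simp
    qed
    ultimately show ?thesis by blast
  qed
  interpret X: induced n k \<mu> by fact
  have iso': "left_module_iso (monoid_algebra (PT n)) (left_ideal (monoid_algebra (PT n)) (induced.e n l \<nu>))
      (left_ideal (monoid_algebra (PT n)) (induced.e n k \<mu>))"
    by (rule left_module_iso_sym[OF X.E.left_module_left_ideal iso])
  show ?thesis
    using half[OF assms(1,2) iso'] half[OF assms(2,1) iso] by auto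
qed

lemma ex_induced_iso:
  fixes Q :: "((nat \<rightharpoonup> nat) \<Rightarrow> complex, 'q) module"
  assumes Q: "left_module (monoid_algebra (PT n)) Q" and fd: "finite_dimensional (PT n) Q"
    and ind: "indecomposable_module (monoid_algebra (PT n)) Q"
    and proj: "projective_module TYPE(nat \<Rightarrow> (nat \<rightharpoonup> nat) \<Rightarrow> complex) TYPE('q) (monoid_algebra (PT n)) Q"
  shows "\<exists>k \<mu>. induced n k \<mu> \<and> left_module_iso (monoid_algebra (PT n)) Q (induced_module n k \<mu>)"
proof -
  let ?A = "monoid_algebra (PT n)"
  interpret Q: left_module ?A Q by fact
  obtain m :: nat and b \<sigma> where basis: "\<forall>i<m. b i \<in> carrier Q \<and> (\<forall>q\<in>carrier Q. \<sigma> i q \<in> alg \<and>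
        (\<forall>q'\<in>carrier Q. \<sigma> i (q \<oplus>\<^bsub>Q\<^esub> q') = \<sigma> i q + \<sigma> i q') \<and>
        (\<forall>a\<in>alg. \<sigma> i (a \<odot>\<^bsub>Q\<^esub> q) = a \<bullet> \<sigma> i q))"
      and expand: "\<forall>q\<in>carrier Q. q = (\<Oplus>\<^bsub>Q\<^esub>i\<in>{..<m}. \<sigma> i q \<odot>\<^bsub>Q\<^esub> b i)"
    using dual_basis[OF Q fd proj] by (elim exE conjE)
  have b: "b i \<in> carrier Q" if "i < m" for i using basis that by blast
  have \<sigma>_in: "\<sigma> i q \<in> alg" if "i < m" "q \<in> carrier Q" for i q using basis that by blast
  have \<sigma>_add: "\<sigma> i (q \<oplus>\<^bsub>Q\<^esub> q') = \<sigma> i q + \<sigma> i q'"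
    if "i < m" "q \<in> carrier Q" "q' \<in> carrier Q" for i q q' using basis that by blast
  have \<sigma>_smult: "\<sigma> i (a \<odot>\<^bsub>Q\<^esub> q) = a \<bullet> \<sigma> i q"
    if "i < m" "a \<in> alg" "q \<in> carrier Q" for i a q using basis that by blast
  note \<sigma>_sum = bspec[OF expand]
  have cl: "x \<odot>\<^bsub>Q\<^esub> q \<in> carrier Q" if "x \<in> alg" "q \<in> carrier Q" for x q
    using Q.smult_closed that by simp
  have as: "(x \<bullet> y) \<odot>\<^bsub>Q\<^esub> q = x \<odot>\<^bsub>Q\<^esub> (y \<odot>\<^bsub>Q\<^esub> q)" if "x \<in> alg" "y \<in> alg" "q \<in> carrier Q" for x y q
    using Q.smult_assoc that by simp
  have zr: "x \<odot>\<^bsub>Q\<^esub> \<zero>\<^bsub>Q\<^esub> = \<zero>\<^bsub>Q\<^esub>" if "x \<in> alg" for x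
    using Q.smult_zero_right that by simp
  note ex_sum = ex_summand_smult_nonzero[OF Q]
  \<comment> \<open>The levels visible in \<open>Q\<close>; by \<open>mob_factor\<close>, a set
    \<open>B\<close> acting nontrivially puts \<open>card B\<close> among them.\<close>
  define K where "K = {k. k \<le> n \<and> (\<exists>q\<in>carrier Q. mob {1..k} \<odot>\<^bsub>Q\<^esub> q \<noteq> \<zero>\<^bsub>Q\<^esub>)}"
  have K_card: "card B \<in> K" if B: "B \<subseteq> {1..n}" and q: "q \<in> carrier Q" "mob B \<odot>\<^bsub>Q\<^esub> q \<noteq> \<zero>\<^bsub>Q\<^esub>" for B q
  proof -
    obtain u w where uw: "u \<in> alg" "w \<in> alg" "mob B = u \<bullet> mob {1..card B} \<bullet> w"
      using mob_factor[OF B] by blast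
    have kn: "card B \<le> n" using card_mono[OF _ B] by simp
    then have f: "mob {1..card B} \<in> alg" by (intro mob_in) auto
    have "mob B \<odot>\<^bsub>Q\<^esub> q = u \<odot>\<^bsub>Q\<^esub> (mob {1..card B} \<odot>\<^bsub>Q\<^esub> (w \<odot>\<^bsub>Q\<^esub> q))"
      unfolding uw(3) using uw(1,2) f q(1) by (simp only: as bilinear_ext_in cl)
    then have "mob {1..card B} \<odot>\<^bsub>Q\<^esub> (w \<odot>\<^bsub>Q\<^esub> q) \<noteq> \<zero>\<^bsub>Q\<^esub>"
      using q(2) zr[OF uw(1)] by metis
    then show ?thesis unfolding K_def using kn cl[OF uw(2) q(1)] by blast
  qed
  have one: "delta \<one>\<^bsub>PT n\<^esub> \<in> alg" by (rule functions_on_closed) (rule one_closed)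
  have "carrier Q \<noteq> {\<zero>\<^bsub>Q\<^esub>}" using ind by (simp add: indecomposable_module_def)
  then obtain q\<^sub>0 where q\<^sub>0: "q\<^sub>0 \<in> carrier Q" "q\<^sub>0 \<noteq> \<zero>\<^bsub>Q\<^esub>" using Q.M.zero_closed by blast
  then have "delta \<one>\<^bsub>PT n\<^esub> \<odot>\<^bsub>Q\<^esub> q\<^sub>0 \<noteq> \<zero>\<^bsub>Q\<^esub>" using Q.smult_one[OF q\<^sub>0(1)] by simp
  then have "\<exists>B\<in>Pow {1..n}. mob B \<odot>\<^bsub>Q\<^esub> q\<^sub>0 \<noteq> \<zero>\<^bsub>Q\<^esub>"
    by (rule ex_sum[OF one q\<^sub>0(1) _ sum_mob[symmetric]]) (auto intro: mob_in)
  then have "K \<noteq> {}" using K_card[OF _ q\<^sub>0(1)] by blast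
  moreover have finK: "finite K" unfolding K_def by simp
  ultimately have "Max K \<in> K" by (rule Max_in[rotated])
  define k where "k = Max K"
  have k: "k \<in> K" and k_max: "\<And>B q. B \<subseteq> {1..n} \<Longrightarrow> q \<in> carrier Q \<Longrightarrow> mob B \<odot>\<^bsub>Q\<^esub> q \<noteq> \<zero>\<^bsub>Q\<^esub> \<Longrightarrow> card B \<le> k"
    using \<open>Max K \<in> K\<close> Max_ge[OF finK K_card] unfolding k_def by auto
  then have kn: "k \<le> n" unfolding K_def by blast
  obtain q\<^sub>1 where q\<^sub>1: "q\<^sub>1 \<in> carrier Q" "mob {1..k} \<odot>\<^bsub>Q\<^esub> q\<^sub>1 \<noteq> \<zero>\<^bsub>Q\<^esub>" using k unfolding K_def by blast
  interpret lev: pt_level n k by unfold_locales (rule kn)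
  let ?j = lev.j
  have j_one: "?j (\<Sum>\<mu>\<in>lev.S.parts. c \<mu> *\<^sub>F lev.S.central_young \<mu>) =
      (\<Sum>\<mu>\<in>lev.S.parts. c \<mu> *\<^sub>F ?j (lev.S.central_young \<mu>))" for c
    by (simp only: lev.j_linear)
  obtain c where c: "delta id = (\<Sum>\<mu>\<in>lev.S.parts. c \<mu> *\<^sub>F lev.S.central_young \<mu>)"
    using lev.S.one_eq_sum_central_young by blast
  \<comment> \<open>The decomposition of the identity of the group algebra becomes one of
    \<open>f\<close>, so some shape acts nontrivially; expanding its central element over conjugates
    then isolates a single Young idempotent.\<close>
  have "mob {1..k} = (\<Sum>\<mu>\<in>lev.S.parts. c \<mu> *\<^sub>F ?j (lev.S.central_young \<mu>))"
    unfolding j_one[symmetric] c[symmetric] lev.j_one ..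
  then have "\<exists>\<mu>\<in>lev.S.parts. (c \<mu> *\<^sub>F ?j (lev.S.central_young \<mu>)) \<odot>\<^bsub>Q\<^esub> q\<^sub>1 \<noteq> \<zero>\<^bsub>Q\<^esub>"
    by (rule ex_sum[OF lev.f_in q\<^sub>1]) (auto simp: lev.S.parts_def finite_partitions)
  then obtain \<mu> where \<mu>: "is_partition k \<mu>" and c\<mu>: "(c \<mu> *\<^sub>F ?j (lev.S.central_young \<mu>)) \<odot>\<^bsub>Q\<^esub> q\<^sub>1 \<noteq> \<zero>\<^bsub>Q\<^esub>"
    unfolding lev.S.parts_def by blast
  interpret X: induced n k \<mu> by unfold_locales (rule \<mu>)
  have "(c \<mu> *\<^sub>F ?j (lev.S.central_young \<mu>)) \<odot>\<^bsub>Q\<^esub> q\<^sub>1 =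
      (c \<mu> *\<^sub>F delta \<one>\<^bsub>PT n\<^esub>) \<odot>\<^bsub>Q\<^esub> (?j (lev.S.central_young \<mu>) \<odot>\<^bsub>Q\<^esub> q\<^sub>1)"
    using as[OF functions_on_closed(3)[OF one] lev.j_in q\<^sub>1(1), of "c \<mu>"]
    by (simp only: bilinear_ext_scale conv_one lev.j_in)
  then have "?j (lev.S.central_young \<mu>) \<odot>\<^bsub>Q\<^esub> q\<^sub>1 \<noteq> \<zero>\<^bsub>Q\<^esub>"
    using c\<mu> zr[OF functions_on_closed(3)[OF one]] by metis
  moreover have "?j (lev.S.central_young \<mu>) =
      (\<Sum>g\<in>carrier (sym_group k). ?j (delta g) \<bullet> X.e \<bullet> ?j (delta (inv' g)))"
    unfolding lev.S.central_young_def lev.S.conj_sum_def lev.j_linear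
  proof (intro sum.cong refl)
    fix g assume g: "g \<in> carrier (sym_group k)"
    then have "delta g \<in> lev.S.alg" "delta (inv' g) \<in> lev.S.alg"
      by (auto intro!: functions_on_closed permutes_inv)
    then show "?j (lev.S.conv (lev.S.conv (delta g) (lev.S.young_idem \<mu>)) (delta (inv\<^bsub>sym_group k\<^esub> g))) =
        ?j (delta g) \<bullet> X.e \<bullet> ?j (delta (inv' g))"
      using g by (simp add: lev.j_conv X.e_def)
  qed
  ultimately have "\<exists>g\<in>carrier (sym_group k). (?j (delta g) \<bullet> X.e \<bullet> ?j (delta (inv' g))) \<odot>\<^bsub>Q\<^esub> q\<^sub>1 \<noteq> \<zero>\<^bsub>Q\<^esub>"
    by (intro ex_sum[OF lev.j_in q\<^sub>1(1)]) (auto simp del: lev.S.sym_group_simps)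
  then obtain g where g: "(?j (delta g) \<bullet> X.e \<bullet> ?j (delta (inv' g))) \<odot>\<^bsub>Q\<^esub> q\<^sub>1 \<noteq> \<zero>\<^bsub>Q\<^esub>" by blast
  define v where "v = X.e \<odot>\<^bsub>Q\<^esub> (?j (delta (inv' g)) \<odot>\<^bsub>Q\<^esub> q\<^sub>1)"
  have v: "v \<in> carrier Q" unfolding v_def by (intro cl X.e_in lev.j_in q\<^sub>1(1))
  have ev: "X.e \<odot>\<^bsub>Q\<^esub> v = v"
    unfolding v_def using as[OF X.e_in X.e_in cl[OF lev.j_in q\<^sub>1(1)]] by (simp only: X.e_idem)
  have v0: "v \<noteq> \<zero>\<^bsub>Q\<^esub>"
  proof
    assume "v = \<zero>\<^bsub>Q\<^esub>"
    then have "(?j (delta g) \<bullet> X.e \<bullet> ?j (delta (inv' g))) \<odot>\<^bsub>Q\<^esub> q\<^sub>1 = \<zero>\<^bsub>Q\<^esub>"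
      using zr[OF lev.j_in] unfolding v_def
      by (simp only: as bilinear_ext_in lev.j_in X.e_in q\<^sub>1(1) cl)
    then show False using g by simp
  qed
  \<comment> \<open>A coordinate is selected whose whole contribution
    \<open>\<sigma> i v \<odot> b i\<close> is nonzero, not just \<open>\<sigma> i v\<close>: the
    vector \<open>b i\<close> is what the maximality of \<open>k\<close> is applied to
    below.\<close>
  have "(\<Oplus>\<^bsub>Q\<^esub>i\<in>{..<m}. \<sigma> i v \<odot>\<^bsub>Q\<^esub> b i) \<noteq> \<zero>\<^bsub>Q\<^esub>" using \<sigma>_sum[OF v] v0 by simp
  then obtain i where i: "i < m" "\<sigma> i v \<odot>\<^bsub>Q\<^esub> b i \<noteq> \<zero>\<^bsub>Q\<^esub>"
    by (rule Q.finsum_nonzeroE) (use cl \<sigma>_in v b in auto)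
  define y where "y = \<sigma> i v"
  have y: "y \<in> alg" unfolding y_def by (rule \<sigma>_in[OF i(1) v])
  have ey: "X.e \<bullet> y = y" unfolding y_def using \<sigma>_smult[OF i(1) X.e_in v] ev by simp
  have "y = (\<Sum>B\<in>Pow {1..n}. y \<bullet> mob B)"
    unfolding bilinear_ext_sum[symmetric] sum_mob conv_one(2)[OF y] ..
  then have "\<exists>B\<in>Pow {1..n}. (y \<bullet> mob B) \<odot>\<^bsub>Q\<^esub> b i \<noteq> \<zero>\<^bsub>Q\<^esub>"
    using i(2) unfolding y_def[symmetric] by (intro ex_sum[OF y b[OF i(1)]]) auto
  then obtain B where B: "B \<subseteq> {1..n}" "(y \<bullet> mob B) \<odot>\<^bsub>Q\<^esub> b i \<noteq> \<zero>\<^bsub>Q\<^esub>" by blast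
  have "mob B \<odot>\<^bsub>Q\<^esub> b i \<noteq> \<zero>\<^bsub>Q\<^esub>"
    using B(2) as[OF y mob_in[OF B(1)] b[OF i(1)]] zr[OF y] by metis
  then have Bk: "card B \<le> k" by (rule k_max[OF B(1) b[OF i(1)]])
  have yB: "y \<bullet> mob B \<noteq> 0"
  proof
    assume "y \<bullet> mob B = 0"
    then show False using B(2) Q.smult_zero_left[OF b[OF i(1)]] by simp
  qed
  have fy: "lev.f \<bullet> y = y"
  proof -
    have "lev.f \<bullet> y = (lev.f \<bullet> X.e) \<bullet> y" by (simp only: conv_assoc ey)
    then show ?thesis by (simp only: X.f_e ey)
  qed
  \<comment> \<open>Maximality bounds \<open>card B\<close> from above; a smaller \<open>B\<close>
    would be killed, since \<open>y\<close> carries a factor \<open>f\<close> on its left.\<close>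
  have "card B = k"
  proof (rule ccontr)
    assume "card B \<noteq> k"
    then have "lev.f \<bullet> y \<bullet> mob B = 0"
      using Bk by (intro mob_conv_mob_eq_0 B(1) lev.k_sub y) simp
    then show False using yB fy by simp
  qed
  then obtain u w where uw: "u \<in> alg" "w \<in> alg" "mob B = u \<bullet> lev.f \<bullet> w"
    using mob_factor[OF B(1)] by blast
  \<comment> \<open>Transports \<open>y \<bullet> mob B\<close> into the corner
    \<open>f A f\<close>, that is, into the group algebra.\<close>
  define Y where "Y = y \<bullet> u \<bullet> lev.f"
  have Y: "Y \<in> alg" "Y \<noteq> 0"
  proof -
    have "y \<bullet> mob B = Y \<bullet> w" unfolding uw(3) Y_def by (simp only: conv_assoc)
    then show "Y \<noteq> 0" using yB by auto
  qed (simp add: Y_def)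
  have eY: "X.e \<bullet> Y = Y" and fYf: "lev.f \<bullet> Y \<bullet> lev.f = Y"
    unfolding Y_def by (simp_all only: conv_assoc[symmetric] ey fy) (simp only: conv_assoc mob_idem[OF lev.k_sub])
  obtain z where z: "z \<in> lev.S.alg" "Y = ?j z" using lev.corner[OF Y(1)] fYf by metis
  have ez: "lev.S.conv (lev.S.young_idem \<mu>) z = z"
    using eY unfolding z(2) X.e_def lev.j_conv[OF lev.S.young_idem_in z(1), symmetric]
    by (intro lev.j_inj bilinear_ext_in z(1))
  \<comment> \<open>Up to a scalar the adjoint inverts \<open>z\<close> from the right:
    \<open>z\<close> times its adjoint lies in the one-dimensional corner of the Young idempotent
    and is nonzero by positivity.\<close>
  let ?s = "lev.S.star z"
  have z0: "z \<noteq> 0" using Y(2) z(2) X.j_zero by auto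
  have zs: "lev.S.conv z ?s \<noteq> 0" using lev.S.conv_star_eq_0_iff[OF z(1)] z0 by auto
  have se: "lev.S.conv ?s (lev.S.young_idem \<mu>) = ?s"
    using arg_cong[OF ez, of lev.S.star] unfolding lev.S.star_conv lev.S.young_idem(3)[OF \<mu>] .
  obtain d where d: "X.e \<bullet> (Y \<bullet> ?j ?s) \<bullet> X.e = d *\<^sub>F X.e"
    using X.e_scalar[OF bilinear_ext_in] by blast
  have "Y \<bullet> ?j ?s = ?j (lev.S.conv z ?s)"
    unfolding z(2) by (rule lev.j_conv[OF z(1) lev.S.star_in, symmetric])
  moreover have "?j (lev.S.conv z ?s) \<noteq> 0"
    using zs lev.j_inj[OF bilinear_ext_in functions_on_closed(1)] X.j_zero by metis
  ultimately have Ys: "Y \<bullet> ?j ?s \<noteq> 0" by simp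
  have "?j ?s \<bullet> X.e = ?j ?s"
    unfolding X.e_def lev.j_conv[OF lev.S.star_in lev.S.young_idem_in, symmetric] se ..
  then have "X.e \<bullet> (Y \<bullet> ?j ?s) \<bullet> X.e = Y \<bullet> ?j ?s"
    using eY by (metis conv_assoc)
  then have d': "Y \<bullet> ?j ?s = d *\<^sub>F X.e" using d by (rule trans[OF sym])
  then have d0: "d \<noteq> 0" using Ys by auto
  \<comment> \<open>A functional followed by right multiplication remains a homomorphism; the
    factors carry \<open>\<sigma> i v\<close> first to \<open>Y\<close>, then to \<open>d\<close>
    times \<open>X.e\<close>, and the scalar normalises.\<close>
  define \<beta> where "\<beta> q = \<sigma> i q \<bullet> (u \<bullet> lev.f \<bullet> ?j ?s \<bullet> (inverse d *\<^sub>F X.e))" for q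
  have "\<beta> v = (Y \<bullet> ?j ?s) \<bullet> (inverse d *\<^sub>F X.e)"
    unfolding \<beta>_def y_def[symmetric] Y_def by (simp only: conv_assoc)
  also have "\<dots> = X.e"
    unfolding d' using d0 by (simp add: bilinear_ext_scale X.e_idem)
  finally have \<beta>v: "\<beta> v = X.e" .
  have \<beta>: "\<beta> \<in> left_module_hom ?A Q (left_ideal ?A X.e)"
  proof (rule left_module_homI)
    fix q q' assume q: "q \<in> carrier Q" "q' \<in> carrier Q"
    show "\<beta> q \<in> carrier (left_ideal ?A X.e)"
      unfolding X.E.left_ideal_iff monoid_algebra_simps \<beta>_def
      by (simp add: conv_assoc bilinear_ext_scale X.e_idem)
    show "\<beta> (q \<oplus>\<^bsub>Q\<^esub> q') = \<beta> q \<oplus>\<^bsub>left_ideal ?A X.e\<^esub> \<beta> q'"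
      using \<sigma>_add[OF i(1) q] by (simp add: \<beta>_def bilinear_ext_add)
  next
    fix a q assume "a \<in> carrier ?A" "q \<in> carrier Q"
    then show "\<beta> (a \<odot>\<^bsub>Q\<^esub> q) = a \<odot>\<^bsub>left_ideal ?A X.e\<^esub> \<beta> q"
      using \<sigma>_smult[OF i(1), of a q] by (simp add: \<beta>_def conv_assoc)
  qed
  have "left_module_iso ?A Q (left_ideal ?A X.e)"
    by (rule X.E.indecomposable_iso_left_ideal[OF Q ind _ v \<beta> \<beta>v]) (simp add: X.e_nonzero)
  then have "left_module_iso ?A Q (induced_module n k \<mu>)"
    using X.induced_iso by (rule left_module_iso_trans)
  then show ?thesis using X.induced_axioms by blast
qed

end

lemma induced_iff: "induced n k \<mu> \<longleftrightarrow> k \<le> n \<and> is_partition k \<mu>"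
  by (simp add: induced_def pt_level_def specht_def)

text \<open>The first part holds at arbitrary types \<open>'u\<close> and \<open>'v\<close>, which
  amounts to projectivity. The third uses lifting at a single pair of types, that of the free
  modules and that of \<open>Q\<close>, so it covers every projective \<open>Q\<close>.\<close>

theorem theorem7p1:
  fixes n :: nat
  assumes "n \<ge> 1"
  shows "(\<forall>k \<mu>. k \<le> n \<longrightarrow> is_partition k \<mu> \<longrightarrow>
            left_module (monoid_algebra (PT n)) (induced_module n k \<mu>) \<and>
            finite_dimensional (PT n) (induced_module n k \<mu>) \<and>
            indecomposable_module (monoid_algebra (PT n)) (induced_module n k \<mu>) \<and>
            projective_module TYPE('u) TYPE('v) (monoid_algebra (PT n)) (induced_module n k \<mu>))
       \<and> (\<forall>k \<mu> l \<nu>. k \<le> n \<longrightarrow> is_partition k \<mu> \<longrightarrow> l \<le> n \<longrightarrow> is_partition l \<nu> \<longrightarrow>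
            left_module_iso (monoid_algebra (PT n)) (induced_module n k \<mu>) (induced_module n l \<nu>) \<longrightarrow>
            k = l \<and> \<mu> = \<nu>)
       \<and> (\<forall>Q :: ((nat \<rightharpoonup> nat) \<Rightarrow> complex, 'q) module.
            left_module (monoid_algebra (PT n)) Q \<longrightarrow>
            finite_dimensional (PT n) Q \<longrightarrow>
            indecomposable_module (monoid_algebra (PT n)) Q \<longrightarrow>
            projective_module TYPE(nat \<Rightarrow> (nat \<rightharpoonup> nat) \<Rightarrow> complex) TYPE('q) (monoid_algebra (PT n)) Q \<longrightarrow>
            (\<exists>k \<mu>. k \<le> n \<and> is_partition k \<mu> \<and>
               left_module_iso (monoid_algebra (PT n)) Q (induced_module n k \<mu>)))"
proof (intro conjI allI impI)
  fix k \<mu> assume "k \<le> n" "is_partition k \<mu>"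
  then interpret induced n k \<mu> by (simp add: induced_iff)
  show "left_module (monoid_algebra (PT n)) (induced_module n k \<mu>)"
    by (rule left_module_induced)
  show "finite_dimensional (PT n) (induced_module n k \<mu>)"
    by (rule finite_dimensional_induced)
  show "indecomposable_module (monoid_algebra (PT n)) (induced_module n k \<mu>)"
    by (rule indecomposable_induced)
  show "projective_module TYPE('u) TYPE('v) (monoid_algebra (PT n)) (induced_module n k \<mu>)"
    by (rule projective_induced)
next
  fix k \<mu> l \<nu>
  assume "k \<le> n" "is_partition k \<mu>" "l \<le> n" "is_partition l \<nu>"
    and iso: "left_module_iso (monoid_algebra (PT n)) (induced_module n k \<mu>) (induced_module n l \<nu>)"
  then have X: "induced n k \<mu>" and Y: "induced n l \<nu>" by (simp_all add: induced_iff)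
  interpret X: induced n k \<mu> by fact
  interpret Y: induced n l \<nu> by fact
  have "left_module_iso (monoid_algebra (PT n)) (left_ideal (monoid_algebra (PT n)) X.e)
      (left_ideal (monoid_algebra (PT n)) Y.e)"
    using X.induced_iso iso left_module_iso_sym[OF Y.E.left_module_left_ideal Y.induced_iso]
    by (blast intro: left_module_iso_trans)
  from X.P.left_ideal_iso_imp_eq[OF X Y this] show "k = l" "\<mu> = \<nu>" by blast+
next
  fix Q :: "((nat \<rightharpoonup> nat) \<Rightarrow> complex, 'q) module"
  assume "left_module (monoid_algebra (PT n)) Q" "finite_dimensional (PT n) Q"
    "indecomposable_module (monoid_algebra (PT n)) Q"
    "projective_module TYPE(nat \<Rightarrow> (nat \<rightharpoonup> nat) \<Rightarrow> complex) TYPE('q) (monoid_algebra (PT n)) Q"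
  then show "\<exists>k \<mu>. k \<le> n \<and> is_partition k \<mu> \<and>
      left_module_iso (monoid_algebra (PT n)) Q (induced_module n k \<mu>)"
    using partial_functions.ex_induced_iso[of n Q] by (simp add: induced_iff)
qed

end
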